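(* Let $h\ge1$ be an integer. Then there exists a constant $\beta_h\in\mathbb Q(\log 2)$ such that $$b_h(n)\sim\beta_h\,\frac{3^{1/4}}{2\pi n^{1/4}}\,e^{\pi\sqrt{n/3}}\qquad\text{as } n\to\infty.$$ Furthermore, $\beta_h\in\mathbb Q$ if and only if $h$ is even.
   Context: A partition $\lambda=(\lambda_1\ge\lambda_2\ge\dots\ge\lambda_\ell>0)$ of $n$ is drawn as its Ferrers diagram: left-adjusted rows of boxes, with $\lambda_i$ boxes in row $i$. The hook number of the box in row $i$ and column $j$ is the number of boxes in the L-shape consisting of that box, all boxes to its right in the same row, and all boxes below it in the same column. $\mathcal H(\lambda)$ denotes the multiset of all hook numbers of $\lambda$. Let $\mathcal D(n)$ be the set of partitions of $n$ whose parts are pairwise distinct. For integers $h\ge1$ and $n\ge0$, define $$b_h(n)=\sum_{\lambda\in\mathcal D(n)}\#\{x\in\mathcal H(\lambda):x=h\},$$ counted with multiplicity. Here $f(n)\sim g(n)$ means $f(n)/g(n)\to1$, $\log$ is the natural logarithm, and $\mathbb Q(\log 2)$ is the subfield of $\mathbb R$ generated by $\log 2$. *)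

theory Defs
  imports
    "HOL-Analysis.Analysis"
    "HOL-Library.Multiset"
    "HOL-Library.Landau_Symbols"
    "HOL-Algebra.Generated_Fields"
    "HOL-Algebra.Algebraic_Closure_Type"
begin

definition partitions :: "nat \<Rightarrow> nat list set" where
  "partitions n = {xs. sorted_wrt (\<ge>) xs \<and> (\<forall>x\<in>set xs. 0 < x) \<and> sum_list xs = n}"

definition distinct_partitions :: "nat \<Rightarrow> nat list set" where
  "distinct_partitions n = {xs \<in> partitions n. distinct xs}"

(* Boxes are pairs (row, column), both counted from 0. *)
definition ferrers :: "nat list \<Rightarrow> (nat \<times> nat) set" where
  "ferrers xs = {(i, j). i < length xs \<and> j < xs ! i}"

definition hook :: "nat list \<Rightarrow> nat \<times> nat \<Rightarrow> (nat \<times> nat) set" where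
  "hook xs = (\<lambda>(i, j). {(i', j') \<in> ferrers xs. i' = i \<and> j \<le> j' \<or> j' = j \<and> i \<le> i'})"

definition hook_number :: "nat list \<Rightarrow> nat \<times> nat \<Rightarrow> nat" where
  "hook_number xs x = card (hook xs x)"

definition hook_numbers :: "nat list \<Rightarrow> nat multiset" where
  "hook_numbers xs = image_mset (hook_number xs) (mset_set (ferrers xs))"

definition hook_count :: "nat \<Rightarrow> nat \<Rightarrow> nat" where
  "hook_count h n = (\<Sum>xs\<in>distinct_partitions n. count (hook_numbers xs) h)"

definition Rats_ln2 :: "real set" where
  "Rats_ln2 = generate_field ring_of_type_algebra {ln 2}"

(* Finiteness of the index sets: neither sum nor mset_set above falls back to its default value. *)

lemma finite_ferrers: "finite (ferrers xs)"
proof -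
  have "ferrers xs = (SIGMA i:{..<length xs}. {..<xs ! i})"
    by (auto simp: ferrers_def)
  then show ?thesis by simp
qed

lemma finite_partitions: "finite (partitions n)"
proof (rule finite_subset)
  show "partitions n \<subseteq> {xs. set xs \<subseteq> {..n} \<and> length xs \<le> n}"
  proof
    fix xs assume xs: "xs \<in> partitions n"
    have "length ys \<le> sum_list ys" if "\<forall>y\<in>set ys. 0 < y" for ys :: "nat list"
      using that by (induction ys) auto
    with xs show "xs \<in> {xs. set xs \<subseteq> {..n} \<and> length xs \<le> n}"
      by (auto simp: partitions_def member_le_sum_list)
  qed
  show "finite {xs. set xs \<subseteq> {..n} \<and> length xs \<le> n}"
    by (rule finite_lists_length_le) simp
qed

lemma finite_distinct_partitions: "finite (distinct_partitions n)"
  by (simp add: distinct_partitions_def finite_partitions)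

end

theory Submission
  imports Defs "HOL-Probability.Probability" "HOL-Real_Asymp.Real_Asymp"
begin

text \<open>
  A partition into distinct parts is a finite set of positive integers, and a hook of length \<open>h\<close> in it
  is a part \<open>m\<close> together with an arm length \<open>d \<le> h\<close> such that exactly \<open>h - d\<close> further parts lie strictly
  between \<open>m - d\<close> and \<open>m\<close>. Hence the count is a sum, over \<open>d\<close>, \<open>m\<close> and the \<open>d - 1\<close> choose \<open>h - d\<close>
  possible patterns in that window, of numbers of sets with sum \<open>n\<close> and a prescribed trace on the window.
  Each of these is a Fourier coefficient of a product; at the saddle point \<open>z = \<pi> / (2 \<surd>3 \<surd>n)\<close>
  it is governed by a local central limit theorem for independent Bernoulli variables with parameters
  \<open>1 / (exp (k z) + 1)\<close>. For \<open>m = x \<surd>n\<close> the prescribed pattern contributes the factor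
  \<open>v ^ (h - d + 1) / (1 + v) ^ d\<close> with \<open>v\<close> the limit of \<open>exp (- m z)\<close>, and summing over \<open>m\<close> turns it into
  the integral of \<open>v ^ (h - d) / (1 + v) ^ d\<close> over the unit interval. Modulo rational numbers that
  integral is an integer multiple of \<open>ln 2\<close>; in the total the coefficient of \<open>ln 2\<close> is 1 for odd \<open>h\<close> and
  0 for even \<open>h\<close>, and \<open>ln 2\<close> is irrational by Niven's argument.
\<close>

definition distinct_part_sets :: "nat \<Rightarrow> nat set set" where
  "distinct_part_sets n = {A. A \<subseteq> {1..n} \<and> \<Sum>A = n}"

definition prescribed_count :: "nat \<Rightarrow> nat set \<Rightarrow> nat set \<Rightarrow> nat" where
  "prescribed_count n U W = card {A \<in> distinct_part_sets n. A \<inter> W = U}"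

definition hook_patterns :: "nat \<Rightarrow> nat \<Rightarrow> nat set set" where
  "hook_patterns h d = {T. T \<subseteq> {..<d} \<and> 0 \<in> T \<and> card T = h - d + 1}"

lemma finite_distinct_part_sets: "finite (distinct_part_sets n)"
  unfolding distinct_part_sets_def by (rule finite_subset[of _ "Pow {1..n}"]) auto

lemma finite_hook_patterns: "finite (hook_patterns h d)"
  unfolding hook_patterns_def by (rule finite_subset[of _ "Pow {..<d}"]) auto

lemma bij_betw_distinct_partitions:
  "bij_betw set (distinct_partitions n) (distinct_part_sets n)"
proof (rule bij_betwI')
  fix xs ys assume "xs \<in> distinct_partitions n" "ys \<in> distinct_partitions n"
  then have "sorted (rev xs)" "distinct (rev xs)" "sorted (rev ys)" "distinct (rev ys)"
    by (auto simp: distinct_partitions_def partitions_def sorted_wrt_rev)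
  then show "(set xs = set ys) = (xs = ys)"
    by (metis rev_rev_ident set_rev sorted_distinct_set_unique)
next
  fix xs assume "xs \<in> distinct_partitions n"
  then show "set xs \<in> distinct_part_sets n"
    using member_le_sum_list[of _ xs] by (auto simp: distinct_part_sets_def distinct_partitions_def
        partitions_def Suc_le_eq simp flip: distinct_sum_list_conv_Sum)
next
  fix A assume A: "A \<in> distinct_part_sets n"
  then have fin: "finite A" by (auto simp: distinct_part_sets_def intro: finite_subset)
  have "rev (sorted_list_of_set A) \<in> distinct_partitions n"
    using A fin by (auto simp: distinct_partitions_def partitions_def distinct_part_sets_def
        sorted_wrt_rev distinct_sum_list_conv_Sum)
  moreover have "A = set (rev (sorted_list_of_set A))" using fin by simp
  ultimately show "\<exists>xs\<in>distinct_partitions n. A = set xs" by blast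
qed

lemma distinct_partition_strict:
  assumes "xs \<in> distinct_partitions n" "i < k" "k < length xs"
  shows "xs ! k < xs ! i"
proof -
  have "xs ! i \<ge> xs ! k" "xs ! i \<noteq> xs ! k"
    using assms by (auto simp: distinct_partitions_def partitions_def sorted_wrt_iff_nth_less nth_eq_iff_index_eq)
  then show ?thesis by simp
qed

lemma hook_number_distinct:
  assumes xs: "xs \<in> distinct_partitions n" and ij: "(i, j) \<in> ferrers xs"
  shows "hook_number xs (i, j) = (xs ! i - j) + card (set xs \<inter> {j<..<xs ! i})"
proof -
  have i: "i < length xs" "j < xs ! i" using ij by (auto simp: ferrers_def)
  let ?L = "{k. i < k \<and> k < length xs \<and> j < xs ! k}"
  have "hook xs (i, j) = {i} \<times> {j..<xs ! i} \<union> ?L \<times> {j}"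
    using i by (auto simp: hook_def ferrers_def order_le_less)
  moreover have "finite ?L" by (rule finite_subset[of _ "{..<length xs}"]) auto
  moreover have "({i} \<times> {j..<xs ! i}) \<inter> (?L \<times> {j}) = {}" by auto
  ultimately have 1: "hook_number xs (i, j) = (xs ! i - j) + card ?L"
    by (simp add: hook_number_def card_Un_disjoint card_cartesian_product)
  have "bij_betw ((!) xs) ?L (set xs \<inter> {j<..<xs ! i})"
  proof (rule bij_betwI')
    fix x y assume "x \<in> ?L" "y \<in> ?L"
    then show "(xs ! x = xs ! y) = (x = y)"
      using xs by (auto simp: distinct_partitions_def nth_eq_iff_index_eq)
  next
    fix x assume "x \<in> ?L" then show "xs ! x \<in> set xs \<inter> {j<..<xs ! i}"
      using distinct_partition_strict[OF xs, of i x] by auto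
  next
    fix y assume y: "y \<in> set xs \<inter> {j<..<xs ! i}"
    then obtain k where k: "k < length xs" "y = xs ! k" by (auto simp: in_set_conv_nth)
    have "i < k"
    proof (rule ccontr)
      assume "\<not> i < k"
      then have "k < i \<or> k = i" by linarith
      then have "xs ! k \<ge> xs ! i" using distinct_partition_strict[OF xs, of k i] i by auto
      with y k show False by auto
    qed
    then show "\<exists>x\<in>?L. y = xs ! x" using k y by auto
  qed
  from bij_betw_same_card[OF this] 1 show ?thesis by simp
qed

lemma count_hook_numbers:
  assumes xs: "xs \<in> distinct_partitions n"
  shows "count (hook_numbers xs) h =
    card {(m, d). m \<in> set xs \<and> d \<in> {1..m} \<and> d + card (set xs \<inter> {m - d<..<m}) = h}"
proof -
  let ?F = "{x \<in> ferrers xs. hook_number xs x = h}"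
  have "count (hook_numbers xs) h = card ?F"
    unfolding hook_numbers_def count_image_mset using finite_ferrers[of xs]
    by (simp add: vimage_def Int_def conj_commute)
  also have "bij_betw (\<lambda>(i, j). (xs ! i, xs ! i - j)) ?F
      {(m, d). m \<in> set xs \<and> d \<in> {1..m} \<and> d + card (set xs \<inter> {m - d<..<m}) = h}"
    (is "bij_betw ?f _ ?G")
  proof (rule bij_betwI')
    fix x y assume "x \<in> ?F" "y \<in> ?F"
    then show "(?f x = ?f y) = (x = y)"
      using xs by (auto simp: distinct_partitions_def nth_eq_iff_index_eq ferrers_def)
  next
    fix x assume "x \<in> ?F"
    then obtain i j where ij: "x = (i, j)" "(i, j) \<in> ferrers xs" "hook_number xs (i, j) = h"
      by (cases x) auto
    then have "xs ! i - (xs ! i - j) = j" "j < xs ! i" "i < length xs" by (auto simp: ferrers_def)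
    with ij show "?f x \<in> ?G" using hook_number_distinct[OF xs ij(2)] by auto
  next
    fix y assume "y \<in> ?G"
    then obtain m d where md: "y = (m, d)" "m \<in> set xs" "1 \<le> d" "d \<le> m"
      "d + card (set xs \<inter> {m - d<..<m}) = h" by auto
    then obtain i where i: "i < length xs" "m = xs ! i" by (auto simp: in_set_conv_nth)
    have f: "(i, m - d) \<in> ferrers xs" using md i by (auto simp: ferrers_def)
    have "(i, m - d) \<in> ?F" using hook_number_distinct[OF xs f] md i f by auto
    moreover have "y = ?f (i, m - d)" using md i by auto
    ultimately show "\<exists>x\<in>?F. y = ?f x" by blast
  qed
  from bij_betw_same_card[OF this] have "card ?F = card ?G" .
  finally show ?thesis .
qed

lemma card_hook_pattern_sets:
  assumes "1 \<le> d" "d \<le> m" "d \<le> h"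
  shows "card {A \<in> distinct_part_sets n. m \<in> A \<and> d + card (A \<inter> {m - d<..<m}) = h} =
    (\<Sum>T\<in>hook_patterns h d. prescribed_count n ((-) m ` T) ((-) m ` {..<d}))"
proof -
  let ?S = "\<lambda>T. {A \<in> distinct_part_sets n. A \<inter> (-) m ` {..<d} = (-) m ` T}"
  have inj: "inj_on ((-) m) {..<d}" using assms by (auto simp: inj_on_def)
  have W: "(-) m ` {..<d} = insert m {m - d<..<m}"
  proof -
    have "x \<in> (-) m ` {..<d}" if "m - d < x" "x < m" for x
      using that assms by (intro image_eqI[of _ _ "m - x"]) auto
    moreover have "m \<in> (-) m ` {..<d}" using assms by (intro image_eqI[of _ _ 0]) auto
    ultimately show ?thesis using assms by auto
  qed
  have "{A \<in> distinct_part_sets n. m \<in> A \<and> d + card (A \<inter> {m - d<..<m}) = h} =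
      (\<Union>T\<in>hook_patterns h d. ?S T)" (is "?L = ?R")
  proof (intro equalityI subsetI)
    fix A assume A: "A \<in> ?L"
    define T where "T = {t \<in> {..<d}. m - t \<in> A}"
    have AW: "A \<inter> (-) m ` {..<d} = (-) m ` T" by (auto simp: T_def)
    have fin: "finite A" using A by (auto simp: distinct_part_sets_def intro: finite_subset)
    have "card T = card ((-) m ` T)"
      by (rule card_image[symmetric]) (rule inj_on_subset[OF inj], auto simp: T_def)
    also have "(-) m ` T = insert m (A \<inter> {m - d<..<m})" using AW[symmetric] A unfolding W by auto
    also have "card \<dots> = h - d + 1" using A fin by auto
    finally have "T \<in> hook_patterns h d" using A assms by (auto simp: hook_patterns_def T_def)
    with A AW show "A \<in> ?R" by auto
  next
    fix A assume "A \<in> ?R"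
    then obtain T where T: "T \<in> hook_patterns h d" "A \<in> distinct_part_sets n"
       "A \<inter> (-) m ` {..<d} = (-) m ` T" by auto
    have Td: "T \<subseteq> {..<d}" "0 \<in> T" "card T = h - d + 1" using T by (auto simp: hook_patterns_def)
    have fin: "finite A" using T by (auto simp: distinct_part_sets_def intro: finite_subset)
    have mA: "m \<in> A" using T(3) Td by (metis Int_iff diff_zero imageI)
    have "card ((-) m ` T) = card T"
      by (rule card_image) (rule inj_on_subset[OF inj Td(1)])
    moreover have "(-) m ` T = insert m (A \<inter> {m - d<..<m})" using T(3) mA unfolding W by auto
    ultimately have "Suc (card (A \<inter> {m - d<..<m})) = h - d + 1" using fin Td by simp
    then show "A \<in> ?L" using T mA assms by auto
  qed
  moreover have "card (\<Union>T\<in>hook_patterns h d. ?S T) = (\<Sum>T\<in>hook_patterns h d. card (?S T))"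
  proof (rule card_UN_disjoint)
    show "finite (hook_patterns h d)" by (rule finite_hook_patterns)
    show "\<forall>T\<in>hook_patterns h d. finite (?S T)" using finite_distinct_part_sets by auto
    show "\<forall>T\<in>hook_patterns h d. \<forall>T'\<in>hook_patterns h d. T \<noteq> T' \<longrightarrow> ?S T \<inter> ?S T' = {}"
    proof (intro ballI impI)
      fix T T' assume T: "T \<in> hook_patterns h d" "T' \<in> hook_patterns h d" "T \<noteq> T'"
      then have "(-) m ` T \<noteq> (-) m ` T'"
        using inj_on_image_eq_iff[OF inj, of T T'] unfolding hook_patterns_def by blast
      then show "?S T \<inter> ?S T' = {}" by blast
    qed
  qed
  ultimately show ?thesis by (simp add: prescribed_count_def)
qed

theorem hook_count_eq:
  "hook_count h n = (\<Sum>d=1..h. \<Sum>T\<in>hook_patterns h d. \<Sum>m=d..n.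
     prescribed_count n ((-) m ` T) ((-) m ` {..<d}))"
proof -
  let ?P = "\<lambda>A m d. m \<in> A \<and> d + card (A \<inter> {m - d<..<m}) = h"
  have "hook_count h n = (\<Sum>xs\<in>distinct_partitions n.
      card {(m, d). m \<in> set xs \<and> d \<in> {1..m} \<and> d + card (set xs \<inter> {m - d<..<m}) = h})"
    unfolding hook_count_def by (intro sum.cong refl count_hook_numbers)
  also have "\<dots> = (\<Sum>A\<in>distinct_part_sets n.
      card {(m, d). m \<in> A \<and> d \<in> {1..m} \<and> d + card (A \<inter> {m - d<..<m}) = h})"
    by (rule sum.reindex_bij_betw[OF bij_betw_distinct_partitions])
  also have "\<dots> = (\<Sum>A\<in>distinct_part_sets n. \<Sum>d=1..h. \<Sum>m=d..n. if ?P A m d then 1 else 0)"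
  proof (intro sum.cong refl)
    fix A assume A: "A \<in> distinct_part_sets n"
    have "(\<Sum>d=1..h. \<Sum>m=d..n. if ?P A m d then 1 else 0) =
        card (SIGMA d:{1..h}. {m \<in> {d..n}. ?P A m d})"
      by (subst card_SigmaI) (auto simp: sum.If_cases Int_def conj_commute)
    also have "\<dots> = card {(m, d). m \<in> A \<and> d \<in> {1..m} \<and> d + card (A \<inter> {m - d<..<m}) = h}"
      using A by (intro bij_betw_same_card[of prod.swap] bij_betwI[of _ _ _ prod.swap])
        (auto simp: distinct_part_sets_def)
    finally show "card {(m, d). m \<in> A \<and> d \<in> {1..m} \<and> d + card (A \<inter> {m - d<..<m}) = h} =
        (\<Sum>d=1..h. \<Sum>m=d..n. if ?P A m d then 1 else 0)" by simp
  qed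
  also have "\<dots> = (\<Sum>d=1..h. \<Sum>A\<in>distinct_part_sets n. \<Sum>m=d..n. if ?P A m d then 1 else 0)"
    by (rule sum.swap)
  also have "\<dots> = (\<Sum>d=1..h. \<Sum>m=d..n. \<Sum>A\<in>distinct_part_sets n. if ?P A m d then 1 else 0)"
    by (intro sum.cong refl sum.swap)
  also have "\<dots> = (\<Sum>d=1..h. \<Sum>m=d..n. card {A \<in> distinct_part_sets n. ?P A m d})"
    by (intro sum.cong refl) (simp add: sum.If_cases finite_distinct_part_sets Int_def conj_commute)
  also have "\<dots> = (\<Sum>d=1..h. \<Sum>m=d..n. \<Sum>T\<in>hook_patterns h d.
      prescribed_count n ((-) m ` T) ((-) m ` {..<d}))"
    by (intro sum.cong refl card_hook_pattern_sets) auto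
  also have "\<dots> = (\<Sum>d=1..h. \<Sum>T\<in>hook_patterns h d. \<Sum>m=d..n.
      prescribed_count n ((-) m ` T) ((-) m ` {..<d}))"
    by (intro sum.cong refl sum.swap)
  finally show ?thesis .
qed

subsection \<open>The irrationality of ln 2\<close>

definition niven_integral :: "nat \<Rightarrow> nat \<Rightarrow> nat \<Rightarrow> real" where
  "niven_integral p i j = integral {0..1} (\<lambda>x. x ^ i * (1 - x) ^ j * exp (real p * x))"

lemma niven_integrable:
  "(\<lambda>x::real. x ^ i * (1 - x) ^ j * exp (real p * x)) integrable_on {0..1}"
  by (intro integrable_continuous_interval continuous_intros)

lemma niven_integral_parts:
  "real p * niven_integral p i j + real i * niven_integral p (i - 1) j -
     real j * niven_integral p i (j - 1) = 0 ^ j * exp (real p) - 0 ^ i"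
proof -
  let ?f = "\<lambda>i j x::real. x ^ i * (1 - x) ^ j * exp (real p * x)"
  have "((\<lambda>x. real p * ?f i j x + real i * ?f (i - 1) j x - real j * ?f i (j - 1) x)
      has_integral (?f i j 1 - ?f i j 0)) {0..1}"
    by (rule fundamental_theorem_of_calculus)
      (auto intro!: derivative_eq_intros simp flip: has_real_derivative_iff_has_vector_derivative
        simp: algebra_simps)
  moreover have "((\<lambda>x. real p * ?f i j x + real i * ?f (i - 1) j x - real j * ?f i (j - 1) x)
      has_integral (real p * niven_integral p i j + real i * niven_integral p (i - 1) j -
        real j * niven_integral p i (j - 1))) {0..1}"
    unfolding niven_integral_def
    by (intro has_integral_add has_integral_diff has_integral_mult_right integrable_integral niven_integrable)
  ultimately show ?thesis by (auto dest: has_integral_unique)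
qed

text \<open>Integration by parts lowers one exponent at a time, and the factors i and j that it produces build up the factorial.\<close>

lemma niven_integral_divisible:
  "\<exists>a b :: int. real p ^ (i + j + 1) * niven_integral p i j =
     fact (min i j) * (of_int a + of_int b * exp (real p))"
proof (induction "i + j" arbitrary: i j rule: less_induct)
  case less
  let ?G = "\<lambda>i j. real p ^ (i + j) * niven_integral p i j"
  have rec: "real p ^ (i + j + 1) * niven_integral p i j =
      real p ^ (i + j) * (0 ^ j * exp (real p) - 0 ^ i) -
      real i * (real p ^ (i + j) * niven_integral p (i - 1) j) +
      real j * (real p ^ (i + j) * niven_integral p i (j - 1))"
  proof -
    have "real p * niven_integral p i j = (0 ^ j * exp (real p) - 0 ^ i) -
        real i * niven_integral p (i - 1) j + real j * niven_integral p i (j - 1)"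
      using niven_integral_parts[of p i j] by linarith
    then have "real p ^ (i + j) * (real p * niven_integral p i j) = real p ^ (i + j) * ((0 ^ j * exp (real p) - 0 ^ i) -
        real i * niven_integral p (i - 1) j + real j * niven_integral p i (j - 1))" by simp
    then show ?thesis by (simp add: algebra_simps)
  qed
  have 1: "\<exists>a b :: int. real i * (real p ^ (i + j) * niven_integral p (i - 1) j) =
      fact (min i j) * (of_int a + of_int b * exp (real p))"
  proof (cases i)
    case 0 then show ?thesis by (intro exI[of _ 0]) simp
  next
    case (Suc i')
    obtain a b :: int where ab: "real p ^ (i' + j + 1) * niven_integral p i' j =
        fact (min i' j) * (of_int a + of_int b * exp (real p))"
      using less[of i' j] Suc by auto
    obtain c :: int where c: "real i * fact (min i' j) = fact (min i j) * of_int c"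
    proof (cases "i' < j")
      case True
      then have "min i' j = i'" "min i j = i" using Suc by auto
      then show ?thesis using Suc that[of 1] by simp
    next
      case False
      then have "min i' j = j" "min i j = j" using Suc by auto
      then show ?thesis using that[of "int i"] by simp
    qed
    have "real i * (real p ^ (i + j) * niven_integral p (i - 1) j) =
      (real i * fact (min i' j)) * (of_int a + of_int b * exp (real p))"
      using ab Suc by (simp add: algebra_simps)
    then show ?thesis unfolding c
      by (intro exI[of _ "c * a"] exI[of _ "c * b"]) (simp add: algebra_simps)
  qed
  have 2: "\<exists>a b :: int. real j * (real p ^ (i + j) * niven_integral p i (j - 1)) =
      fact (min i j) * (of_int a + of_int b * exp (real p))"
  proof (cases j)
    case 0 then show ?thesis by (intro exI[of _ 0]) simp
  next
    case (Suc j')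
    obtain a b :: int where ab: "real p ^ (i + j' + 1) * niven_integral p i j' =
        fact (min i j') * (of_int a + of_int b * exp (real p))"
      using less[of i j'] Suc by auto
    obtain c :: int where c: "real j * fact (min i j') = fact (min i j) * of_int c"
    proof (cases "j' < i")
      case True
      then have "min i j' = j'" "min i j = j" using Suc by auto
      then show ?thesis using Suc that[of 1] by simp
    next
      case False
      then have "min i j' = i" "min i j = i" using Suc by auto
      then show ?thesis using that[of "int j"] by simp
    qed
    have "real j * (real p ^ (i + j) * niven_integral p i (j - 1)) =
      (real j * fact (min i j')) * (of_int a + of_int b * exp (real p))"
      using ab Suc by (simp add: algebra_simps)
    then show ?thesis unfolding c
      by (intro exI[of _ "c * a"] exI[of _ "c * b"]) (simp add: algebra_simps)
  qed
  have 3: "\<exists>a b :: int. real p ^ (i + j) * (0 ^ j * exp (real p) - 0 ^ i) =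
      fact (min i j) * (of_int a + of_int b * exp (real p))"
  proof (cases "min i j = 0")
    case True
    then show ?thesis
      by (intro exI[of _ "- (int p ^ (i + j) * 0 ^ i)"] exI[of _ "int p ^ (i + j) * 0 ^ j"])
         (auto simp: algebra_simps)
  next
    case False
    then have z: "(0::real) ^ i = 0" "(0::real) ^ j = 0" by auto
    show ?thesis unfolding z by (intro exI[of _ 0]) simp
  qed
  from 1 2 3 obtain a1 b1 a2 b2 a3 b3 :: int where
    "real i * (real p ^ (i + j) * niven_integral p (i - 1) j) =
      fact (min i j) * (of_int a1 + of_int b1 * exp (real p))"
    "real j * (real p ^ (i + j) * niven_integral p i (j - 1)) =
      fact (min i j) * (of_int a2 + of_int b2 * exp (real p))"
    "real p ^ (i + j) * (0 ^ j * exp (real p) - 0 ^ i) =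
      fact (min i j) * (of_int a3 + of_int b3 * exp (real p))" by metis
  then show ?case unfolding rec
    by (intro exI[of _ "a3 - a1 + a2"] exI[of _ "b3 - b1 + b2"]) (simp add: algebra_simps)
qed

lemma niven_integral_bounds:
  "0 < niven_integral p n n" "niven_integral p n n \<le> exp (real p)"
proof -
  let ?f = "\<lambda>x::real. x ^ n * (1 - x) ^ n * exp (real p * x)"
  have nn: "0 \<le> ?f x" if "x \<in> {0..1}" for x using that by auto
  have "niven_integral p n n \<noteq> 0"
  proof
    assume "niven_integral p n n = 0"
    then have "(?f has_integral 0) (cbox 0 1)"
      using integrable_integral[OF niven_integrable[of n n p]] by (simp add: niven_integral_def)
    then have "?f (1/2) = 0"
      by (rule has_integral_0_cbox_imp_0[rotated 2]) (use nn in \<open>auto intro!: continuous_intros\<close>)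
    then show False by simp
  qed
  moreover have "0 \<le> niven_integral p n n"
    unfolding niven_integral_def using nn by (intro integral_nonneg niven_integrable) auto
  ultimately show "0 < niven_integral p n n" by linarith
  have "niven_integral p n n \<le> integral {0..1} (\<lambda>x::real. exp (real p))"
    unfolding niven_integral_def
  proof (intro integral_le niven_integrable)
    fix x :: real assume x: "x \<in> {0..1}"
    have "x ^ n * (1 - x) ^ n * exp (real p * x) \<le> 1 * 1 * exp (real p)"
      using x by (intro mult_mono power_le_one) (auto intro: mult_left_le)
    then show "x ^ n * (1 - x) ^ n * exp (real p * x) \<le> exp (real p)" by simp
  qed auto
  then show "niven_integral p n n \<le> exp (real p)" by simp
qed

theorem ln_2_irrational: "(ln 2 :: real) \<notin> \<rat>"
proof
  assume "(ln 2 :: real) \<in> \<rat>"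
  then obtain p q :: nat where pq: "q \<noteq> 0" "\<bar>ln 2 :: real\<bar> = real p / real q"
    by (elim Rats_abs_nat_div_natE) auto
  then have "real p = real q * ln 2" by (simp add: field_simps)
  then have ep: "exp (real p) = 2 ^ q"
    by (metis exp_ln exp_of_nat_mult zero_less_numeral)
  have p0: "p > 0" using pq by (cases "p = 0") auto
  have "1 \<le> real p * exp (real p) * ((real p ^ 2) ^ n / fact n)" for n
  proof -
    obtain a b :: int where ab: "real p ^ (n + n + 1) * niven_integral p n n =
        fact n * (of_int a + of_int b * exp (real p))"
      using niven_integral_divisible[of p n n] by auto
    have "0 < real p ^ (n + n + 1) * niven_integral p n n"
      using p0 niven_integral_bounds by simp
    then have "0 < (of_int a + of_int b * exp (real p) :: real)"
      unfolding ab by (simp add: zero_less_mult_iff)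
    also have "(of_int a + of_int b * exp (real p) :: real) = of_int (a + b * 2 ^ q)"
      by (simp add: ep)
    finally have "1 \<le> a + b * 2 ^ q" by linarith
    then have "(1::real) \<le> of_int (a + b * 2 ^ q)" by linarith
    then have "fact n \<le> (fact n :: real) * of_int (a + b * 2 ^ q)" by simp
    also have "\<dots> = real p ^ (n + n + 1) * niven_integral p n n" unfolding ab by (simp add: ep)
    also have "\<dots> \<le> real p ^ (n + n + 1) * exp (real p)"
      by (intro mult_left_mono niven_integral_bounds) auto
    also have "real p ^ (n + n + 1) = real p * (real p ^ 2) ^ n" by (simp add: power_add power_mult flip: mult_2)
    finally show ?thesis by (simp add: field_simps)
  qed
  moreover have "(\<lambda>n. real p * exp (real p) * ((real p ^ 2) ^ n / fact n)) \<longlonglongrightarrow> real p * exp (real p) * 0"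
    by (intro tendsto_intros summable_LIMSEQ_zero[OF summable_exp, unfolded inverse_eq_divide times_divide_eq_left mult_1])
  ultimately have "1 \<le> real p * exp (real p) * 0"
    using LIMSEQ_le_const by blast
  then show False by simp
qed

subsection \<open>Rational integrals modulo ln 2\<close>

definition pattern_integral :: "nat \<Rightarrow> nat \<Rightarrow> real" where
  "pattern_integral a d = integral {0..1} (\<lambda>v. v ^ a / (1 + v) ^ d)"

lemma pattern_integrable: "(\<lambda>v::real. v ^ a / (1 + v) ^ d) integrable_on {0..1}"
  by (intro integrable_continuous_interval continuous_intros) auto

lemma pattern_integral_rec:
  "pattern_integral (Suc a) (Suc d) = pattern_integral a d - pattern_integral a (Suc d)"
proof -
  have "pattern_integral (Suc a) (Suc d) =
      integral {0..1} (\<lambda>v. v ^ a / (1 + v) ^ d - v ^ a / (1 + v) ^ (Suc d))"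
    unfolding pattern_integral_def
  proof (rule integral_cong)
    fix v :: real assume "v \<in> {0..1}"
    then have "1 + v \<noteq> 0" by auto
    then show "v ^ Suc a / (1 + v) ^ Suc d = v ^ a / (1 + v) ^ d - v ^ a / (1 + v) ^ Suc d"
      by (simp add: divide_simps) (simp add: algebra_simps)
  qed
  also have "\<dots> = pattern_integral a d - pattern_integral a (Suc d)"
    unfolding pattern_integral_def by (intro integral_diff pattern_integrable)
  finally show ?thesis .
qed

lemma pattern_integral_0_right: "pattern_integral a 0 = 1 / (real a + 1)"
proof -
  have "((\<lambda>v. v ^ a / (1 + v) ^ 0) has_integral (1 ^ Suc a / (real a + 1) - 0 ^ Suc a / (real a + 1))) {0..1::real}"
  proof (rule fundamental_theorem_of_calculus)
    fix x :: real
    have "((\<lambda>v. v ^ Suc a / (real a + 1)) has_real_derivative (real (Suc a) * x ^ a / (real a + 1))) (at x within {0..1})"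
      by (intro DERIV_cdivide) (auto intro!: derivative_eq_intros simp del: power_Suc)
    moreover have "real (Suc a) * x ^ a / (real a + 1) = x ^ a / (1 + x) ^ 0"
      by (simp add: add.commute)
    ultimately show "((\<lambda>v. v ^ Suc a / (real a + 1)) has_vector_derivative x ^ a / (1 + x) ^ 0) (at x within {0..1})"
      by (simp flip: has_real_derivative_iff_has_vector_derivative)
  qed auto
  then show ?thesis by (simp add: pattern_integral_def integral_unique)
qed

lemma pattern_integral_0_1: "pattern_integral 0 1 = ln 2"
proof -
  have "((\<lambda>v. v ^ 0 / (1 + v) ^ 1) has_integral (ln (1 + 1) - ln (1 + 0))) {0..1::real}"
    by (rule fundamental_theorem_of_calculus)
      (auto intro!: derivative_eq_intros simp flip: has_real_derivative_iff_has_vector_derivative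
        simp: field_simps)
  then show ?thesis by (simp add: pattern_integral_def integral_unique)
qed

lemma pattern_integral_0_Suc_Suc:
  "pattern_integral 0 (Suc (Suc d)) = (1 - 1 / 2 ^ Suc d) / (real d + 1)"
proof -
  let ?F = "\<lambda>v::real. - inverse ((real d + 1) * (1 + v) ^ Suc d)"
  have "((\<lambda>v. v ^ 0 / (1 + v) ^ Suc (Suc d)) has_integral (?F 1 - ?F 0)) {0..1::real}"
  proof (rule fundamental_theorem_of_calculus)
    fix x :: real assume x: "x \<in> {0..1}"
    have nz: "(real d + 1) * (1 + x) ^ Suc d \<noteq> 0" using x by auto
    have "(?F has_real_derivative (real d + 1) * ((real d + 1) * (1 + x) ^ d) / ((real d + 1) * (1 + x) ^ Suc d)^2) (at x within {0..1})"
    proof -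
      have "((\<lambda>v. (real d + 1) * (1 + v) ^ Suc d) has_real_derivative
          (real d + 1) * ((real d + 1) * (1 + x) ^ d)) (at x within {0..1})"
        by (intro DERIV_cmult) (auto intro!: derivative_eq_intros simp del: power_Suc)
      from DERIV_minus[OF DERIV_inverse'[OF this nz]] show ?thesis
        by (rule DERIV_cong) (simp only: divide_inverse power2_eq_square inverse_mult_distrib minus_minus mult_ac)
    qed
    moreover have "(real d + 1) * ((real d + 1) * (1 + x) ^ d) / ((real d + 1) * (1 + x) ^ Suc d)^2 = x ^ 0 / (1 + x) ^ Suc (Suc d)"
      using x by (simp add: divide_simps power2_eq_square)
    ultimately show "(?F has_vector_derivative x ^ 0 / (1 + x) ^ Suc (Suc d)) (at x within {0..1})"
      by (simp flip: has_real_derivative_iff_has_vector_derivative)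
  qed auto
  then show ?thesis by (simp add: pattern_integral_def integral_unique diff_divide_distrib inverse_eq_divide mult_ac)
qed

lemma pattern_integral_mod_ln_2:
  "pattern_integral a (Suc d) - real (a choose d) * (- 1) ^ (a + d) * ln 2 \<in> \<rat>"
proof (induction a arbitrary: d)
  case 0
  then show ?case
    by (cases d) (auto simp: pattern_integral_0_1[simplified] pattern_integral_0_Suc_Suc)
next
  case (Suc a)
  show ?case
  proof (cases d)
    case 0
    have "pattern_integral (Suc a) (Suc 0) - real (Suc a choose 0) * (- 1) ^ (Suc a + 0) * ln 2 =
        1 / (real a + 1) - (pattern_integral a (Suc 0) - real (a choose 0) * (- 1) ^ (a + 0) * ln 2)"
      by (simp add: pattern_integral_rec pattern_integral_0_right)
    also have "\<dots> \<in> \<rat>" using Suc[of 0] by (intro Rats_diff[of "1 / (real a + 1)"]) auto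
    finally show ?thesis using 0 by simp
  next
    case (Suc d')
    have "pattern_integral (Suc a) (Suc d) - real (Suc a choose d) * (- 1) ^ (Suc a + d) * ln 2 =
        (pattern_integral a (Suc d') - real (a choose d') * (- 1) ^ (a + d') * ln 2) -
        (pattern_integral a (Suc d) - real (a choose d) * (- 1) ^ (a + d) * ln 2)"
      using Suc by (simp add: pattern_integral_rec algebra_simps)
    also have "\<dots> \<in> \<rat>" by (intro Rats_diff Suc.IH)
    finally show ?thesis .
  qed
qed

definition hook_const :: "nat \<Rightarrow> real" where
  "hook_const h = (\<Sum>d=1..h. real ((d - 1) choose (h - d)) * pattern_integral (h - d) d)"

lemma hook_const_mod_ln_2: "hook_const h - of_bool (odd h) * ln 2 \<in> \<rat>"
proof -
  let ?c = "\<lambda>d. real ((d - 1) choose (h - d)) * (real ((h - d) choose (d - 1)) * (- 1) ^ (h - d + (d - 1)))"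
  have c: "?c d = (if h = 2 * d - 1 then 1 else 0)" if "d \<in> {1..h}" for d
  proof (cases "h = 2 * d - 1")
    case True
    then have "h - d = d - 1" by simp
    then show ?thesis using True by simp
  next
    case False
    then have "h - d \<noteq> d - 1" using that by auto
    then have "d - 1 < h - d \<or> h - d < d - 1" by linarith
    then show ?thesis using False by (auto simp: binomial_eq_0)
  qed
  have "(\<Sum>d=1..h. ?c d) = (\<Sum>d=1..h. if h = 2 * d - 1 then 1 else 0)"
    using c by (intro sum.cong) auto
  also have "\<dots> = of_bool (odd h)"
  proof (cases "odd h")
    case True
    then obtain k where k: "h = 2 * k + 1" by (rule oddE)
    have "(\<Sum>d=1..h. if h = 2 * d - 1 then 1 else 0::real) = (\<Sum>d=1..h. if d = k + 1 then 1 else 0)"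
      using k by (intro sum.cong) auto
    then show ?thesis using True k by simp
  next
    case False
    then have "h \<noteq> 2 * d - 1" if "d \<in> {1..h}" for d using that by auto
    then show ?thesis using False by simp
  qed
  finally have "hook_const h - of_bool (odd h) * ln 2 =
     (\<Sum>d=1..h. real ((d - 1) choose (h - d)) * pattern_integral (h - d) d - ?c d * ln 2)"
    unfolding hook_const_def sum_subtractf sum_distrib_right[symmetric] by simp
  also have "\<dots> = (\<Sum>d=1..h. real ((d - 1) choose (h - d)) * (pattern_integral (h - d) (Suc (d - 1)) -
      real ((h - d) choose (d - 1)) * (- 1) ^ (h - d + (d - 1)) * ln 2))"
    by (intro sum.cong) (auto simp: algebra_simps)
  also have "\<dots> \<in> \<rat>"
    by (intro Rats_sum Rats_mult pattern_integral_mod_ln_2) auto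
  finally show ?thesis .
qed

lemma hook_const_rational_iff: "hook_const h \<in> \<rat> \<longleftrightarrow> even h"
proof (cases "even h")
  case True then show ?thesis using hook_const_mod_ln_2[of h] by simp
next
  case False
  have "hook_const h \<notin> \<rat>"
  proof
    assume "hook_const h \<in> \<rat>"
    then have "hook_const h - (hook_const h - of_bool (odd h) * ln 2) \<in> \<rat>"
      by (intro Rats_diff hook_const_mod_ln_2)
    with False ln_2_irrational show False by simp
  qed
  with False show ?thesis by simp
qed

lemma Rats_ln2_ln_2: "ln 2 \<in> Rats_ln2"
  unfolding Rats_ln2_def by (rule generate_field.incl) simp

lemma Rats_ln2_add: "x \<in> Rats_ln2 \<Longrightarrow> y \<in> Rats_ln2 \<Longrightarrow> x + y \<in> Rats_ln2"
  unfolding Rats_ln2_def using generate_field.eng_add[of x ring_of_type_algebra "{ln 2}" y]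
  by (simp add: ring_of_type_algebra_def)

lemma Rats_ln2_mult: "x \<in> Rats_ln2 \<Longrightarrow> y \<in> Rats_ln2 \<Longrightarrow> x * y \<in> Rats_ln2"
  unfolding Rats_ln2_def using generate_field.eng_mult[of x ring_of_type_algebra "{ln 2}" y]
  by (simp add: ring_of_type_algebra_def)

lemma Rats_ln2_uminus: "x \<in> Rats_ln2 \<Longrightarrow> - x \<in> Rats_ln2"
proof -
  interpret K: field "ring_of_type_algebra :: real ring" by (rule field_from_type_algebra)
  assume "x \<in> Rats_ln2"
  moreover have "\<ominus>\<^bsub>ring_of_type_algebra\<^esub> x = - x"
    by (rule K.minus_equality) (auto simp: ring_of_type_algebra_def)
  ultimately show ?thesis
    using generate_field.a_inv[of x ring_of_type_algebra "{ln 2}"] by (simp add: Rats_ln2_def)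
qed

lemma Rats_ln2_inverse: "x \<in> Rats_ln2 \<Longrightarrow> x \<noteq> 0 \<Longrightarrow> inverse x \<in> Rats_ln2"
proof -
  interpret K: field "ring_of_type_algebra :: real ring" by (rule field_from_type_algebra)
  assume x: "x \<in> Rats_ln2" "x \<noteq> 0"
  have "inv\<^bsub>ring_of_type_algebra\<^esub> x = inverse x"
    by (rule K.comm_inv_char) (use x in \<open>auto simp: ring_of_type_algebra_def\<close>)
  then show ?thesis
    using x generate_field.m_inv[of x ring_of_type_algebra "{ln 2}"]
    by (simp add: Rats_ln2_def) (simp add: ring_of_type_algebra_def)
qed

lemma Rats_subset_Rats_ln2: "\<rat> \<subseteq> Rats_ln2"
proof
  have 1: "1 \<in> Rats_ln2"
    unfolding Rats_ln2_def using generate_field.one[of ring_of_type_algebra "{ln 2}"]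
    by (simp add: ring_of_type_algebra_def)
  have 0: "0 \<in> Rats_ln2" using Rats_ln2_add[OF 1 Rats_ln2_uminus[OF 1]] by simp
  have nat: "real k \<in> Rats_ln2" for k by (induction k) (auto intro: 0 1 Rats_ln2_add)
  have int: "real_of_int k \<in> Rats_ln2" for k
    by (cases k rule: int_cases2) (auto intro: nat Rats_ln2_uminus)
  fix x :: real assume "x \<in> \<rat>"
  then obtain a b :: int where "b > 0" "x = of_int a / of_int b" by (elim Rats_cases')
  then show "x \<in> Rats_ln2"
    unfolding divide_inverse by (auto intro!: Rats_ln2_mult Rats_ln2_inverse int)
qed

lemma hook_const_in_Rats_ln2: "hook_const h \<in> Rats_ln2"
proof -
  have "of_bool (odd h) * ln 2 \<in> Rats_ln2"
    using Rats_subset_Rats_ln2 by (intro Rats_ln2_mult Rats_ln2_ln_2) auto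
  with hook_const_mod_ln_2[of h] have "(hook_const h - of_bool (odd h) * ln 2) + of_bool (odd h) * ln 2 \<in> Rats_ln2"
    using Rats_subset_Rats_ln2 by (intro Rats_ln2_add) auto
  then show ?thesis by simp
qed

subsection \<open>The coefficient as a Fourier integral\<close>

definition part_char :: "real \<Rightarrow> nat \<Rightarrow> real \<Rightarrow> complex" where
  "part_char z k t = (1 + of_real (exp (- real k * z)) * cis (real k * t)) / of_real (1 + exp (- real k * z))"

definition fourier_coeff :: "real \<Rightarrow> nat \<Rightarrow> nat set \<Rightarrow> nat \<Rightarrow> complex" where
  "fourier_coeff z n W j =
    (LBINT t:{-pi..pi}. (\<Prod>k\<in>{1..n} - W. part_char z k t) * cis ((real j - real n) * t)) / (2 * pi)"

lemma integral_cis_int: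
  "(LBINT t:{-pi..pi}. cis (of_int l * t)) = (if l = 0 then 2 * of_real pi else 0)"
proof (cases "l = 0")
  case True
  then show ?thesis by (simp add: set_lebesgue_integral_def scaleR_conv_of_real)
next
  case False
  let ?F = "\<lambda>t::real. exp (\<i> * of_int l * of_real t) / (\<i> * of_int l)"
  have "(LBINT t:{-pi..pi}. cis (of_int l * t)) = (LBINT t. indicator {-pi..pi} t *\<^sub>R exp (\<i> * of_int l * of_real t))"
    unfolding set_lebesgue_integral_def by (intro Bochner_Integration.integral_cong) (auto simp: cis_conv_exp mult_ac)
  also have "\<dots> = ?F pi - ?F (- pi)"
  proof (rule integral_FTC_atLeastAtMost)
    fix x :: real
    have "((\<lambda>w. exp (\<i> * of_int l * w) / (\<i> * of_int l)) has_field_derivative exp (\<i> * of_int l * of_real x)) (at (of_real x))"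
      using False by (auto intro!: derivative_eq_intros)
    then show "(?F has_vector_derivative exp (\<i> * of_int l * of_real x)) (at x within {-pi..pi})"
      by (rule has_vector_derivative_real_field)
  qed (auto intro!: continuous_intros)
  also have "?F pi = ?F (- pi)"
  proof -
    have "\<i> * of_int l * of_real pi = \<i> * of_int l * of_real (- pi) + 2 * of_int l * pi * \<i>"
      by (simp add: algebra_simps)
    then have "exp (\<i> * of_int l * of_real pi) = exp (\<i> * of_int l * of_real (- pi)) * exp (2 * of_int l * pi * \<i>)"
      by (simp only: exp_add)
    also have "exp (2 * of_int l * pi * \<i>) = 1"
      by (rule exp_integer_2pi) auto
    finally show ?thesis by simp
  qed
  finally show ?thesis using False by simp
qed

lemma continuous_on_part_char [continuous_intros]:
  "continuous_on S f \<Longrightarrow> continuous_on S (\<lambda>t. part_char z k (f t))"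
  unfolding part_char_def
  by (intro continuous_intros) (auto simp flip: of_real_add simp: add_pos_pos less_imp_neq[symmetric])

lemma prescribed_count_eq_card_complement:
  assumes "U \<subseteq> W" "W \<subseteq> {1..n}"
  shows "prescribed_count n U W = card {B \<in> Pow ({1..n} - W). \<Sum>B + \<Sum>U = n}"
proof -
  have fin: "finite U" using assms by (meson finite_atLeastAtMost finite_subset subset_trans)
  have "bij_betw (\<lambda>B. B \<union> U) {B \<in> Pow ({1..n} - W). \<Sum>B + \<Sum>U = n} {A \<in> distinct_part_sets n. A \<inter> W = U}"
  proof (rule bij_betwI[where g = "\<lambda>A. A - U"])
    show "(\<lambda>B. B \<union> U) \<in> {B \<in> Pow ({1..n} - W). \<Sum>B + \<Sum>U = n} \<rightarrow> {A \<in> distinct_part_sets n. A \<inter> W = U}"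
    proof
      fix B assume B: "B \<in> {B \<in> Pow ({1..n} - W). \<Sum>B + \<Sum>U = n}"
      then have "finite B" "B \<inter> U = {}" using assms by (auto intro: finite_subset)
      then have "\<Sum>(B \<union> U) = n" using B fin by (simp add: sum.union_disjoint)
      then show "B \<union> U \<in> {A \<in> distinct_part_sets n. A \<inter> W = U}"
        using B assms by (auto simp: distinct_part_sets_def)
    qed
    show "(\<lambda>A. A - U) \<in> {A \<in> distinct_part_sets n. A \<inter> W = U} \<rightarrow> {B \<in> Pow ({1..n} - W). \<Sum>B + \<Sum>U = n}"
    proof
      fix A assume A: "A \<in> {A \<in> distinct_part_sets n. A \<inter> W = U}"
      then have "finite A" "U \<subseteq> A" by (auto simp: distinct_part_sets_def intro: finite_subset)
      then have "\<Sum>(A - U) + \<Sum>U = n" using A by (simp add: sum.subset_diff[symmetric] distinct_part_sets_def)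
      then show "A - U \<in> {B \<in> Pow ({1..n} - W). \<Sum>B + \<Sum>U = n}"
        using A assms by (auto simp: distinct_part_sets_def)
    qed
  qed (use assms in auto)
  from bij_betw_same_card[OF this] show ?thesis by (simp add: prescribed_count_def)
qed

lemma prescribed_count_fourier:
  assumes UW: "U \<subseteq> W" "W \<subseteq> {1..n}"
  shows "of_nat (prescribed_count n U W) =
    of_real (exp (real n * z) * (\<Prod>k=1..n. 1 + exp (- real k * z)) *
      ((\<Prod>k\<in>U. exp (- real k * z)) / (\<Prod>k\<in>W. 1 + exp (- real k * z)))) * fourier_coeff z n W (\<Sum>U)"
proof -
  let ?x = "\<lambda>k t. of_real (exp (- real k * z)) * cis (real k * t)"
  let ?D = "\<lambda>S. \<Prod>k\<in>S. 1 + exp (- real k * z)"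
  have finW: "finite W" "finite ({1..n} - W)" using UW by (auto intro: finite_subset)
  have Dpos: "?D S > 0" for S by (intro prod_pos) (auto intro: add_pos_pos)
  have Dsplit: "?D {1..n} = ?D ({1..n} - W) * ?D W"
    using UW by (intro prod.subset_diff) auto
  have xprod: "(\<Prod>k\<in>B. ?x k t) = of_real (exp (- real (\<Sum>B) * z)) * cis (real (\<Sum>B) * t)"
    if "finite B" for B t
    using that by induction (auto simp: exp_add[symmetric] cis_mult algebra_simps simp flip: of_real_mult)
  have expU: "(\<Prod>k\<in>U. exp (- real k * z)) = exp (- real (\<Sum>U) * z)"
    using UW finite_subset[OF UW(1) finW(1)] by (subst exp_sum[symmetric]) (auto simp: sum_distrib_right sum_negf)
  have char: "of_real (?D ({1..n} - W)) * (\<Prod>k\<in>{1..n} - W. part_char z k t) =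
      (\<Sum>B\<in>Pow ({1..n} - W). of_real (exp (- real (\<Sum>B) * z)) * cis (real (\<Sum>B) * t))" for t
  proof -
    have nz: "(of_real (?D ({1..n} - W)) :: complex) \<noteq> 0"
      using Dpos[of "{1..n} - W"] by (simp only: of_real_eq_0_iff)
    have "(\<Prod>k\<in>{1..n} - W. part_char z k t) = (\<Prod>k\<in>{1..n} - W. ?x k t + 1) / of_real (?D ({1..n} - W))"
      by (simp only: part_char_def prod_dividef of_real_prod add.commute)
    then have "of_real (?D ({1..n} - W)) * (\<Prod>k\<in>{1..n} - W. part_char z k t) = (\<Prod>k\<in>{1..n} - W. ?x k t + 1)"
      using nz by (simp only: nonzero_mult_div_cancel_left times_divide_eq_right not_False_eq_True)
    also have "\<dots> = (\<Sum>B\<in>Pow ({1..n} - W). (\<Prod>k\<in>B. ?x k t) * (\<Prod>k\<in>{1..n} - W - B. 1))"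
      by (rule prod_add) (use finW in auto)
    also have "\<dots> = (\<Sum>B\<in>Pow ({1..n} - W). of_real (exp (- real (\<Sum>B) * z)) * cis (real (\<Sum>B) * t))"
    proof (intro sum.cong refl)
      fix B assume "B \<in> Pow ({1..n} - W)"
      then have "finite B" using finW finite_subset by auto
      then show "(\<Prod>k\<in>B. ?x k t) * (\<Prod>k\<in>{1..n} - W - B. 1) = of_real (exp (- real (\<Sum>B) * z)) * cis (real (\<Sum>B) * t)"
        by (simp only: xprod prod.neutral_const mult_1_right)
    qed
    finally show ?thesis .
  qed
  have int: "set_integrable lborel {-pi..pi} (\<lambda>t. c * cis (a * t))" for c :: complex and a :: real
    by (rule borel_integrable_atLeastAtMost') (intro continuous_intros)
  have "of_real (?D ({1..n} - W)) * (fourier_coeff z n W (\<Sum>U) * (2 * of_real pi)) =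
      (LBINT t:{-pi..pi}. of_real (?D ({1..n} - W)) * ((\<Prod>k\<in>{1..n} - W. part_char z k t) * cis ((real (\<Sum>U) - real n) * t)))"
    by (simp add: fourier_coeff_def del: of_real_prod)
  also have "\<dots> = (LBINT t:{-pi..pi}. (\<Sum>B\<in>Pow ({1..n} - W). of_real (exp (- real (\<Sum>B) * z)) * cis (of_int (int (\<Sum>B + \<Sum>U) - int n) * t)))"
  proof (rule set_lebesgue_integral_cong)
    show "\<forall>t. t \<in> {-pi..pi} \<longrightarrow> of_real (?D ({1..n} - W)) * ((\<Prod>k\<in>{1..n} - W. part_char z k t) * cis ((real (\<Sum>U) - real n) * t)) =
       (\<Sum>B\<in>Pow ({1..n} - W). of_real (exp (- real (\<Sum>B) * z)) * cis (of_int (int (\<Sum>B + \<Sum>U) - int n) * t))"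
      unfolding mult.assoc[symmetric] char sum_distrib_right
      by (intro allI impI sum.cong refl) (simp add: mult.assoc cis_mult algebra_simps del: of_nat_sum)
  qed auto
  also have "\<dots> = (\<Sum>B\<in>Pow ({1..n} - W). (LBINT t:{-pi..pi}. of_real (exp (- real (\<Sum>B) * z)) * cis (of_int (int (\<Sum>B + \<Sum>U) - int n) * t)))"
    unfolding set_lebesgue_integral_def scaleR_sum_right
    by (rule Bochner_Integration.integral_sum) (use int in \<open>auto simp only: set_integrable_def\<close>)
  also have "\<dots> = (\<Sum>B\<in>Pow ({1..n} - W). of_real (exp (- real (\<Sum>B) * z)) * (if \<Sum>B + \<Sum>U = n then 2 * complex_of_real pi else 0))"
    by (intro sum.cong refl) (simp add: integral_cis_int del: of_int_diff of_int_of_nat_eq of_nat_add of_nat_sum)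
  also have "\<dots> = (\<Sum>B\<in>Pow ({1..n} - W). if \<Sum>B + \<Sum>U = n then of_real (exp (real (\<Sum>U) * z - real n * z)) * (2 * complex_of_real pi) else 0)"
  proof (intro sum.cong refl)
    fix B
    show "(of_real (exp (- real (\<Sum>B) * z)) * (if \<Sum>B + \<Sum>U = n then 2 * complex_of_real pi else 0) :: complex) =
       (if \<Sum>B + \<Sum>U = n then of_real (exp (real (\<Sum>U) * z - real n * z)) * (2 * complex_of_real pi) else 0)"
    proof (cases "\<Sum>B + \<Sum>U = n")
      case True
      have "real n = real (\<Sum>B) + real (\<Sum>U)" unfolding True[symmetric] by (rule of_nat_add)
      then have "- real (\<Sum>B) * z = real (\<Sum>U) * z - real n * z" by (simp only: algebra_simps)
      then show ?thesis using True by simp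
    qed simp
  qed
  also have "\<dots> = of_nat (prescribed_count n U W) * (of_real (exp (real (\<Sum>U) * z - real n * z)) * (2 * complex_of_real pi))"
    unfolding prescribed_count_eq_card_complement[OF UW] using finW
    by (subst sum.If_cases) (auto simp: Int_def conj_commute)
  finally have "of_real (?D ({1..n} - W)) * fourier_coeff z n W (\<Sum>U) * (2 * complex_of_real pi) =
      of_nat (prescribed_count n U W) * of_real (exp (real (\<Sum>U) * z - real n * z)) * (2 * complex_of_real pi)"
    by (simp only: mult.assoc)
  then have "of_real (?D ({1..n} - W)) * fourier_coeff z n W (\<Sum>U) =
      of_nat (prescribed_count n U W) * of_real (exp (real (\<Sum>U) * z - real n * z))"
    by (simp del: of_real_prod)
  then have *: "of_nat (prescribed_count n U W) = of_real (exp (real n * z - real (\<Sum>U) * z)) *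
      (of_real (?D ({1..n} - W)) * fourier_coeff z n W (\<Sum>U))"
    by (simp add: mult_ac exp_diff del: of_real_prod of_nat_sum)
  have e: "exp (real n * z) * ?D {1..n} * (exp (- real (\<Sum>U) * z) / ?D W) =
      exp (real n * z - real (\<Sum>U) * z) * ?D ({1..n} - W)"
  proof -
    have "exp (real n * z) * exp (- real (\<Sum>U) * z) = exp (real n * z - real (\<Sum>U) * z)"
      by (simp only: exp_add[symmetric]) simp
    then show ?thesis unfolding Dsplit using Dpos[of W] by (simp add: field_simps del: of_nat_sum)
  qed
  show ?thesis unfolding * expU e by (simp only: of_real_mult mult.assoc)
qed

subsection \<open>An antiderivative of ln (1 + exp (- x))\<close>

definition alt_dilog :: "real \<Rightarrow> real" where
  "alt_dilog u = (\<Sum>j. (- 1) ^ j * u ^ Suc j / real (Suc j) ^ 2)"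

lemma inverse_Suc_squares_sums: "(\<lambda>j. 1 / real (Suc j) ^ 2) sums (pi ^ 2 / 6)"
  using inverse_squares_sums by simp

lemma alt_dilog_term_bound:
  assumes "0 \<le> u" "u \<le> 1"
  shows "norm ((- 1) ^ j * u ^ Suc j / real (Suc j) ^ 2) \<le> u * (1 / real (Suc j) ^ 2)"
proof -
  have "u ^ j \<le> 1" using assms by (intro power_le_one)
  then have "u * u ^ j \<le> u * 1" using assms by (intro mult_left_mono) auto
  then have "u * u ^ j / real (Suc j) ^ 2 \<le> u / real (Suc j) ^ 2" by (intro divide_right_mono) auto
  then show ?thesis using assms by (simp add: norm_mult norm_divide norm_power abs_mult power_abs)
qed

lemma alt_dilog_summable:
  assumes "0 \<le> u" "u \<le> 1"
  shows "summable (\<lambda>j. (- 1) ^ j * u ^ Suc j / real (Suc j) ^ 2)"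
  using alt_dilog_term_bound[OF assms]
  by (rule summable_comparison_test'[OF summable_mult[OF sums_summable[OF inverse_Suc_squares_sums]]])

lemma abs_alt_dilog_le:
  assumes "0 \<le> u" "u \<le> 1"
  shows "\<bar>alt_dilog u\<bar> \<le> pi ^ 2 / 6 * u"
proof -
  have "norm (alt_dilog u) \<le> (\<Sum>j. u * (1 / real (Suc j) ^ 2))"
    unfolding alt_dilog_def
    by (rule norm_suminf_le) (use alt_dilog_term_bound[OF assms] in
      \<open>auto intro!: summable_mult sums_summable[OF inverse_Suc_squares_sums] simp only:\<close>)
  also have "\<dots> = u * (pi ^ 2 / 6)"
    by (rule sums_unique[symmetric]) (rule sums_mult[OF inverse_Suc_squares_sums])
  finally show ?thesis by (simp add: mult.commute)
qed

lemma alt_dilog_1: "alt_dilog 1 = pi ^ 2 / 12"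
proof -
  let ?a = "\<lambda>j. 1 / real (Suc j) ^ 2"
  have "(\<lambda>n. if even n then 0 else ?a ((n - 1) div 2)) sums (pi ^ 2 / 6)"
    by (rule sums_if'[OF inverse_Suc_squares_sums])
  from sums_diff[OF inverse_Suc_squares_sums sums_mult[OF this, of "1/2"]]
  have "(\<lambda>n. ?a n - 1 / 2 * (if even n then 0 else ?a ((n - 1) div 2))) sums (pi ^ 2 / 12)"
    by simp
  also have "(\<lambda>n. ?a n - 1 / 2 * (if even n then 0 else ?a ((n - 1) div 2))) =
      (\<lambda>j. (- 1) ^ j * 1 ^ Suc j / real (Suc j) ^ 2)"
  proof
    fix n
    show "?a n - 1 / 2 * (if even n then 0 else ?a ((n - 1) div 2)) = (- 1) ^ n * 1 ^ Suc n / real (Suc n) ^ 2"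
    proof (cases "even n")
      case False
      then obtain k where "n = 2 * k + 1" by (rule oddE)
      then show ?thesis by (simp add: divide_simps power2_eq_square) (simp add: algebra_simps)
    qed simp
  qed
  finally show ?thesis unfolding alt_dilog_def by (rule sums_unique[symmetric])
qed

lemma continuous_on_alt_dilog: "continuous_on {0..1} alt_dilog"
proof (rule uniform_limit_theorem)
  show "uniform_limit {0..1} (\<lambda>n u. \<Sum>j<n. (- 1) ^ j * u ^ Suc j / real (Suc j) ^ 2) alt_dilog sequentially"
    unfolding alt_dilog_def
  proof (rule Weierstrass_m_test)
    fix j and u :: real assume u: "u \<in> {0..1}"
    have "norm ((- 1) ^ j * u ^ Suc j / real (Suc j) ^ 2) \<le> u * (1 / real (Suc j) ^ 2)"
      using u by (intro alt_dilog_term_bound) auto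
    also have "\<dots> \<le> 1 * (1 / real (Suc j) ^ 2)" using u by (intro mult_right_mono) auto
    finally show "norm ((- 1) ^ j * u ^ Suc j / real (Suc j) ^ 2) \<le> 1 / real (Suc j) ^ 2" by simp
  qed (rule sums_summable[OF inverse_Suc_squares_sums])
  show "\<forall>\<^sub>F n in sequentially. continuous_on {0..1} (\<lambda>u::real. \<Sum>j<n. (- 1) ^ j * u ^ Suc j / real (Suc j) ^ 2)"
    by (intro always_eventually allI continuous_intros) auto
qed auto

lemma alt_dilog_has_derivative:
  assumes "0 < u" "u < 1"
  shows "(alt_dilog has_real_derivative ln (1 + u) / u) (at u)"
proof -
  define c :: "nat \<Rightarrow> real" where "c n = (if n = 0 then 0 else (- 1) ^ (n - 1) / real n ^ 2)" for n
  have c_sum: "(\<Sum>n. c n * x ^ n) = alt_dilog x \<and> summable (\<lambda>n. c n * x ^ n)" if "0 \<le> x" "x \<le> 1" for x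
  proof -
    have "(\<lambda>j. c (Suc j) * x ^ Suc j) sums alt_dilog x"
      using summable_sums[OF alt_dilog_summable[OF that]] by (simp add: alt_dilog_def c_def)
    then have "(\<lambda>j. c j * x ^ j) sums (alt_dilog x + c 0 * x ^ 0)" by (rule iffD1[OF sums_Suc_iff, rotated])
    then show ?thesis by (auto simp: c_def dest: sums_unique[symmetric] sums_summable)
  qed
  have "((\<lambda>x. \<Sum>n. c n * x ^ n) has_real_derivative (\<Sum>n. diffs c n * u ^ n)) (at u)"
    by (rule termdiffs_strong[where K = 1]) (use assms c_sum[of 1] in auto)
  moreover have "(\<Sum>n. diffs c n * u ^ n) = ln (1 + u) / u"
  proof -
    have "(\<lambda>n. (- 1) ^ n * (1 / real (n + 1)) * u ^ Suc n) sums ln (1 + u)"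
    proof -
      have "ln (1 + u) = (\<Sum>n. (- 1) ^ n * (1 / real (n + 1)) * (1 + u - 1) ^ Suc n)"
        using assms by (intro ln_series) auto
      moreover have "summable (\<lambda>n. (- 1) ^ n * (1 / real (n + 1)) * u ^ Suc n)"
      proof (rule summable_comparison_test'[where N = 0])
        show "summable (\<lambda>n. u ^ n)" using assms by (intro summable_geometric) auto
        fix n :: nat
        have "u ^ Suc n / real (n + 1) \<le> u ^ Suc n / 1" using assms by (intro divide_left_mono) auto
        also have "\<dots> \<le> u ^ n" using assms by (simp add: mult_left_le_one_le)
        finally show "norm ((- 1) ^ n * (1 / real (n + 1)) * u ^ Suc n) \<le> u ^ n"
          using assms by (simp add: norm_mult norm_power abs_mult power_abs)
      qed
      ultimately show ?thesis using summable_sums by fastforce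
    qed
    from sums_divide[OF this, of u] have "(\<lambda>n. diffs c n * u ^ n) sums (ln (1 + u) / u)"
      using assms by (simp add: diffs_def c_def power2_eq_square)
    then show ?thesis by (rule sums_unique[symmetric])
  qed
  ultimately have "((\<lambda>x. \<Sum>n. c n * x ^ n) has_real_derivative ln (1 + u) / u) (at u)" by simp
  then show ?thesis
    by (rule has_field_derivative_transform_within_open[of _ _ _ "{0<..<1}"])
       (use assms c_sum in auto)
qed

definition log_antideriv :: "real \<Rightarrow> real" where
  "log_antideriv x = - alt_dilog (exp (- x))"

lemma log_antideriv_0: "log_antideriv 0 = - (pi ^ 2 / 12)"
  by (simp add: log_antideriv_def alt_dilog_1)

lemma abs_log_antideriv_le: "0 \<le> x \<Longrightarrow> \<bar>log_antideriv x\<bar> \<le> pi ^ 2 / 6 * exp (- x)"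
  unfolding log_antideriv_def abs_minus_cancel by (rule abs_alt_dilog_le) auto

lemma continuous_on_log_antideriv: "continuous_on {0..} log_antideriv"
  unfolding log_antideriv_def
  by (intro continuous_on_minus continuous_on_compose2[OF continuous_on_alt_dilog]) (auto intro!: continuous_intros)

lemma log_antideriv_has_derivative:
  assumes "0 < x"
  shows "(log_antideriv has_real_derivative ln (1 + exp (- x))) (at x)"
proof -
  have "((\<lambda>x. alt_dilog (exp (- x))) has_real_derivative (ln (1 + exp (- x)) / exp (- x)) * (exp (- x) * (- 1))) (at x)"
    by (rule DERIV_chain2[OF alt_dilog_has_derivative]) (use assms in \<open>auto intro!: derivative_eq_intros\<close>)
  from DERIV_minus[OF this] show ?thesis
    unfolding log_antideriv_def by simp
qed

subsection \<open>Riemann sums\<close>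

text \<open>The modulus V controls the variation of g on every subinterval, so that the errors telescope.\<close>

lemma riemann_sum_error:
  fixes g G V :: "real \<Rightarrow> real"
  assumes "z > 0" and cont: "continuous_on {0..} G"
    and deriv: "\<And>x. x > 0 \<Longrightarrow> (G has_real_derivative g x) (at x)"
    and var: "\<And>x y. 0 \<le> x \<Longrightarrow> x \<le> y \<Longrightarrow> \<bar>g x - g y\<bar> \<le> V x - V y"
  shows "\<bar>z * (\<Sum>k=1..n. g (real k * z)) - (G (real n * z) - G 0)\<bar> \<le> z * (V 0 - V (real n * z))"
proof (induction n)
  case (Suc n)
  define a b where "a = real n * z" and "b = real (Suc n) * z"
  have ab: "a < b" "0 \<le> a" "b - a = z" using \<open>z > 0\<close> by (auto simp: a_def b_def algebra_simps)
  have "\<exists>l x. a < x \<and> x < b \<and> (G has_real_derivative l) (at x) \<and> G b - G a = (b - a) * l"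
    by (rule MVT) (use ab deriv in \<open>auto intro!: continuous_on_subset[OF cont] simp: real_differentiable_def
        intro: order_trans dest: le_less_trans\<close>)
  then obtain l x where x: "a < x" "x < b" "(G has_real_derivative l) (at x)" "G b - G a = z * l"
    unfolding ab(3) by blast
  have "l = g x" using DERIV_unique[OF x(3) deriv] ab x by auto
  have "\<bar>g x - g b\<bar> \<le> V x - V b" using x ab by (intro var) auto
  moreover have "\<bar>g a - g x\<bar> \<le> V a - V x" using x ab by (intro var) auto
  ultimately have "\<bar>g b - g x\<bar> \<le> V a - V b" by linarith
  then have "z * \<bar>g b - g x\<bar> \<le> z * (V a - V b)" using \<open>z > 0\<close> by (intro mult_left_mono) auto
  then have "\<bar>z * g b - (G b - G a)\<bar> \<le> z * (V a - V b)"
    unfolding x(4) \<open>l = g x\<close> using \<open>z > 0\<close> by (simp add: abs_mult flip: right_diff_distrib)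
  then have "\<bar>z * g (real (Suc n) * z) - (G (real (Suc n) * z) - G (real n * z))\<bar>
      \<le> z * V (real n * z) - z * V (real (Suc n) * z)"
    unfolding a_def b_def right_diff_distrib .
  moreover have S: "z * (\<Sum>k=1..Suc n. g (real k * z)) = z * (\<Sum>k=1..n. g (real k * z)) + z * g (real (Suc n) * z)"
    by (simp add: distrib_left del: of_nat_Suc)
  ultimately show ?case using Suc
    unfolding S right_diff_distrib by linarith
qed simp

lemma trapezoid_sum_error:
  fixes f f' G V :: "real \<Rightarrow> real"
  assumes "z > 0" and cont: "continuous_on {0..} G"
    and deriv: "\<And>x. x > 0 \<Longrightarrow> (G has_real_derivative f x) (at x)"
    and deriv2: "\<And>x. (f has_real_derivative f' x) (at x)"
    and var: "\<And>x y. 0 \<le> x \<Longrightarrow> x \<le> y \<Longrightarrow> \<bar>f' x - f' y\<bar> \<le> V x - V y"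
  shows "\<bar>z * (\<Sum>k=1..n. f (real k * z)) + z / 2 * (f 0 - f (real n * z)) - (G (real n * z) - G 0)\<bar>
    \<le> z ^ 2 / 2 * (V 0 - V (real n * z))"
proof (induction n)
  case (Suc n)
  define a b where "a = real n * z" and "b = real (Suc n) * z"
  have ab: "a < b" "0 \<le> a" "b = a + z" using \<open>z > 0\<close> by (auto simp: a_def b_def algebra_simps)
  let ?E = "\<lambda>t. t / 2 * (f a + f (a + t)) - (G (a + t) - G a)"
  have fcont: "continuous_on UNIV f"
    using deriv2 by (intro continuous_at_imp_continuous_on) (auto intro: DERIV_isCont)
  have dE: "(?E has_real_derivative (f a - f (a + t)) / 2 + t / 2 * f' (a + t)) (at t)" if "t > 0" for t
  proof -
    have sh: "((\<lambda>t. a + t) has_real_derivative 1) (at t)"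
      by (auto intro!: derivative_eq_intros)
    have 1: "((\<lambda>t. f (a + t)) has_real_derivative f' (a + t)) (at t)"
      using DERIV_chain2[OF deriv2 sh] by simp
    have 2: "((\<lambda>t. G (a + t)) has_real_derivative f (a + t)) (at t)"
      using DERIV_chain2[OF deriv sh] that ab by simp
    have "(?E has_real_derivative 1 / 2 * (f a + f (a + t)) + f' (a + t) * (t / 2) - f (a + t)) (at t)"
      by (auto intro!: derivative_eq_intros 1 2)
    then show ?thesis by (rule DERIV_cong) (simp add: field_simps)
  qed
  have "\<exists>l t. 0 < t \<and> t < z \<and> (?E has_real_derivative l) (at t) \<and> ?E z - ?E 0 = (z - 0) * l"
  proof (rule MVT)
    show "continuous_on {0..z} ?E"
      using ab by (intro continuous_intros continuous_on_compose2[OF fcont] continuous_on_compose2[OF cont]) auto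
  qed (use dE \<open>z > 0\<close> in \<open>auto simp: real_differentiable_def\<close>)
  then obtain l t where t: "0 < t" "t < z" "(?E has_real_derivative l) (at t)" "?E z = z * l" by auto
  have l: "l = (f a - f (a + t)) / 2 + t / 2 * f' (a + t)"
    using DERIV_unique[OF t(3) dE[OF t(1)]] .
  obtain x where x: "a < x" "x < a + t" "f (a + t) - f a = t * f' x"
    using MVT2[of a "a + t" f f'] deriv2 t by auto
  have l': "l = t / 2 * (f' (a + t) - f' x)" using x(3) unfolding l by (simp add: algebra_simps)
  have "\<bar>l\<bar> = t / 2 * \<bar>f' (a + t) - f' x\<bar>" unfolding l' abs_mult using t(1) by simp
  also have "\<dots> \<le> z / 2 * (V a - V b)"
  proof (rule mult_mono)
    have "\<bar>f' x - f' (a + t)\<bar> \<le> V x - V (a + t)" "\<bar>f' a - f' x\<bar> \<le> V a - V x"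
      "\<bar>f' (a + t) - f' b\<bar> \<le> V (a + t) - V b"
      using x ab t by (auto intro!: var simp del: of_nat_Suc)
    then show "\<bar>f' (a + t) - f' x\<bar> \<le> V a - V b" by linarith
  qed (use t in auto)
  finally have "z * \<bar>l\<bar> \<le> z * (z / 2 * (V a - V b))" using \<open>z > 0\<close> by (intro mult_left_mono) auto
  then have "\<bar>?E z\<bar> \<le> z ^ 2 / 2 * (V a - V b)"
    unfolding t(4) using \<open>z > 0\<close> by (simp add: abs_mult power2_eq_square)
  then have "\<bar>z / 2 * (f a + f b) - (G b - G a)\<bar> \<le> z ^ 2 / 2 * (V a - V b)"
    unfolding ab(3) .
  then have E: "\<bar>z / 2 * f a + z / 2 * f b - (G b - G a)\<bar> \<le> z ^ 2 / 2 * V a - z ^ 2 / 2 * V b"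
    by (simp only: distrib_left right_diff_distrib)
  have IH: "\<bar>z * (\<Sum>k=1..n. f (real k * z)) + (z / 2 * f 0 - z / 2 * f a) - (G a - G 0)\<bar>
      \<le> z ^ 2 / 2 * V 0 - z ^ 2 / 2 * V a"
    using Suc by (simp only: right_diff_distrib a_def)
  have S: "z * (\<Sum>k=1..Suc n. f (real k * z)) = z * (\<Sum>k=1..n. f (real k * z)) + (z / 2 * f b + z / 2 * f b)"
    by (simp add: distrib_left b_def del: of_nat_Suc)
  show ?case
    using E IH unfolding S right_diff_distrib b_def[symmetric] by linarith
qed simp

definition logistic :: "real \<Rightarrow> real" where
  "logistic x = 1 / (1 + exp x)"

lemma logistic_pos: "logistic x > 0" and logistic_less_1: "logistic x < 1"
  and logistic_le_exp: "logistic x \<le> exp (- x)"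
  and one_minus_logistic_pos: "1 - logistic x > 0"
proof -
  define e where "e = exp x"
  have "e > 0" by (simp add: e_def)
  then show "logistic x > 0" "logistic x < 1" "logistic x \<le> exp (- x)" "1 - logistic x > 0"
    unfolding logistic_def exp_minus e_def[symmetric] by (auto simp: field_simps)
qed

lemma logistic_alt: "logistic x = exp (- x) / (1 + exp (- x))"
proof -
  have "1 + exp x > 0" "exp x > 0" by (auto intro: add_pos_pos)
  then show ?thesis by (simp add: logistic_def field_simps exp_minus)
qed

lemma logistic_has_derivative [derivative_intros]:
  "(logistic has_real_derivative - (logistic x * (1 - logistic x))) (at x)"
proof -
  have nz: "1 + exp x \<noteq> 0" using add_pos_pos[of 1 "exp x"] by simp
  have "((\<lambda>x. inverse (1 + exp x)) has_real_derivative - (inverse (1 + exp x) * exp x * inverse (1 + exp x))) (at x)"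
    using nz by (auto intro!: derivative_eq_intros)
  moreover have "inverse (1 + exp x) * exp x * inverse (1 + exp x) = logistic x * (1 - logistic x)"
    using nz by (simp add: logistic_def field_simps)
  ultimately show ?thesis by (simp add: logistic_def[abs_def] divide_inverse)
qed

lemma softplus_has_derivative:
  "((\<lambda>x. ln (1 + exp (- x))) has_real_derivative - logistic x) (at x)"
proof -
  have "1 + exp (- x) > 0" by (intro add_pos_pos) auto
  moreover have "((\<lambda>x. 1 + exp (- x)) has_real_derivative - exp (- x)) (at x)"
    by (auto intro!: derivative_eq_intros)
  ultimately have "((\<lambda>x. ln (1 + exp (- x))) has_real_derivative 1 / (1 + exp (- x)) * - exp (- x)) (at x)"
    by (rule DERIV_chain2[OF DERIV_ln_divide])
  then show ?thesis by (simp add: logistic_alt)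
qed

lemma variation_le_of_deriv_le:
  fixes g V :: "real \<Rightarrow> real"
  assumes "\<And>x. x \<ge> 0 \<Longrightarrow> (g has_real_derivative g' x) (at x)"
    and "\<And>x. x \<ge> 0 \<Longrightarrow> (V has_real_derivative V' x) (at x)"
    and "\<And>x. x \<ge> 0 \<Longrightarrow> \<bar>g' x\<bar> \<le> - V' x"
    and "0 \<le> x" "x \<le> y"
  shows "\<bar>g x - g y\<bar> \<le> V x - V y"
proof -
  have "V y - g y \<le> V x - g x"
  proof (rule DERIV_nonpos_imp_nonincreasing[OF \<open>x \<le> y\<close>])
    fix t assume "x \<le> t"
    then have "t \<ge> 0" using assms by simp
    then show "\<exists>d. ((\<lambda>t. V t - g t) has_real_derivative d) (at t) \<and> d \<le> 0"
      using assms(3)[of t] by (intro exI[of _ "V' t - g' t"]) (auto intro!: derivative_eq_intros assms)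
  qed
  moreover have "V y + g y \<le> V x + g x"
  proof (rule DERIV_nonpos_imp_nonincreasing[OF \<open>x \<le> y\<close>])
    fix t assume "x \<le> t"
    then have "t \<ge> 0" using assms by simp
    then show "\<exists>d. ((\<lambda>t. V t + g t) has_real_derivative d) (at t) \<and> d \<le> 0"
      using assms(3)[of t] by (intro exI[of _ "V' t + g' t"]) (auto intro!: derivative_eq_intros assms)
  qed
  ultimately show ?thesis by linarith
qed

definition mean_antideriv :: "real \<Rightarrow> real" where
  "mean_antideriv x = log_antideriv x - x * ln (1 + exp (- x))"

definition var_antideriv :: "real \<Rightarrow> real" where
  "var_antideriv x = 2 * mean_antideriv x - x ^ 2 * logistic x"

lemma mean_antideriv_has_derivative:
  assumes "x > 0"
  shows "(mean_antideriv has_real_derivative x * logistic x) (at x)"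
  unfolding mean_antideriv_def
  by (rule DERIV_cong[OF DERIV_diff[OF log_antideriv_has_derivative[OF assms]
        DERIV_mult[OF DERIV_ident softplus_has_derivative]]]) simp

lemma var_antideriv_has_derivative:
  assumes "x > 0"
  shows "(var_antideriv has_real_derivative x ^ 2 * (logistic x * (1 - logistic x))) (at x)"
  unfolding var_antideriv_def
  by (rule DERIV_cong[OF DERIV_diff[OF DERIV_cmult[OF mean_antideriv_has_derivative[OF assms]]
        DERIV_mult[OF DERIV_pow logistic_has_derivative]]])
     (simp add: algebra_simps power2_eq_square)

lemma continuous_on_mean_antideriv: "continuous_on {0..} mean_antideriv"
proof -
  have "1 + exp (- x) \<noteq> 0" for x :: real using add_pos_pos[of 1 "exp (- x)"] by simp
  then show ?thesis
    unfolding mean_antideriv_def by (intro continuous_intros continuous_on_log_antideriv) auto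
qed

lemma continuous_on_var_antideriv: "continuous_on {0..} var_antideriv"
proof -
  have "continuous_on {0..} logistic"
    by (rule DERIV_continuous_on[OF has_field_derivative_at_within[OF logistic_has_derivative]])
  then show ?thesis
    unfolding var_antideriv_def by (intro continuous_intros continuous_on_mean_antideriv)
qed

lemma abs_mean_antideriv_le:
  assumes "x \<ge> 0"
  shows "\<bar>mean_antideriv x\<bar> \<le> (pi ^ 2 / 6 + x) * exp (- x)"
proof -
  have "0 \<le> ln (1 + exp (- x))" "ln (1 + exp (- x)) \<le> exp (- x)"
    by (auto intro!: ln_ge_zero ln_add_one_self_le_self)
  then have "\<bar>x * ln (1 + exp (- x))\<bar> \<le> x * exp (- x)"
    using assms by (simp add: abs_mult mult_left_mono)
  then show ?thesis
    using abs_log_antideriv_le[OF assms] unfolding mean_antideriv_def distrib_right by linarith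
qed

lemma abs_var_antideriv_le:
  assumes "x \<ge> 0"
  shows "\<bar>var_antideriv x\<bar> \<le> (pi ^ 2 / 3 + 2 * x + x ^ 2) * exp (- x)"
proof -
  have "\<bar>x ^ 2 * logistic x\<bar> \<le> x ^ 2 * exp (- x)"
    using logistic_pos[of x] logistic_le_exp[of x] by (simp add: abs_mult mult_left_mono)
  moreover have "(pi ^ 2 / 3 + 2 * x + x ^ 2) * exp (- x) = 2 * ((pi ^ 2 / 6 + x) * exp (- x)) + x ^ 2 * exp (- x)"
    by (simp add: algebra_simps)
  ultimately show ?thesis
    using abs_mean_antideriv_le[OF assms] unfolding var_antideriv_def by linarith
qed

lemma log_partition_error:
  assumes "z > 0"
  shows "\<bar>(\<Sum>k=1..n. ln (1 + exp (- (real k * z)))) - (pi ^ 2 / 12 / z - ln 2 / 2)\<bar>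
    \<le> z / 4 + (pi ^ 2 / 6 / z + 1) * exp (- (real n * z))"
proof -
  let ?S = "\<Sum>k=1..n. ln (1 + exp (- (real k * z)))"
  let ?f = "ln (1 + exp (- (real n * z)))"
  have var: "\<bar>(- logistic x) - (- logistic y)\<bar> \<le> logistic x - logistic y" if "0 \<le> x" "x \<le> y" for x y
    by (rule variation_le_of_deriv_le[OF _ _ _ that,
          where g' = "\<lambda>x. logistic x * (1 - logistic x)" and V' = "\<lambda>x. - (logistic x * (1 - logistic x))"])
       (auto intro!: derivative_eq_intros logistic_has_derivative simp: abs_mult logistic_pos less_imp_le logistic_less_1)
  have "\<bar>z * ?S + z / 2 * (ln (1 + exp (- 0)) - ?f) - (log_antideriv (real n * z) - log_antideriv 0)\<bar>
    \<le> z ^ 2 / 2 * (logistic 0 - logistic (real n * z))"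
    by (rule trapezoid_sum_error[OF assms continuous_on_log_antideriv log_antideriv_has_derivative softplus_has_derivative var])
  also have "\<dots> \<le> z ^ 2 / 2 * (1 / 2)"
    using logistic_pos[of "real n * z"] by (intro mult_left_mono) (auto simp: logistic_def)
  finally have "\<bar>z * ?S + z / 2 * (ln 2 - ?f) - (log_antideriv (real n * z) + pi ^ 2 / 12)\<bar> / z \<le> (z ^ 2 / 2 * (1 / 2)) / z"
    using assms by (intro divide_right_mono) (auto simp: log_antideriv_0)
  also have "(z ^ 2 / 2 * (1 / 2)) / z = z / 4" using assms by (simp add: power2_eq_square)
  also have "\<bar>z * ?S + z / 2 * (ln 2 - ?f) - (log_antideriv (real n * z) + pi ^ 2 / 12)\<bar> / z =
      \<bar>?S - (pi ^ 2 / 12 / z - ln 2 / 2) - (?f / 2 + log_antideriv (real n * z) / z)\<bar>"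
    (is "\<bar>?A\<bar> / z = \<bar>?B\<bar>")
  proof -
    have "z * S + z / 2 * (l - f) - (L + P) = z * (S - (P / z - l / 2) - (f / 2 + L / z))"
      for S l f L P :: real
      using assms by (simp add: right_diff_distrib distrib_left)
    then have "?A = z * ?B" .
    then show ?thesis using assms by (simp only: abs_mult abs_of_pos) simp
  qed
  finally have 1: "\<bar>?B\<bar> \<le> z / 4" .
  have 2: "0 \<le> ?f" "?f \<le> exp (- (real n * z))"
    by (auto intro!: ln_ge_zero ln_add_one_self_le_self)
  have "\<bar>log_antideriv (real n * z)\<bar> / z \<le> pi ^ 2 / 6 * exp (- (real n * z)) / z"
    using assms by (intro divide_right_mono abs_log_antideriv_le) auto
  then have 3: "\<bar>log_antideriv (real n * z) / z\<bar> \<le> pi ^ 2 / 6 / z * exp (- (real n * z))"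
    using assms by simp
  show ?thesis using 1 2 3 unfolding distrib_right mult_1 by linarith
qed

lemma mean_error:
  assumes "z > 0"
  shows "\<bar>z ^ 2 * (\<Sum>k=1..n. real k * logistic (real k * z)) - pi ^ 2 / 12\<bar>
    \<le> 2 * z + (pi ^ 2 / 6 + real n * z) * exp (- (real n * z))"
proof -
  have var: "\<bar>x * logistic x - y * logistic y\<bar> \<le> (2 + x) * exp (- x) - (2 + y) * exp (- y)"
    if "0 \<le> x" "x \<le> y" for x y
  proof (rule variation_le_of_deriv_le[OF _ _ _ that])
    fix x :: real assume x: "x \<ge> 0"
    show "((\<lambda>x. x * logistic x) has_real_derivative logistic x - x * (logistic x * (1 - logistic x))) (at x)"
      by (rule derivative_eq_intros logistic_has_derivative refl)+ simp
    show "((\<lambda>x. (2 + x) * exp (- x)) has_real_derivative - (1 + x) * exp (- x)) (at x)"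
      by (rule derivative_eq_intros refl)+ (simp add: algebra_simps)
    have "0 \<le> logistic x * (1 - logistic x)" "logistic x * (1 - logistic x) \<le> logistic x * 1"
      using logistic_pos[of x] logistic_less_1[of x] by (auto intro!: mult_left_mono simp del: mult_1_right)
    then have "0 \<le> logistic x * (1 - logistic x)" "logistic x * (1 - logistic x) \<le> exp (- x)"
      using logistic_le_exp[of x] by auto
    then have "0 \<le> x * (logistic x * (1 - logistic x))" "x * (logistic x * (1 - logistic x)) \<le> x * exp (- x)"
      using x by (auto intro: mult_left_mono)
    moreover have "- (- (1 + x) * exp (- x)) = exp (- x) + x * exp (- x)" by (simp add: algebra_simps)
    ultimately show "\<bar>logistic x - x * (logistic x * (1 - logistic x))\<bar> \<le> - (- (1 + x) * exp (- x))"
      using logistic_pos[of x] logistic_le_exp[of x] by linarith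
  qed
  have "\<bar>z * (\<Sum>k=1..n. (real k * z) * logistic (real k * z)) - (mean_antideriv (real n * z) - mean_antideriv 0)\<bar>
     \<le> z * ((2 + 0) * exp (- 0) - (2 + real n * z) * exp (- (real n * z)))"
    by (rule riemann_sum_error[OF assms continuous_on_mean_antideriv mean_antideriv_has_derivative var])
  also have "\<dots> \<le> z * 2" using assms by (intro mult_left_mono) auto
  also have "z * (\<Sum>k=1..n. (real k * z) * logistic (real k * z)) = z ^ 2 * (\<Sum>k=1..n. real k * logistic (real k * z))"
    by (simp add: sum_distrib_left power2_eq_square mult_ac)
  also have "mean_antideriv 0 = - (pi ^ 2 / 12)"
    by (simp add: mean_antideriv_def log_antideriv_0)
  finally show ?thesis
    using abs_mean_antideriv_le[of "real n * z"] assms by (simp add: less_imp_le)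
qed

lemma variance_error:
  assumes "z > 0"
  shows "\<bar>z ^ 3 * (\<Sum>k=1..n. real k ^ 2 * (logistic (real k * z) * (1 - logistic (real k * z)))) - pi ^ 2 / 6\<bar>
    \<le> 4 * z + (pi ^ 2 / 3 + 2 * (real n * z) + (real n * z) ^ 2) * exp (- (real n * z))"
proof -
  let ?q = "\<lambda>x. logistic x * (1 - logistic x)"
  have var: "\<bar>x ^ 2 * ?q x - y ^ 2 * ?q y\<bar> \<le> (x ^ 2 + 4 * x + 4) * exp (- x) - (y ^ 2 + 4 * y + 4) * exp (- y)"
    if "0 \<le> x" "x \<le> y" for x y
  proof (rule variation_le_of_deriv_le[OF _ _ _ that])
    fix x :: real assume x: "x \<ge> 0"
    show "((\<lambda>x. x ^ 2 * ?q x) has_real_derivative 2 * x * ?q x - x ^ 2 * (?q x * (1 - 2 * logistic x))) (at x)"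
      by (rule derivative_eq_intros logistic_has_derivative refl)+ (simp add: algebra_simps)
    show "((\<lambda>x. (x ^ 2 + 4 * x + 4) * exp (- x)) has_real_derivative - (2 * x + x ^ 2) * exp (- x)) (at x)"
      by (rule derivative_eq_intros refl)+ (simp add: algebra_simps)
    have "0 \<le> ?q x" "?q x \<le> logistic x * 1"
      using logistic_pos[of x] logistic_less_1[of x] by (auto intro!: mult_left_mono simp del: mult_1_right)
    then have q: "0 \<le> ?q x" "?q x \<le> exp (- x)"
      using logistic_le_exp[of x] by auto
    have 1: "0 \<le> 2 * x * ?q x" "2 * x * ?q x \<le> 2 * x * exp (- x)"
      using x q by (auto intro: mult_left_mono simp del: mult_nonneg_nonneg simp add: mult_nonneg_nonneg)
    have "\<bar>?q x * (1 - 2 * logistic x)\<bar> = ?q x * \<bar>1 - 2 * logistic x\<bar>" unfolding abs_mult[of "?q x"] abs_of_nonneg[OF q(1)] ..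
    also have "\<dots> \<le> exp (- x) * 1"
      using q logistic_pos[of x] logistic_less_1[of x] by (intro mult_mono) auto
    finally have 2: "\<bar>x ^ 2 * (?q x * (1 - 2 * logistic x))\<bar> \<le> x ^ 2 * exp (- x)"
      by (simp add: abs_mult mult_left_mono)
    have "- (- (2 * x + x ^ 2) * exp (- x)) = 2 * x * exp (- x) + x ^ 2 * exp (- x)" by (simp add: algebra_simps)
    then show "\<bar>2 * x * ?q x - x ^ 2 * (?q x * (1 - 2 * logistic x))\<bar> \<le> - (- (2 * x + x ^ 2) * exp (- x))"
      using 1 2 by linarith
  qed
  have "\<bar>z * (\<Sum>k=1..n. (real k * z) ^ 2 * ?q (real k * z)) - (var_antideriv (real n * z) - var_antideriv 0)\<bar>
     \<le> z * ((0 ^ 2 + 4 * 0 + 4) * exp (- 0) - ((real n * z) ^ 2 + 4 * (real n * z) + 4) * exp (- (real n * z)))"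
    by (rule riemann_sum_error[OF assms continuous_on_var_antideriv var_antideriv_has_derivative var])
  also have "\<dots> \<le> z * 4" using assms by (intro mult_left_mono) auto
  also have "z * (\<Sum>k=1..n. (real k * z) ^ 2 * ?q (real k * z)) = z ^ 3 * (\<Sum>k=1..n. real k ^ 2 * ?q (real k * z))"
    by (simp add: sum_distrib_left power2_eq_square power3_eq_cube mult_ac)
  also have "var_antideriv 0 = - (pi ^ 2 / 6)"
    by (simp add: var_antideriv_def mean_antideriv_def log_antideriv_0)
  finally show ?thesis
    using abs_var_antideriv_le[of "real n * z"] assms by (simp add: less_imp_le)
qed

lemma moment_sum_le:
  assumes "z > 0"
  shows "z ^ Suc m * (\<Sum>k=1..n. real k ^ m * logistic (real k * z)) \<le> fact m * 2 ^ Suc m"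
proof -
  have pow: "x ^ m * exp (- x) \<le> fact m * 2 ^ m * exp (- (x / 2))" if "x \<ge> 0" for x :: real
  proof -
    have "(x / 2) ^ m / fact m \<le> exp (x / 2)"
    proof -
      have "(\<Sum>n\<in>{m}. (x / 2) ^ n /\<^sub>R fact n) \<le> (\<Sum>n. (x / 2) ^ n /\<^sub>R fact n)"
        by (rule sum_le_suminf[OF summable_exp_generic]) (use that in auto)
      then have "(x / 2) ^ m /\<^sub>R fact m \<le> exp (x / 2)" unfolding exp_def by simp
      then show ?thesis by (simp only: real_scaleR_def divide_inverse mult.commute)
    qed
    then have "x ^ m \<le> fact m * 2 ^ m * exp (x / 2)" by (simp add: power_divide field_simps)
    then have "x ^ m * exp (- x) \<le> fact m * 2 ^ m * exp (x / 2) * exp (- x)" by (intro mult_right_mono) auto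
    also have "\<dots> = fact m * 2 ^ m * exp (- (x / 2))" by (simp add: mult.assoc flip: exp_add)
    finally show ?thesis .
  qed
  have geo: "(\<Sum>k=1..n. exp (- (y * real k))) \<le> 1 / y" if "y > 0" for y :: real and n
  proof -
    have "(\<Sum>k=1..n. exp (- (y * real k))) * (exp y - 1) \<le> 1 - exp (- (y * real n))"
    proof (induction n)
      case (Suc n)
      have "exp (- (y * real (Suc n))) * (exp y - 1) = exp (- (y * real n)) - exp (- (y * real (Suc n)))"
        by (simp add: algebra_simps flip: exp_add)
      then show ?case using Suc by (simp add: distrib_right del: of_nat_Suc)
    qed simp
    also have "\<dots> \<le> 1" by simp
    finally have "(\<Sum>k=1..n. exp (- (y * real k))) * (exp y - 1) \<le> 1" .
    moreover have "(\<Sum>k=1..n. exp (- (y * real k))) * y \<le> (\<Sum>k=1..n. exp (- (y * real k))) * (exp y - 1)"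
    proof (intro mult_left_mono sum_nonneg)
      show "y \<le> exp y - 1" using exp_ge_add_one_self[of y] by linarith
    qed auto
    ultimately show ?thesis using that by (simp add: field_simps)
  qed
  have "z ^ Suc m * (\<Sum>k=1..n. real k ^ m * logistic (real k * z)) = z * (\<Sum>k=1..n. (real k * z) ^ m * logistic (real k * z))"
    by (simp add: sum_distrib_left power_mult_distrib mult_ac)
  also have "\<dots> \<le> z * (\<Sum>k=1..n. fact m * 2 ^ m * exp (- (z / 2 * real k)))"
  proof (intro mult_left_mono sum_mono)
    fix k
    have "(real k * z) ^ m * logistic (real k * z) \<le> (real k * z) ^ m * exp (- (real k * z))"
      using assms by (intro mult_left_mono logistic_le_exp) auto
    also have "\<dots> \<le> fact m * 2 ^ m * exp (- (real k * z / 2))" using assms by (intro pow) auto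
    finally show "(real k * z) ^ m * logistic (real k * z) \<le> fact m * 2 ^ m * exp (- (z / 2 * real k))"
      by (simp add: mult_ac)
  qed (use assms in auto)
  also have "\<dots> = z * (fact m * 2 ^ m * (\<Sum>k=1..n. exp (- (z / 2 * real k))))"
    by (simp add: sum_distrib_left)
  also have "\<dots> \<le> z * (fact m * 2 ^ m * (1 / (z / 2)))"
    using assms by (intro mult_left_mono geo) auto
  also have "\<dots> = fact m * 2 ^ Suc m" using assms by simp
  finally show ?thesis .
qed

subsection \<open>The saddle point\<close>

definition saddle_const :: real where
  "saddle_const = pi / (2 * sqrt 3)"

definition saddle :: "nat \<Rightarrow> real" where
  "saddle n = saddle_const / sqrt (real n)"

lemma saddle_const_pos: "saddle_const > 0"
  by (simp add: saddle_const_def)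

lemma saddle_const_square: "saddle_const ^ 2 = pi ^ 2 / 12"
  by (simp add: saddle_const_def power_divide power_mult_distrib)

lemma saddle_pos: "n > 0 \<Longrightarrow> saddle n > 0"
  by (simp add: saddle_def saddle_const_pos)

lemma saddle_square: "n > 0 \<Longrightarrow> saddle n ^ 2 * real n = pi ^ 2 / 12"
  by (simp add: saddle_def power_divide saddle_const_square)

lemma saddle_exponent:
  assumes "n > 0"
  shows "real n * saddle n + pi ^ 2 / 12 / saddle n = pi * sqrt (real n / 3)"
proof -
  have z: "saddle n > 0" using saddle_pos[OF assms] .
  have "pi ^ 2 / 12 / saddle n = real n * saddle n"
    unfolding saddle_square[OF assms, symmetric] using z by (simp add: power2_eq_square)
  moreover have "real n * saddle n = sqrt (real n) * saddle_const"
  proof -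
    have "real n * saddle n = (real n / sqrt (real n)) * saddle_const" by (simp add: saddle_def)
    then show ?thesis by (simp add: real_div_sqrt)
  qed
  ultimately have "real n * saddle n + pi ^ 2 / 12 / saddle n = sqrt (real n) * (2 * saddle_const)" by simp
  also have "2 * saddle_const = pi / sqrt 3" by (simp add: saddle_const_def)
  finally show ?thesis by (simp add: real_sqrt_divide)
qed

lemma partition_product_asymp:
  "(\<lambda>n. exp (real n * saddle n) * (\<Prod>k=1..n. 1 + exp (- real k * saddle n)) / exp (pi * sqrt (real n / 3)))
     \<longlonglongrightarrow> 1 / sqrt 2"
proof -
  define c where "c = saddle_const"
  have c: "c > 0" unfolding c_def by (rule saddle_const_pos)
  define E where "E n = (\<Sum>k=1..n. ln (1 + exp (- (real k * saddle n)))) - (pi ^ 2 / 12 / saddle n - ln 2 / 2)" for n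
  have "(\<lambda>n. (c / sqrt (real n)) / 4 + (pi ^ 2 / 6 / (c / sqrt (real n)) + 1) * exp (- (real n * (c / sqrt (real n))))) \<longlonglongrightarrow> 0"
    using c by real_asymp
  then have "(\<lambda>n. saddle n / 4 + (pi ^ 2 / 6 / saddle n + 1) * exp (- (real n * saddle n))) \<longlonglongrightarrow> 0"
    by (simp add: saddle_def c_def)
  then have "E \<longlonglongrightarrow> 0"
  proof (rule Lim_null_comparison[rotated], intro eventually_mono[OF eventually_gt_at_top[of 0]])
    fix n :: nat assume "n > 0"
    from log_partition_error[OF saddle_pos[OF this], of n]
    show "norm (E n) \<le> saddle n / 4 + (pi ^ 2 / 6 / saddle n + 1) * exp (- (real n * saddle n))"
      unfolding E_def real_norm_def .
  qed
  then have "(\<lambda>n. exp (E n - ln 2 / 2)) \<longlonglongrightarrow> exp (0 - ln 2 / 2)"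
    by (intro tendsto_intros)
  moreover have "exp (0 - ln 2 / 2) = 1 / sqrt (2 :: real)"
  proof -
    have "exp (ln 2 / 2) = sqrt (2 :: real)"
      using exp_ln[of "sqrt 2"] by (simp add: ln_sqrt)
    then show ?thesis by (simp add: exp_minus inverse_eq_divide)
  qed
  moreover have "\<forall>\<^sub>F n in sequentially. exp (E n - ln 2 / 2) =
      exp (real n * saddle n) * (\<Prod>k=1..n. 1 + exp (- real k * saddle n)) / exp (pi * sqrt (real n / 3))"
  proof (rule eventually_mono[OF eventually_gt_at_top[of 0]])
    fix n :: nat assume n: "n > 0"
    have "(\<Prod>k=1..n. 1 + exp (- real k * saddle n)) = (\<Prod>k=1..n. exp (ln (1 + exp (- (real k * saddle n)))))"
      by (intro prod.cong refl) (simp add: add_pos_pos)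
    also have "\<dots> = exp (\<Sum>k=1..n. ln (1 + exp (- (real k * saddle n))))"
      by (simp add: exp_sum)
    also have "(\<Sum>k=1..n. ln (1 + exp (- (real k * saddle n)))) = E n + (pi ^ 2 / 12 / saddle n - ln 2 / 2)"
      by (simp add: E_def)
    finally show "exp (E n - ln 2 / 2) =
      exp (real n * saddle n) * (\<Prod>k=1..n. 1 + exp (- real k * saddle n)) / exp (pi * sqrt (real n / 3))"
      by (simp only: saddle_exponent[OF n, symmetric] exp_add[symmetric] exp_diff[symmetric]) simp
  qed
  ultimately show ?thesis
    by (simp only: tendsto_cong)
qed

definition part_prob :: "nat \<Rightarrow> nat \<Rightarrow> real" where
  "part_prob n k = logistic (real k * saddle n)"

lemma mean_asymp:
  "(\<lambda>n. ((\<Sum>k=1..n. real k * part_prob n k) - real n) / real n powr (3/4)) \<longlonglongrightarrow> 0"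
proof -
  define c where "c = saddle_const"
  have c: "c > 0" unfolding c_def by (rule saddle_const_pos)
  have "(\<lambda>n. (2 * (c / sqrt (real n)) + (pi ^ 2 / 6 + real n * (c / sqrt (real n))) * exp (- (real n * (c / sqrt (real n)))))
      / (c / sqrt (real n)) ^ 2 / real n powr (3/4)) \<longlonglongrightarrow> 0"
    using c by real_asymp
  then have lim: "(\<lambda>n. (2 * saddle n + (pi ^ 2 / 6 + real n * saddle n) * exp (- (real n * saddle n)))
      / saddle n ^ 2 / real n powr (3/4)) \<longlonglongrightarrow> 0"
    by (simp add: saddle_def c_def)
  show ?thesis
  proof (rule Lim_null_comparison[OF _ lim], rule eventually_mono[OF eventually_gt_at_top[of 0]])
    fix n :: nat assume n: "n > 0"
    let ?S = "\<Sum>k=1..n. real k * part_prob n k" and ?z = "saddle n"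
    have z: "?z > 0" using saddle_pos[OF n] .
    have "\<bar>?z ^ 2 * ?S - ?z ^ 2 * real n\<bar> \<le> 2 * ?z + (pi ^ 2 / 6 + real n * ?z) * exp (- (real n * ?z))"
      unfolding saddle_square[OF n] part_prob_def by (rule mean_error[OF z])
    moreover have "\<bar>?z ^ 2 * ?S - ?z ^ 2 * real n\<bar> = ?z ^ 2 * \<bar>?S - real n\<bar>"
      unfolding right_diff_distrib[symmetric] abs_mult by simp
    ultimately have "\<bar>?S - real n\<bar> \<le> (2 * ?z + (pi ^ 2 / 6 + real n * ?z) * exp (- (real n * ?z))) / ?z ^ 2"
      using z by (simp only: pos_le_divide_eq zero_less_power mult.commute)
    then have "\<bar>?S - real n\<bar> / real n powr (3/4) \<le>
        (2 * ?z + (pi ^ 2 / 6 + real n * ?z) * exp (- (real n * ?z))) / ?z ^ 2 / real n powr (3/4)"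
      by (intro divide_right_mono) auto
    then show "norm ((?S - real n) / real n powr (3/4)) \<le>
        (2 * ?z + (pi ^ 2 / 6 + real n * ?z) * exp (- (real n * ?z))) / ?z ^ 2 / real n powr (3/4)"
      by simp
  qed
qed

definition part_variance :: "nat \<Rightarrow> nat \<Rightarrow> real" where
  "part_variance n k = real k ^ 2 * (part_prob n k * (1 - part_prob n k))"

definition limit_variance :: real where
  "limit_variance = 4 * sqrt 3 / pi"

lemma limit_variance_pos: "limit_variance > 0"
  by (simp add: limit_variance_def)

lemma variance_asymp:
  "(\<lambda>n. (\<Sum>k=1..n. part_variance n k) / real n powr (3/2)) \<longlonglongrightarrow> limit_variance"
proof -
  define c where "c = saddle_const"
  have c: "c > 0" unfolding c_def by (rule saddle_const_pos)
  have "(\<lambda>n. 4 * (c / sqrt (real n)) + (pi ^ 2 / 3 + 2 * (real n * (c / sqrt (real n))) + (real n * (c / sqrt (real n))) ^ 2)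
       * exp (- (real n * (c / sqrt (real n))))) \<longlonglongrightarrow> 0"
    using c by real_asymp
  then have lim: "(\<lambda>n. 4 * saddle n + (pi ^ 2 / 3 + 2 * (real n * saddle n) + (real n * saddle n) ^ 2)
       * exp (- (real n * saddle n))) \<longlonglongrightarrow> 0"
    by (simp add: saddle_def c_def)
  have "(\<lambda>n. saddle n ^ 3 * (\<Sum>k=1..n. part_variance n k) - pi ^ 2 / 6) \<longlonglongrightarrow> 0"
  proof (rule Lim_null_comparison[OF _ lim], intro eventually_mono[OF eventually_gt_at_top[of 0]])
    fix n :: nat assume "n > 0"
    from variance_error[OF saddle_pos[OF this], of n]
    show "norm (saddle n ^ 3 * (\<Sum>k=1..n. part_variance n k) - pi ^ 2 / 6) \<le>
       4 * saddle n + (pi ^ 2 / 3 + 2 * (real n * saddle n) + (real n * saddle n) ^ 2) * exp (- (real n * saddle n))"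
      unfolding part_variance_def part_prob_def real_norm_def .
  qed
  then have "(\<lambda>n. saddle n ^ 3 * (\<Sum>k=1..n. part_variance n k)) \<longlonglongrightarrow> pi ^ 2 / 6"
    by (simp add: LIM_zero_iff)
  then have "(\<lambda>n. saddle n ^ 3 * (\<Sum>k=1..n. part_variance n k) / c ^ 3) \<longlonglongrightarrow> pi ^ 2 / 6 / c ^ 3"
    by (intro tendsto_divide tendsto_const) (use c in auto)
  moreover have "pi ^ 2 / 6 / c ^ 3 = limit_variance"
    by (simp add: c_def saddle_const_def limit_variance_def power_divide power_mult_distrib power3_eq_cube power2_eq_square field_simps)
  moreover have "\<forall>\<^sub>F n in sequentially. saddle n ^ 3 * (\<Sum>k=1..n. part_variance n k) / c ^ 3 =
      (\<Sum>k=1..n. part_variance n k) / real n powr (3/2)"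
  proof (rule eventually_mono[OF eventually_gt_at_top[of 0]])
    fix n :: nat assume n: "n > 0"
    have "sqrt (real n) ^ 3 = real n powr (3/2)"
      using n by (simp add: powr_half_sqrt[symmetric] powr_powr flip: powr_realpow)
    then show "saddle n ^ 3 * (\<Sum>k=1..n. part_variance n k) / c ^ 3 = (\<Sum>k=1..n. part_variance n k) / real n powr (3/2)"
      using c by (simp add: saddle_def c_def[symmetric] power_divide)
  qed
  ultimately show ?thesis
    by (simp only: tendsto_cong)
qed

lemma moment_asymp:
  assumes "real (Suc m) / 2 < a"
  shows "(\<lambda>n. (\<Sum>k=1..n. real k ^ m * part_prob n k) / real n powr a) \<longlonglongrightarrow> 0"
proof -
  define c where "c = saddle_const"
  have c: "c > 0" unfolding c_def by (rule saddle_const_pos)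
  define K where "K = fact m * 2 ^ Suc m / c ^ Suc m"
  define e where "e = real (Suc m) / 2 - a"
  have "e < 0" using assms by (simp add: e_def)
  then have lim: "(\<lambda>n. K * real n powr e) \<longlonglongrightarrow> 0"
    by real_asymp
  show ?thesis
  proof (rule Lim_null_comparison[OF _ lim], rule eventually_mono[OF eventually_gt_at_top[of 0]])
    fix n :: nat assume n: "n > 0"
    let ?S = "\<Sum>k=1..n. real k ^ m * part_prob n k"
    have z: "saddle n > 0" using saddle_pos[OF n] .
    have S: "?S \<ge> 0" by (intro sum_nonneg) (auto simp: part_prob_def logistic_pos less_imp_le)
    have "saddle n ^ Suc m * ?S \<le> fact m * 2 ^ Suc m"
      unfolding part_prob_def by (rule moment_sum_le[OF z])
    then have "?S \<le> fact m * 2 ^ Suc m / saddle n ^ Suc m"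
      using z by (simp only: pos_le_divide_eq zero_less_power mult.commute)
    also have "\<dots> = K * sqrt (real n) ^ Suc m"
      by (simp add: K_def saddle_def c_def power_divide)
    also have "sqrt (real n) ^ Suc m = real n powr (real (Suc m) / 2)"
      using n by (simp add: powr_half_sqrt[symmetric] powr_powr flip: powr_realpow del: power_Suc)
    finally have "?S / real n powr a \<le> K * real n powr (real (Suc m) / 2) / real n powr a"
      by (intro divide_right_mono) auto
    also have "\<dots> = K * real n powr e" using n by (simp add: e_def powr_diff)
    finally show "norm (?S / real n powr a) \<le> K * real n powr e" using S by simp
  qed
qed

subsection \<open>Bounds for the characteristic function\<close>

lemma part_char_eq:
  "part_char z k t = of_real (1 - logistic (real k * z)) + of_real (logistic (real k * z)) * cis (real k * t)"
proof -
  define e where "e = exp (- (real k * z))"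
  have e: "1 + e > 0" by (simp add: e_def add_pos_pos)
  have 1: "logistic (real k * z) = e / (1 + e)"
    by (simp add: logistic_alt e_def)
  then have 2: "1 - logistic (real k * z) = 1 / (1 + e)"
    using e by (simp add: field_simps)
  show ?thesis
    by (subst 2, subst 1) (simp add: part_char_def e_def[symmetric] add_divide_distrib)
qed

lemma norm_mixture_square:
  "norm (of_real (1 - p) + of_real p * cis x) ^ 2 = 1 - 2 * (p * (1 - p)) * (1 - cos x)"
proof -
  have "norm (of_real (1 - p) + of_real p * cis x) ^ 2 = ((1 - p) + p * cos x) ^ 2 + (p * sin x) ^ 2"
    unfolding cmod_power2 by simp
  also have "\<dots> = (1 - p) ^ 2 + 2 * p * (1 - p) * cos x + p ^ 2 * ((cos x) ^ 2 + (sin x) ^ 2)"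
  proof -
    have "((1 - p) + p * c) ^ 2 + (p * s) ^ 2 = (1 - p) ^ 2 + 2 * p * (1 - p) * c + p ^ 2 * (c ^ 2 + s ^ 2)" for c s :: real
      by (simp add: power2_eq_square algebra_simps)
    then show ?thesis .
  qed
  also have "(cos x) ^ 2 + (sin x) ^ 2 = 1" by simp
  also have "(1 - p) ^ 2 + 2 * p * (1 - p) * c + p ^ 2 * 1 = 1 - 2 * (p * (1 - p)) * (1 - c)" for c :: real
    by (simp add: power2_eq_square algebra_simps)
  finally show ?thesis .
qed

lemma norm_part_char_le:
  "norm (part_char z k t) \<le> exp (- (logistic (real k * z) * (1 - logistic (real k * z)) * (1 - cos (real k * t))))"
proof -
  define p where "p = logistic (real k * z)"
  let ?y = "p * (1 - p) * (1 - cos (real k * t))"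
  have "norm (part_char z k t) ^ 2 = 1 - 2 * ?y"
    unfolding part_char_eq p_def[symmetric] norm_mixture_square by simp
  also have "\<dots> \<le> exp (- (2 * ?y))" using exp_ge_add_one_self[of "- (2 * ?y)"] by linarith
  also have "\<dots> = exp (- ?y) ^ 2" by (simp add: power2_eq_square flip: exp_add)
  finally show ?thesis unfolding p_def by (rule power2_le_imp_le) simp
qed

lemma norm_part_char_le_1: "norm (part_char z k t) \<le> 1"
proof -
  have "0 \<le> logistic (real k * z) * (1 - logistic (real k * z)) * (1 - cos (real k * t))"
    using logistic_pos[of "real k * z"] one_minus_logistic_pos[of "real k * z"] cos_le_one[of "real k * t"]
    by (intro mult_nonneg_nonneg) auto
  then have "exp (- (logistic (real k * z) * (1 - logistic (real k * z)) * (1 - cos (real k * t)))) \<le> 1"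
    by simp
  with norm_part_char_le[of z k t] show ?thesis by linarith
qed

lemma logistic_variance_ge:
  assumes "0 \<le> x" "x \<le> 1"
  shows "1 / 16 \<le> logistic x * (1 - logistic x)"
proof -
  define e where "e = exp x"
  have e: "1 \<le> e" "e \<le> 3"
    using assms exp_le order_trans[of "exp x" "exp 1" 3] by (auto simp: e_def)
  have "logistic x * (1 - logistic x) = e / (1 + e) ^ 2"
    using e by (simp add: logistic_def e_def[symmetric] power2_eq_square field_simps)
  moreover have "(1 + e) ^ 2 \<le> 16 * e"
  proof -
    have "(1 + e) ^ 2 \<le> 4 ^ 2" using e by (intro power_mono) auto
    then show ?thesis using e by simp
  qed
  moreover have "(1 + e) ^ 2 > 0" using e by simp
  ultimately show ?thesis by (simp add: pos_le_divide_eq)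
qed

lemma jordan_sin_ge:
  fixes y :: real
  assumes "0 \<le> y" "y \<le> pi / 2"
  shows "2 / pi * y \<le> sin y"
proof (cases "y = 0 \<or> y = pi / 2")
  case False
  then have y: "0 < y" "y < pi / 2" using assms by auto
  obtain a where a: "0 < a" "a < y" "sin y - sin 0 = (y - 0) * cos a"
    using MVT2[of 0 y sin cos] y DERIV_sin by blast
  obtain b where b: "y < b" "b < pi / 2" "sin (pi / 2) - sin y = (pi / 2 - y) * cos b"
    using MVT2[of y "pi / 2" sin cos] y DERIV_sin by blast
  have "cos b \<le> cos a" using a b y by (intro cos_monotone_0_pi_le) auto
  then have "y * (pi / 2 - y) * cos b \<le> y * (pi / 2 - y) * cos a"
    using y by (intro mult_left_mono) auto
  moreover have "y * (pi / 2 - y) * cos b = y * (1 - sin y)" using b(3) by simp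
  moreover have "y * (pi / 2 - y) * cos a = (pi / 2 - y) * sin y" using a(3) by simp
  ultimately have "y \<le> pi / 2 * sin y" by (simp add: algebra_simps)
  then show ?thesis by (simp add: field_simps)
next
  case True
  then show ?thesis by (elim disjE) (simp, simp only: sin_pi_half, simp)
qed

lemma one_minus_cos_ge:
  fixes x :: real
  assumes "\<bar>x\<bar> \<le> pi"
  shows "2 * x ^ 2 / pi ^ 2 \<le> 1 - cos x"
proof -
  have "2 / pi * (\<bar>x\<bar> / 2) \<le> sin (\<bar>x\<bar> / 2)" using assms by (intro jordan_sin_ge) auto
  then have "(2 / pi * (\<bar>x\<bar> / 2)) ^ 2 \<le> sin (\<bar>x\<bar> / 2) ^ 2" by (intro power_mono) auto
  moreover have "cos \<bar>x\<bar> = 1 - 2 * sin (\<bar>x\<bar> / 2) ^ 2" using cos_double_sin[of "\<bar>x\<bar> / 2"] by simp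
  ultimately show ?thesis by (simp add: power_divide)
qed

lemma dirichlet_kernel:
  "2 * sin (t / 2) * (\<Sum>k=1..M. cos (real k * t)) = sin ((real M + 1 / 2) * t) - sin (t / 2)"
proof (induction M)
  case (Suc M)
  have "2 * sin (t / 2) * cos (real (Suc M) * t) = sin ((real (Suc M) + 1 / 2) * t) - sin ((real M + 1 / 2) * t)"
  proof -
    have "2 * sin (t / 2) * cos (real (Suc M) * t) = sin (t / 2 + real (Suc M) * t) + sin (t / 2 - real (Suc M) * t)"
      by (simp add: sin_add sin_diff)
    also have "t / 2 + real (Suc M) * t = (real (Suc M) + 1 / 2) * t" by (simp add: algebra_simps)
    also have "t / 2 - real (Suc M) * t = - ((real M + 1 / 2) * t)" by (simp add: algebra_simps)
    finally show ?thesis by simp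
  qed
  moreover have S: "(\<Sum>k=1..Suc M. cos (real k * t)) = (\<Sum>k=1..M. cos (real k * t)) + cos (real (Suc M) * t)"
    by (simp del: of_nat_Suc)
  ultimately show ?case using Suc unfolding S distrib_left by linarith
qed simp

lemma cos_defect_ge_near:
  assumes "M > 0" "\<bar>t\<bar> \<le> pi / real M"
  shows "2 * t ^ 2 / (3 * pi ^ 2) * real M ^ 3 \<le> (\<Sum>k=1..M. 1 - cos (real k * t))"
proof -
  have sq: "real M ^ 3 / 3 \<le> (\<Sum>k=1..M. real k ^ 2)" for M
    by (induction M) (auto simp: power2_eq_square power3_eq_cube algebra_simps)
  have "2 * t ^ 2 / (3 * pi ^ 2) * real M ^ 3 = 2 * t ^ 2 / pi ^ 2 * (real M ^ 3 / 3)" by simp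
  also have "\<dots> \<le> 2 * t ^ 2 / pi ^ 2 * (\<Sum>k=1..M. real k ^ 2)"
    by (intro mult_left_mono sq) auto
  also have "\<dots> = (\<Sum>k=1..M. 2 * (real k * t) ^ 2 / pi ^ 2)"
    by (simp add: sum_distrib_left power_mult_distrib mult_ac sum_divide_distrib)
  also have "\<dots> \<le> (\<Sum>k=1..M. 1 - cos (real k * t))"
  proof (intro sum_mono one_minus_cos_ge)
    fix k assume "k \<in> {1..M}"
    then have "\<bar>real k * t\<bar> \<le> real M * (pi / real M)"
      unfolding abs_mult using assms by (intro mult_mono) auto
    then show "\<bar>real k * t\<bar> \<le> pi" using assms by simp
  qed
  finally show ?thesis .
qed

lemma cos_defect_ge_far:
  assumes "M > 0" "pi / real M \<le> \<bar>t\<bar>" "\<bar>t\<bar> \<le> pi"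
  shows "real M / 2 \<le> (\<Sum>k=1..M. 1 - cos (real k * t))"
proof -
  let ?s = "sin (\<bar>t\<bar> / 2)"
  have "pi / real M > 0" using assms by simp
  then have tpos: "\<bar>t\<bar> > 0" using assms by linarith
  have s: "\<bar>t\<bar> / pi \<le> ?s" using jordan_sin_ge[of "\<bar>t\<bar> / 2"] assms by simp
  then have spos: "?s > 0" using tpos by (auto intro: less_le_trans[of _ "\<bar>t\<bar> / pi"])
  have "1 \<le> real M * ?s"
  proof -
    have "1 \<le> real M * (\<bar>t\<bar> / pi)" using assms by (simp add: field_simps)
    also have "\<dots> \<le> real M * ?s" by (intro mult_left_mono s) auto
    finally show ?thesis .
  qed
  have "2 * ?s * (\<Sum>k=1..M. cos (real k * \<bar>t\<bar>)) \<le> 1 - ?s"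
    unfolding dirichlet_kernel using sin_le_one[of "(real M + 1 / 2) * \<bar>t\<bar>"] by linarith
  also have "\<dots> \<le> 2 * ?s * (real M / 2)" using \<open>1 \<le> real M * ?s\<close> spos by (simp add: mult.commute)
  finally have "(\<Sum>k=1..M. cos (real k * \<bar>t\<bar>)) \<le> real M / 2"
    using spos by (simp del: times_divide_eq_right)
  moreover have "cos (real k * \<bar>t\<bar>) = cos (real k * t)" for k
    by (cases "t \<ge> 0") auto
  ultimately show ?thesis by (simp add: sum_subtractf)
qed

lemma norm_prod_part_char_le:
  assumes "M \<le> n" "0 \<le> z" "real M * z \<le> 1" "finite W" "card W \<le> h"
  shows "norm (\<Prod>k\<in>{1..n} - W. part_char z k t) \<le>
    exp (real h / 8) * exp (- (\<Sum>k=1..M. 1 - cos (real k * t)) / 16)"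
proof -
  let ?f = "\<lambda>k. 1 - cos (real k * t)"
  have f: "0 \<le> ?f k" "?f k \<le> 2" for k
    using cos_le_one[of "real k * t"] cos_ge_minus_one[of "real k * t"] by linarith+
  have "norm (\<Prod>k\<in>{1..n} - W. part_char z k t) = (\<Prod>k\<in>{1..n} - W. norm (part_char z k t))"
    by (simp add: prod_norm)
  also have "\<dots> \<le> (\<Prod>k\<in>{1..n} - W. if k \<in> {1..M} - W then exp (- ?f k / 16) else 1)"
  proof (intro prod_mono conjI)
    fix k assume k: "k \<in> {1..n} - W"
    show "norm (part_char z k t) \<le> (if k \<in> {1..M} - W then exp (- ?f k / 16) else 1)"
    proof (cases "k \<le> M")
      case True
      have "real k * z \<le> real M * z" using True assms by (intro mult_right_mono) auto
      then have "1 / 16 \<le> logistic (real k * z) * (1 - logistic (real k * z))"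
        using assms by (intro logistic_variance_ge) auto
      then have "1 / 16 * ?f k \<le> logistic (real k * z) * (1 - logistic (real k * z)) * ?f k"
        using f by (intro mult_right_mono)
      then have "exp (- (logistic (real k * z) * (1 - logistic (real k * z)) * ?f k)) \<le> exp (- ?f k / 16)"
        unfolding exp_le_cancel_iff by linarith
      with norm_part_char_le[of z k t] have "norm (part_char z k t) \<le> exp (- ?f k / 16)" by linarith
      moreover have "k \<in> {1..M} - W" using True k by auto
      ultimately show ?thesis by (simp only: if_True)
    next
      case False
      then show ?thesis using norm_part_char_le_1[of z k t] by simp
    qed
  qed simp
  also have "\<dots> = (\<Prod>k\<in>{1..M} - W. exp (- ?f k / 16))"
    using assms by (subst prod.inter_restrict[symmetric]) (auto intro!: prod.cong)
  also have "\<dots> = exp (- (\<Sum>k\<in>{1..M} - W. ?f k) / 16)"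
    by (simp only: exp_sum[symmetric] sum_divide_distrib[symmetric] sum_negf finite_Diff finite_atLeastAtMost)
  also have "\<dots> \<le> exp (real h / 8 - (\<Sum>k=1..M. ?f k) / 16)"
  proof -
    have "(\<Sum>k=1..M. ?f k) = (\<Sum>k\<in>{1..M} - W. ?f k) + (\<Sum>k\<in>{1..M} \<inter> W. ?f k)"
      using sum.Int_Diff[of "{1..M}" ?f W] by simp
    also have "(\<Sum>k\<in>{1..M} \<inter> W. ?f k) \<le> (\<Sum>k\<in>W. ?f k)"
      using assms f by (intro sum_mono2) auto
    also have "\<dots> \<le> real (card W) * 2" by (rule sum_bounded_above) (use f in auto)
    also have "\<dots> \<le> real h * 2" using assms by simp
    finally show ?thesis by simp
  qed
  also have "\<dots> = exp (real h / 8) * exp (- (\<Sum>k=1..M. ?f k) / 16)"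
    by (simp flip: exp_add)
  finally show ?thesis .
qed

lemma saddle_const_le_1: "saddle_const \<le> 1"
proof -
  have "pi \<le> 2 * sqrt 3"
  proof (rule power2_le_imp_le)
    have "pi \<le> 3.2" using pi_approx by simp
    then have "pi ^ 2 \<le> 3.2 ^ 2" by (intro power_mono) auto
    then show "pi ^ 2 \<le> (2 * sqrt 3) ^ 2" by (simp add: power_mult_distrib power2_eq_square)
  qed simp
  then show ?thesis by (simp add: saddle_const_def)
qed

text \<open>The first summand comes from the central range, where the exponent is quadratic in u; the second from the outer
  range, where it is of order sqrt n while 1 + u^2 is at most of order n^(3/2).\<close>

definition tail_const :: real where
  "tail_const = 192 * pi ^ 2 + (1 + pi ^ 2) * (6 * 64 ^ 3)"

lemma norm_prod_part_char_scaled_le: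
  assumes "n > 0" "finite W" "card W \<le> h" "\<bar>u\<bar> \<le> pi * real n powr (3/4)"
  shows "norm (\<Prod>k\<in>{1..n} - W. part_char (saddle n) k (u / real n powr (3/4))) \<le>
    exp (real h / 8) * tail_const * inverse (1 + u ^ 2)"
proof -
  define r where "r = sqrt (real n)"
  define a where "a = real n powr (3/4)"
  define M where "M = nat \<lfloor>r\<rfloor>"
  have r1: "r \<ge> 1" using assms by (simp add: r_def)
  have a: "a > 0" using assms by (simp add: a_def)
  have a2: "a ^ 2 = r ^ 3"
    using assms by (simp add: a_def r_def powr_half_sqrt[symmetric] powr_powr flip: powr_realpow)
  have M: "real M \<le> r" "r < real M + 1" "M > 0" unfolding M_def using r1 by linarith+
  have M2: "r / 2 \<le> real M" using M by linarith
  have Mn: "M \<le> n"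
  proof -
    have "r * 1 \<le> r * r" using r1 by (intro mult_left_mono) auto
    then have "r \<le> real n" by (simp add: r_def)
    with M show ?thesis by linarith
  qed
  have Mz: "real M * saddle n \<le> 1"
  proof -
    have "real M * saddle n \<le> r * saddle n"
      using saddle_pos[OF assms(1)] M by (intro mult_right_mono) auto
    also have "\<dots> = saddle_const" using assms by (simp add: saddle_def r_def)
    finally show ?thesis using saddle_const_le_1 by linarith
  qed
  let ?S = "\<Sum>k=1..M. 1 - cos (real k * (u / a))"
  have "exp (- ?S / 16) * (1 + u ^ 2) \<le> tail_const"
  proof (cases "\<bar>u / a\<bar> \<le> pi / real M")
    case True
    define y where "y = u ^ 2 / (192 * pi ^ 2)"
    have "real M ^ 3 / a ^ 2 \<ge> 1 / 8"
    proof -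
      have "(r / 2) ^ 3 \<le> real M ^ 3" using M2 r1 by (intro power_mono) auto
      then show ?thesis using a unfolding a2[symmetric] power_divide by (simp add: field_simps)
    qed
    then have "2 * u ^ 2 / (3 * pi ^ 2) * (1 / 8) \<le> 2 * u ^ 2 / (3 * pi ^ 2) * (real M ^ 3 / a ^ 2)"
      by (intro mult_left_mono) auto
    also have "\<dots> = 2 * (u / a) ^ 2 / (3 * pi ^ 2) * real M ^ 3" by (simp add: power_divide)
    also have "\<dots> \<le> ?S" by (rule cos_defect_ge_near[OF M(3) True])
    finally have "y \<le> ?S / 16" by (simp add: y_def)
    then have "exp (- ?S / 16) \<le> exp (- y)" by simp
    also have "\<dots> \<le> inverse (1 + y)"
      unfolding exp_minus using exp_ge_add_one_self[of y]
      by (intro le_imp_inverse_le) (auto simp: y_def intro: add_pos_nonneg)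
    finally have "exp (- ?S / 16) * (1 + u ^ 2) \<le> inverse (1 + y) * (192 * pi ^ 2 * (1 + y))"
    proof (rule mult_mono)
      have "1 \<le> pi ^ 2" using pi_ge_two by (intro one_le_power) auto
      then show "1 + u ^ 2 \<le> 192 * pi ^ 2 * (1 + y)"
        by (simp add: y_def distrib_left)
    qed (auto simp: y_def)
    also have "\<dots> = 192 * pi ^ 2"
    proof -
      have "1 + y > 0" by (simp add: y_def add_pos_nonneg)
      then show ?thesis by simp
    qed
    also have "\<dots> \<le> tail_const" by (simp add: tail_const_def)
    finally show ?thesis .
  next
    case False
    have "\<bar>u / a\<bar> \<le> pi" using assms(4) a unfolding a_def[symmetric] by (simp add: abs_divide pos_divide_le_eq)
    then have "real M / 2 \<le> ?S" using False by (intro cos_defect_ge_far M) auto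
    then have "r / 64 \<le> ?S / 16" using M2 by linarith
    then have "exp (- ?S / 16) \<le> exp (- (r / 64))" by simp
    moreover have "1 + u ^ 2 \<le> (1 + pi ^ 2) * r ^ 3"
    proof -
      have "u ^ 2 \<le> (pi * a) ^ 2"
        using assms(4) unfolding a_def[symmetric] by (metis abs_ge_zero power2_abs power_mono)
      also have "\<dots> = pi ^ 2 * r ^ 3" by (simp add: power_mult_distrib a2)
      finally show ?thesis using one_le_power[OF r1, of 3] by (simp add: distrib_right)
    qed
    ultimately have "exp (- ?S / 16) * (1 + u ^ 2) \<le> exp (- (r / 64)) * ((1 + pi ^ 2) * r ^ 3)"
      by (intro mult_mono) auto
    also have "\<dots> \<le> (1 + pi ^ 2) * (6 * 64 ^ 3)"
    proof -
      have "(r / 64) ^ 3 / fact 3 \<le> exp (r / 64)"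
      proof -
        have "(\<Sum>n\<in>{3}. (r / 64) ^ n /\<^sub>R fact n) \<le> (\<Sum>n. (r / 64) ^ n /\<^sub>R fact n)"
          by (rule sum_le_suminf[OF summable_exp_generic]) (use r1 in auto)
        then have "(r / 64) ^ 3 /\<^sub>R fact 3 \<le> exp (r / 64)" unfolding exp_def by simp
        then show ?thesis by (simp only: real_scaleR_def divide_inverse mult.commute)
      qed
      then have "r ^ 3 \<le> 6 * 64 ^ 3 * exp (r / 64)" by (simp add: power_divide fact_numeral field_simps)
      then have "exp (- (r / 64)) * r ^ 3 \<le> exp (- (r / 64)) * (6 * 64 ^ 3 * exp (r / 64))"
        by (intro mult_left_mono) auto
      also have "\<dots> = 6 * 64 ^ 3" by (simp add: exp_minus)
      finally have "(1 + pi ^ 2) * (exp (- (r / 64)) * r ^ 3) \<le> (1 + pi ^ 2) * (6 * 64 ^ 3)"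
        by (intro mult_left_mono) auto
      then show ?thesis by (simp add: mult_ac)
    qed
    also have "\<dots> \<le> tail_const" by (simp add: tail_const_def)
    finally show ?thesis .
  qed
  then have "exp (- ?S / 16) \<le> tail_const * inverse (1 + u ^ 2)"
    by (simp add: divide_inverse[symmetric] pos_le_divide_eq add_pos_nonneg)
  then have "exp (real h / 8) * exp (- ?S / 16) \<le> exp (real h / 8) * (tail_const * inverse (1 + u ^ 2))"
    by (intro mult_left_mono) auto
  moreover have "norm (\<Prod>k\<in>{1..n} - W. part_char (saddle n) k (u / a)) \<le> exp (real h / 8) * exp (- ?S / 16)"
    by (rule norm_prod_part_char_le[OF Mn less_imp_le[OF saddle_pos[OF assms(1)]] Mz assms(2,3)])
  ultimately show ?thesis unfolding a_def[symmetric] mult.assoc by linarith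
qed

subsection \<open>The Gaussian limit\<close>

lemma norm_cis_minus_1_le: "norm (cis x - 1) \<le> \<bar>x\<bar>"
  using iexp_approx1[of x 0] by (simp add: cis_conv_exp)

lemma norm_cis_taylor_le: "norm (cis x - (1 + \<i> * x - of_real (x ^ 2 / 2))) \<le> \<bar>x\<bar> ^ 3 / 6"
proof -
  have "(\<Sum>k\<le>2. (\<i> * complex_of_real x) ^ k / fact k) = 1 + \<i> * x - of_real (x ^ 2 / 2)"
  proof -
    have "{..2::nat} = {0, 1, 2}" by auto
    then show ?thesis by (simp add: power_mult_distrib)
  qed
  then show ?thesis
    using iexp_approx1[of x 2] by (simp add: cis_conv_exp fact_numeral)
qed

lemma abs_exp_minus_taylor_le:
  fixes y :: real
  assumes "y \<ge> 0"
  shows "\<bar>exp (- y) - (1 - y)\<bar> \<le> y ^ 2"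
proof -
  have "exp (- y) \<le> inverse (1 + y)"
    unfolding exp_minus using exp_ge_add_one_self[of y] assms by (intro le_imp_inverse_le) auto
  also have "\<dots> \<le> 1 - y + y ^ 2"
  proof -
    have "(1 - y + y ^ 2) * (1 + y) = 1 + y ^ 3"
      by (simp add: power2_eq_square power3_eq_cube algebra_simps)
    then have "1 \<le> (1 - y + y ^ 2) * (1 + y)" using assms by simp
    then show ?thesis using assms by (simp add: inverse_eq_divide pos_divide_le_eq)
  qed
  finally show ?thesis using exp_ge_add_one_self[of "- y"] by linarith
qed

lemma centered_mixture_bound:
  assumes p: "0 < p" "p < 1"
  shows "norm ((of_real (1 - p) + of_real p * cis x) * cis (- (p * x)) - of_real (exp (- (p * (1 - p) * x ^ 2 / 2))))
    \<le> p * \<bar>x\<bar> ^ 3 + p * x ^ 4"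
proof -
  let ?T = "\<lambda>y::real. 1 + \<i> * y - of_real (y ^ 2 / 2)"
  let ?y = "p * (1 - p) * x ^ 2 / 2"
  let ?a = "- (p * x)" and ?b = "(1 - p) * x"
  have p': "1 - p > 0" using p by simp
  have split: "(of_real (1 - p) + of_real p * cis x) * cis ?a = of_real (1 - p) * cis ?a + of_real p * cis ?b"
    by (simp add: distrib_right mult.assoc cis_mult) (simp add: algebra_simps)
  have T: "of_real (1 - p) * ?T ?a + of_real p * ?T ?b = of_real (1 - ?y)"
    by (simp add: complex_eq_iff power2_eq_square) (simp add: field_simps)
  have sum: "(of_real (1 - p) + of_real p * cis x) * cis ?a - of_real (exp (- ?y)) =
      of_real (1 - p) * (cis ?a - ?T ?a) + of_real p * (cis ?b - ?T ?b) + (of_real (1 - ?y) - of_real (exp (- ?y)))"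
    unfolding split T[symmetric] by (simp add: algebra_simps)
  have 1: "norm (of_real (1 - p) * (cis ?a - ?T ?a)) \<le> p * \<bar>x\<bar> ^ 3 / 6"
  proof -
    have a: "\<bar>?a\<bar> ^ 3 = p ^ 3 * \<bar>x\<bar> ^ 3"
      unfolding abs_minus_cancel abs_mult abs_of_pos[OF p(1)] by (rule power_mult_distrib)
    have "p ^ 3 \<le> p ^ 1" using p by (intro power_decreasing) auto
    then have "p ^ 3 * \<bar>x\<bar> ^ 3 \<le> p * \<bar>x\<bar> ^ 3" by (intro mult_right_mono) auto
    then have "norm (cis ?a - ?T ?a) \<le> p * \<bar>x\<bar> ^ 3 / 6"
      using norm_cis_taylor_le[of ?a] unfolding a by linarith
    moreover have "(1 - p) * norm (cis ?a - ?T ?a) \<le> 1 * norm (cis ?a - ?T ?a)"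
      by (rule mult_right_mono) (use p in simp, rule norm_ge_zero)
    ultimately show ?thesis
      unfolding norm_mult norm_of_real abs_of_pos[OF p'] by linarith
  qed
  have 2: "norm (of_real p * (cis ?b - ?T ?b)) \<le> p * \<bar>x\<bar> ^ 3 / 6"
  proof -
    have b: "\<bar>?b\<bar> ^ 3 = (1 - p) ^ 3 * \<bar>x\<bar> ^ 3"
      unfolding abs_mult abs_of_pos[OF p'] by (rule power_mult_distrib)
    have "(1 - p) ^ 3 \<le> 1" using p by (intro power_le_one) auto
    then have "(1 - p) ^ 3 * \<bar>x\<bar> ^ 3 \<le> 1 * \<bar>x\<bar> ^ 3" by (intro mult_right_mono) auto
    then have "norm (cis ?b - ?T ?b) \<le> \<bar>x\<bar> ^ 3 / 6"
      using norm_cis_taylor_le[of ?b] unfolding b by linarith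
    then have "p * norm (cis ?b - ?T ?b) \<le> p * (\<bar>x\<bar> ^ 3 / 6)"
      by (rule mult_left_mono) (rule less_imp_le[OF p(1)])
    then show ?thesis
      unfolding norm_mult norm_of_real abs_of_pos[OF p(1)] by linarith
  qed
  have 3: "norm (of_real (1 - ?y) - of_real (exp (- ?y)) :: complex) \<le> p * x ^ 4"
  proof -
    have "norm (of_real (1 - ?y) - of_real (exp (- ?y)) :: complex) = \<bar>exp (- ?y) - (1 - ?y)\<bar>"
      unfolding of_real_diff[symmetric] norm_of_real by (rule abs_minus_commute)
    also have "\<dots> \<le> ?y ^ 2" using p by (intro abs_exp_minus_taylor_le) auto
    also have "?y ^ 2 = (p * (p * (1 - p) ^ 2)) * (x ^ 4 / 4)"
      by (simp add: power2_eq_square numeral_eq_Suc)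
    also have "\<dots> \<le> (p * 1) * (x ^ 4 / 1)"
    proof (intro mult_mono mult_left_mono)
      have "p * (1 - p) ^ 2 \<le> 1 * 1" using p by (intro mult_mono power_le_one) auto
      then show "p * (1 - p) ^ 2 \<le> 1" by simp
      have "0 \<le> x ^ 4" by (simp add: zero_le_even_power)
      then show "x ^ 4 / 4 \<le> x ^ 4 / 1" "0 \<le> x ^ 4 / 4" by simp_all
    qed (use p in auto)
    finally show ?thesis by simp
  qed
  have "0 \<le> p * \<bar>x\<bar> ^ 3" using p by simp
  moreover have "norm (of_real (1 - p) * (cis ?a - ?T ?a) + of_real p * (cis ?b - ?T ?b) + (of_real (1 - ?y) - of_real (exp (- ?y))))
     \<le> norm (of_real (1 - p) * (cis ?a - ?T ?a)) + norm (of_real p * (cis ?b - ?T ?b)) +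
      norm (of_real (1 - ?y) - of_real (exp (- ?y)) :: complex)"
    by (rule order_trans[OF norm_triangle_ineq add_right_mono[OF norm_triangle_ineq]])
  ultimately show ?thesis
    unfolding sum using 1 2 3 by linarith
qed

definition scaled_char :: "nat \<Rightarrow> nat set \<Rightarrow> nat \<Rightarrow> real \<Rightarrow> complex" where
  "scaled_char n W j u = (\<Prod>k\<in>{1..n} - W. part_char (saddle n) k (u / real n powr (3/4))) *
     cis ((real j - real n) * (u / real n powr (3/4)))"

lemma part_char_saddle:
  "part_char (saddle n) k t = of_real (1 - part_prob n k) + of_real (part_prob n k) * cis (real k * t)"
  unfolding part_char_eq part_prob_def ..

lemma part_prob_pos: "0 < part_prob n k" and part_prob_less_1: "part_prob n k < 1"
  by (simp_all add: part_prob_def logistic_pos logistic_less_1)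

lemma part_variance_nonneg: "0 \<le> part_variance n k"
  using part_prob_pos[of n k] part_prob_less_1[of n k] by (simp add: part_variance_def)

lemma centered_char_tendsto:
  "(\<lambda>n. \<Prod>k=1..n. part_char (saddle n) k (u / real n powr (3/4)) * cis (- (real k * part_prob n k * (u / real n powr (3/4)))))
    \<longlonglongrightarrow> of_real (exp (- (limit_variance * u ^ 2 / 2)))"
proof -
  define \<theta> where "\<theta> n = u / real n powr (3/4)" for n
  define A where "A n = (\<Prod>k=1..n. part_char (saddle n) k (\<theta> n) * cis (- (real k * part_prob n k * \<theta> n)))" for n
  define G where "G n = (\<Prod>k=1..n. complex_of_real (exp (- (part_variance n k * \<theta> n ^ 2 / 2))))" for n
  have G_lim: "G \<longlonglongrightarrow> of_real (exp (- (limit_variance * u ^ 2 / 2)))"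
  proof -
    have "(\<lambda>n. complex_of_real (exp (- ((\<Sum>k=1..n. part_variance n k) / real n powr (3/2) * u ^ 2 / 2))))
       \<longlonglongrightarrow> of_real (exp (- (limit_variance * u ^ 2 / 2)))"
      by (intro tendsto_intros variance_asymp) auto
    moreover have "\<forall>\<^sub>F n in sequentially. complex_of_real (exp (- ((\<Sum>k=1..n. part_variance n k) / real n powr (3/2) * u ^ 2 / 2))) = G n"
    proof (rule eventually_mono[OF eventually_gt_at_top[of 0]])
      fix n :: nat assume n: "n > 0"
      have t: "\<theta> n ^ 2 = u ^ 2 / real n powr (3/2)"
        using n by (simp add: \<theta>_def power_divide power2_eq_square flip: powr_add)
      have "G n = of_real (\<Prod>k=1..n. exp (- (part_variance n k * \<theta> n ^ 2 / 2)))"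
        by (simp add: G_def)
      also have "(\<Prod>k=1..n. exp (- (part_variance n k * \<theta> n ^ 2 / 2))) = exp (\<Sum>k=1..n. - (part_variance n k * \<theta> n ^ 2 / 2))"
        by (rule exp_sum[symmetric]) simp
      also have "(\<Sum>k=1..n. - (part_variance n k * \<theta> n ^ 2 / 2)) = - ((\<Sum>k=1..n. part_variance n k) * \<theta> n ^ 2 / 2)"
        by (simp only: sum_negf sum_distrib_right sum_divide_distrib)
      finally show "complex_of_real (exp (- ((\<Sum>k=1..n. part_variance n k) / real n powr (3/2) * u ^ 2 / 2))) = G n"
        unfolding t by simp
    qed
    ultimately show ?thesis by (simp only: tendsto_cong)
  qed
  have lim: "(\<lambda>n. \<bar>u\<bar> ^ 3 * ((\<Sum>k=1..n. real k ^ 3 * part_prob n k) / real n powr (9/4)) +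
       u ^ 4 * ((\<Sum>k=1..n. real k ^ 4 * part_prob n k) / real n powr 3)) \<longlonglongrightarrow> 0"
    by (rule tendsto_eq_intros moment_asymp refl | simp)+
  have "(\<lambda>n. A n - G n) \<longlonglongrightarrow> 0"
  proof (rule Lim_null_comparison[OF _ lim], rule eventually_mono[OF eventually_gt_at_top[of 0]])
    fix n :: nat assume n: "n > 0"
    have t3: "\<bar>\<theta> n\<bar> ^ 3 = \<bar>u\<bar> ^ 3 / real n powr (9/4)" and t4: "\<theta> n ^ 4 = u ^ 4 / real n powr 3"
      using n by (simp_all add: \<theta>_def power_divide powr_powr flip: powr_realpow powr_numeral)
    have "norm (A n - G n) \<le> (\<Sum>k=1..n. norm (part_char (saddle n) k (\<theta> n) * cis (- (real k * part_prob n k * \<theta> n)) -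
         complex_of_real (exp (- (part_variance n k * \<theta> n ^ 2 / 2)))))"
      unfolding A_def G_def
    proof (rule norm_prod_diff)
      fix k
      show "norm (part_char (saddle n) k (\<theta> n) * cis (- (real k * part_prob n k * \<theta> n))) \<le> 1"
        by (simp add: norm_mult norm_part_char_le_1)
      show "norm (complex_of_real (exp (- (part_variance n k * \<theta> n ^ 2 / 2)))) \<le> 1"
        using part_variance_nonneg[of n k] by (simp del: of_real_exp)
    qed
    also have "\<dots> \<le> (\<Sum>k=1..n. part_prob n k * \<bar>real k * \<theta> n\<bar> ^ 3 + part_prob n k * (real k * \<theta> n) ^ 4)"
    proof (intro sum_mono)
      fix k
      show "norm (part_char (saddle n) k (\<theta> n) * cis (- (real k * part_prob n k * \<theta> n)) -
         complex_of_real (exp (- (part_variance n k * \<theta> n ^ 2 / 2)))) \<le>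
         part_prob n k * \<bar>real k * \<theta> n\<bar> ^ 3 + part_prob n k * (real k * \<theta> n) ^ 4"
        using centered_mixture_bound[OF part_prob_pos part_prob_less_1, of n k "real k * \<theta> n"]
        unfolding part_char_saddle part_variance_def
        by (simp only: power_mult_distrib mult_ac)
    qed
    also have "\<dots> = \<bar>\<theta> n\<bar> ^ 3 * (\<Sum>k=1..n. real k ^ 3 * part_prob n k) + \<theta> n ^ 4 * (\<Sum>k=1..n. real k ^ 4 * part_prob n k)"
      by (simp add: sum.distrib sum_distrib_left power_mult_distrib abs_mult mult_ac)
    finally show "norm (A n - G n) \<le> \<bar>u\<bar> ^ 3 * ((\<Sum>k=1..n. real k ^ 3 * part_prob n k) / real n powr (9/4)) +
       u ^ 4 * ((\<Sum>k=1..n. real k ^ 4 * part_prob n k) / real n powr 3)"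
      unfolding t3 t4 by simp
  qed
  from tendsto_add[OF this G_lim] have "A \<longlonglongrightarrow> of_real (exp (- (limit_variance * u ^ 2 / 2)))" by simp
  then show ?thesis unfolding A_def \<theta>_def .
qed

lemma scaled_char_tendsto:
  assumes W: "\<And>n. finite (W n)" "\<And>n. card (W n) \<le> h" "\<And>n. W n \<subseteq> {1..n}"
    "\<And>n k. k \<in> W n \<Longrightarrow> real k \<le> C * sqrt (real n)"
    and j: "\<And>n. real (j n) \<le> Y * sqrt (real n)"
  shows "(\<lambda>n. scaled_char n (W n) (j n) u) \<longlonglongrightarrow> of_real (exp (- (limit_variance * u ^ 2 / 2)))"
proof -
  define \<theta> where "\<theta> n = u / real n powr (3/4)" for n
  define A where "A n = (\<Prod>k=1..n. part_char (saddle n) k (\<theta> n) * cis (- (real k * part_prob n k * \<theta> n)))" for n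
  define P where "P n = (\<Prod>k=1..n. part_char (saddle n) k (\<theta> n))" for n
  define B where "B n = (\<Prod>k\<in>{1..n} - W n. part_char (saddle n) k (\<theta> n))" for n
  define mean where "mean n = (\<Sum>k=1..n. real k * part_prob n k)" for n
  have A_lim: "A \<longlonglongrightarrow> of_real (exp (- (limit_variance * u ^ 2 / 2)))"
    using centered_char_tendsto[of u] unfolding A_def \<theta>_def .
  have sqrt_lim: "(\<lambda>n. K * sqrt (real n) * \<theta> n) \<longlonglongrightarrow> 0" for K
  proof -
    have "(\<lambda>n. K * sqrt (real n) * (u / real n powr (3/4))) \<longlonglongrightarrow> 0" by real_asymp
    then show ?thesis unfolding \<theta>_def .
  qed
  have cis_prod: "(\<Prod>k\<in>S. cis (f k)) = cis (\<Sum>k\<in>S. f k)" if "finite S" for S and f :: "nat \<Rightarrow> real"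
    using that by induction (auto simp: cis_mult)
  have AP: "P n = A n * cis (mean n * \<theta> n)" for n
  proof -
    have "A n = P n * (\<Prod>k=1..n. cis (- (real k * part_prob n k * \<theta> n)))"
      unfolding A_def P_def by (rule prod.distrib)
    also have "(\<Prod>k=1..n. cis (- (real k * part_prob n k * \<theta> n))) = cis (- (mean n * \<theta> n))"
      by (subst cis_prod) (auto simp: mean_def sum_negf sum_distrib_right)
    finally show ?thesis by (simp add: mult.assoc cis_mult)
  qed
  have BP: "(\<lambda>n. B n - P n) \<longlonglongrightarrow> 0"
  proof (rule Lim_null_comparison)
    show "(\<lambda>n. \<bar>real h * C * sqrt (real n) * \<theta> n\<bar>) \<longlonglongrightarrow> 0"
      using tendsto_rabs[OF sqrt_lim[of "real h * C"]] by simp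
    show "\<forall>\<^sub>F n in sequentially. norm (B n - P n) \<le> \<bar>real h * C * sqrt (real n) * \<theta> n\<bar>"
    proof (rule always_eventually, rule allI)
      fix n
      let ?\<phi> = "\<lambda>k. part_char (saddle n) k (\<theta> n)"
      have B: "B n = (\<Prod>k=1..n. if k \<in> W n then 1 else ?\<phi> k)"
        unfolding B_def by (rule prod.mono_neutral_cong_left) auto
      have "norm (B n - P n) \<le> (\<Sum>k=1..n. norm ((if k \<in> W n then 1 else ?\<phi> k) - ?\<phi> k))"
        unfolding P_def B by (rule norm_prod_diff) (auto simp: norm_part_char_le_1)
      also have "\<dots> = (\<Sum>k\<in>W n. norm (1 - ?\<phi> k))"
        using W(3)[of n] by (intro sum.mono_neutral_cong_right) auto
      also have "\<dots> \<le> (\<Sum>k\<in>W n. \<bar>C * sqrt (real n) * \<theta> n\<bar>)"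
      proof (intro sum_mono)
        fix k assume k: "k \<in> W n"
        have "1 - ?\<phi> k = - of_real (part_prob n k) * (cis (real k * \<theta> n) - 1)"
          unfolding part_char_saddle by (simp add: algebra_simps)
        then have "norm (1 - ?\<phi> k) = part_prob n k * norm (cis (real k * \<theta> n) - 1)"
          using part_prob_pos[of n k] by (simp only: norm_mult norm_minus_cancel norm_of_real abs_of_pos)
        also have "\<dots> \<le> 1 * \<bar>real k * \<theta> n\<bar>"
          using part_prob_less_1[of n k] part_prob_pos[of n k]
          by (intro mult_mono norm_cis_minus_1_le) auto
        also have "\<dots> = real k * \<bar>\<theta> n\<bar>" by (simp add: abs_mult)
        also have "\<dots> \<le> \<bar>C * sqrt (real n)\<bar> * \<bar>\<theta> n\<bar>"
          using W(4)[OF k] by (intro mult_right_mono) auto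
        finally show "norm (1 - ?\<phi> k) \<le> \<bar>C * sqrt (real n) * \<theta> n\<bar>" by (simp add: abs_mult)
      qed
      also have "\<dots> = real (card (W n)) * \<bar>C * sqrt (real n) * \<theta> n\<bar>" by simp
      also have "\<dots> \<le> real h * \<bar>C * sqrt (real n) * \<theta> n\<bar>"
        using W(2)[of n] by (intro mult_right_mono) auto
      also have "\<dots> = \<bar>real h * C * sqrt (real n) * \<theta> n\<bar>" by (simp add: abs_mult)
      finally show "norm (B n - P n) \<le> \<bar>real h * C * sqrt (real n) * \<theta> n\<bar>" .
    qed
  qed
  have "(\<lambda>n. real (j n) * \<theta> n) \<longlonglongrightarrow> 0"
  proof (rule Lim_null_comparison)
    show "(\<lambda>n. \<bar>Y * sqrt (real n) * \<theta> n\<bar>) \<longlonglongrightarrow> 0"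
      using tendsto_rabs[OF sqrt_lim[of Y]] by simp
    have "norm (real (j n) * \<theta> n) \<le> \<bar>Y * sqrt (real n) * \<theta> n\<bar>" for n
    proof -
      have "real (j n) \<le> \<bar>Y * sqrt (real n)\<bar>" using j[of n] by linarith
      then have "real (j n) * \<bar>\<theta> n\<bar> \<le> \<bar>Y * sqrt (real n)\<bar> * \<bar>\<theta> n\<bar>" by (intro mult_right_mono) auto
      then show ?thesis by (simp add: abs_mult)
    qed
    then show "\<forall>\<^sub>F n in sequentially. norm (real (j n) * \<theta> n) \<le> \<bar>Y * sqrt (real n) * \<theta> n\<bar>" by simp
  qed
  moreover have "(\<lambda>n. (mean n - real n) / real n powr (3/4) * u) \<longlonglongrightarrow> 0 * u"
    unfolding mean_def by (intro tendsto_intros mean_asymp)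
  ultimately have arg: "(\<lambda>n. (mean n - real n) / real n powr (3/4) * u + real (j n) * \<theta> n) \<longlonglongrightarrow> 0"
    using tendsto_add by fastforce
  have "(\<lambda>n. (B n - P n) * cis ((real (j n) - real n) * \<theta> n) +
      A n * cis ((mean n - real n) / real n powr (3/4) * u + real (j n) * \<theta> n))
      \<longlonglongrightarrow> 0 + of_real (exp (- (limit_variance * u ^ 2 / 2))) * cis 0"
  proof (intro tendsto_add tendsto_mult A_lim)
    show "(\<lambda>n. (B n - P n) * cis ((real (j n) - real n) * \<theta> n)) \<longlonglongrightarrow> 0"
      by (rule Lim_null_comparison[OF _ tendsto_norm_zero[OF BP]]) (simp add: norm_mult)
    show "(\<lambda>n. cis ((mean n - real n) / real n powr (3/4) * u + real (j n) * \<theta> n)) \<longlonglongrightarrow> cis 0"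
    proof (rule isCont_tendsto_compose[OF _ arg])
      have "continuous_on UNIV cis" by (intro continuous_on_cis continuous_on_id)
      then show "isCont cis 0" by (simp add: continuous_on_eq_continuous_at)
    qed
  qed
  moreover have "(B n - P n) * cis ((real (j n) - real n) * \<theta> n) +
      A n * cis ((mean n - real n) / real n powr (3/4) * u + real (j n) * \<theta> n) = scaled_char n (W n) (j n) u" for n
  proof -
    have "P n * cis ((real (j n) - real n) * \<theta> n) = A n * cis ((mean n - real n) * \<theta> n + real (j n) * \<theta> n)"
      unfolding AP mult.assoc cis_mult by (simp add: algebra_simps)
    then show ?thesis
      by (simp add: scaled_char_def B_def \<theta>_def left_diff_distrib)
  qed
  ultimately show ?thesis by simp
qed

lemma limit_variance_gaussian:
  "integrable lborel (\<lambda>u. exp (- (limit_variance * u ^ 2 / 2)))"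
  "(LBINT u. exp (- (limit_variance * u ^ 2 / 2))) = sqrt (2 * pi / limit_variance)"
proof -
  define \<sigma> where "\<sigma> = 1 / sqrt limit_variance"
  have \<sigma>: "\<sigma> > 0" "\<sigma> ^ 2 = 1 / limit_variance"
    using limit_variance_pos by (simp_all add: \<sigma>_def power_divide)
  have eq: "exp (- (limit_variance * u ^ 2 / 2)) = sqrt (2 * pi / limit_variance) * normal_density 0 \<sigma> u" for u
    using limit_variance_pos by (simp add: normal_density_def \<sigma>(2) real_sqrt_divide)
  show "integrable lborel (\<lambda>u. exp (- (limit_variance * u ^ 2 / 2)))"
    unfolding eq using integrable_normal_density[OF \<sigma>(1)] by simp
  show "(LBINT u. exp (- (limit_variance * u ^ 2 / 2))) = sqrt (2 * pi / limit_variance)"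
    unfolding eq using integral_normal_density[OF \<sigma>(1)] by simp
qed

definition truncated_char :: "nat \<Rightarrow> nat set \<Rightarrow> nat \<Rightarrow> real \<Rightarrow> complex" where
  "truncated_char n W j u = indicator {- pi * real n powr (3/4)..pi * real n powr (3/4)} u *\<^sub>R scaled_char n W j u"

lemma truncated_char_measurable [measurable]: "truncated_char n W j \<in> borel_measurable lborel"
proof -
  have "continuous_on UNIV (scaled_char n W j)"
    unfolding scaled_char_def divide_inverse by (intro continuous_intros)
  then have [measurable]: "scaled_char n W j \<in> borel_measurable borel"
    by (rule borel_measurable_continuous_onI)
  show ?thesis unfolding truncated_char_def by measurable
qed

lemma fourier_coeff_rescale:
  assumes "n > 0"
  shows "of_real (real n powr (3/4)) * fourier_coeff (saddle n) n W j = (LBINT u. truncated_char n W j u) / (2 * pi)"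
proof -
  define a where "a = real n powr (3/4)"
  have a: "a > 0" using assms by (simp add: a_def)
  have "(LBINT u. truncated_char n W j u) = \<bar>a\<bar> *\<^sub>R (LBINT t. truncated_char n W j (0 + a * t))"
    by (rule lborel_integral_real_affine) (use a in auto)
  also have "(\<lambda>t. truncated_char n W j (0 + a * t)) =
      (\<lambda>t. indicator {-pi..pi} t *\<^sub>R ((\<Prod>k\<in>{1..n} - W. part_char (saddle n) k t) * cis ((real j - real n) * t)))"
  proof
    fix t
    have "(a * t \<in> {- pi * a..pi * a}) = (t \<in> {-pi..pi})"
    proof -
      have "(- pi * a \<le> a * t) = (- pi \<le> t)"
        using a mult_le_cancel_left_pos[of a "- pi" t] by (simp only: mult.commute)
      moreover have "(a * t \<le> pi * a) = (t \<le> pi)"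
        using a mult_le_cancel_left_pos[of a t pi] by (simp only: mult.commute)
      ultimately show ?thesis by simp
    qed
    moreover have "a * t / a = t" using a by simp
    ultimately show "truncated_char n W j (0 + a * t) =
        indicator {-pi..pi} t *\<^sub>R ((\<Prod>k\<in>{1..n} - W. part_char (saddle n) k t) * cis ((real j - real n) * t))"
      unfolding truncated_char_def scaled_char_def a_def[symmetric] add_0_left indicator_def by simp
  qed
  finally show ?thesis
    using a unfolding fourier_coeff_def set_lebesgue_integral_def a_def[symmetric] by (simp add: scaleR_conv_of_real)
qed

definition char_bound :: "nat \<Rightarrow> real" where
  "char_bound h = exp (real h / 8) * tail_const"

lemma tail_const_nonneg: "tail_const \<ge> 0"
  by (simp add: tail_const_def)

lemma norm_truncated_char_le:
  assumes "n > 0" "finite W" "card W \<le> h"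
  shows "norm (truncated_char n W j u) \<le> char_bound h * inverse (1 + u ^ 2)"
proof (cases "\<bar>u\<bar> \<le> pi * real n powr (3/4)")
  case True
  then show ?thesis
    using norm_prod_part_char_scaled_le[OF assms True]
    by (auto simp: truncated_char_def scaled_char_def norm_mult char_bound_def indicator_def)
next
  case False
  then have "truncated_char n W j u = 0" by (auto simp: truncated_char_def indicator_def)
  moreover have "0 \<le> char_bound h * inverse (1 + u ^ 2)"
    using tail_const_nonneg by (simp add: char_bound_def add_nonneg_nonneg)
  ultimately show ?thesis by simp
qed

lemma integrable_char_bound: "integrable lborel (\<lambda>u::real. char_bound h * inverse (1 + u ^ 2))"
  using integrable_inverse_1_plus_square by (simp add: set_integrable_def)

lemma truncated_char_integral_tendsto:
  assumes W: "\<And>n. finite (W n)" "\<And>n. card (W n) \<le> h" "\<And>n. W n \<subseteq> {1..n}"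
    "\<And>n k. k \<in> W n \<Longrightarrow> real k \<le> C * sqrt (real n)"
    and j: "\<And>n. real (j n) \<le> Y * sqrt (real n)"
  shows "(\<lambda>n. LBINT u. truncated_char n (W n) (j n) u) \<longlonglongrightarrow> of_real (sqrt (2 * pi / limit_variance))"
proof -
  have "(\<lambda>n. LBINT u. truncated_char (Suc n) (W (Suc n)) (j (Suc n)) u)
      \<longlonglongrightarrow> (LBINT u. complex_of_real (exp (- (limit_variance * u ^ 2 / 2))))"
  proof (rule integral_dominated_convergence[OF _ _ integrable_char_bound[of h]])
    show "AE u in lborel. (\<lambda>n. truncated_char (Suc n) (W (Suc n)) (j (Suc n)) u)
       \<longlonglongrightarrow> complex_of_real (exp (- (limit_variance * u ^ 2 / 2)))"
    proof (rule AE_I2)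
      fix u :: real
      have "filterlim (\<lambda>n. pi * real n powr (3/4)) at_top sequentially" by real_asymp
      then have "\<forall>\<^sub>F n in sequentially. \<bar>u\<bar> \<le> pi * real n powr (3/4)"
        by (rule filterlim_at_top[THEN iffD1, rule_format])
      then have "\<forall>\<^sub>F n in sequentially. scaled_char n (W n) (j n) u = truncated_char n (W n) (j n) u"
        by eventually_elim (auto simp: truncated_char_def indicator_def)
      moreover have "(\<lambda>n. scaled_char n (W n) (j n) u) \<longlonglongrightarrow> complex_of_real (exp (- (limit_variance * u ^ 2 / 2)))"
        by (rule scaled_char_tendsto[where h = h and C = C and Y = Y]) (use W j in auto)
      ultimately have "(\<lambda>n. truncated_char n (W n) (j n) u) \<longlonglongrightarrow> complex_of_real (exp (- (limit_variance * u ^ 2 / 2)))"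
        by (rule Lim_transform_eventually[rotated])
      then show "(\<lambda>n. truncated_char (Suc n) (W (Suc n)) (j (Suc n)) u)
         \<longlonglongrightarrow> complex_of_real (exp (- (limit_variance * u ^ 2 / 2)))"
        by (rule LIMSEQ_Suc)
    qed
    show "AE u in lborel. norm (truncated_char (Suc n) (W (Suc n)) (j (Suc n)) u) \<le> char_bound h * inverse (1 + u ^ 2)" for n
      using W by (intro AE_I2 norm_truncated_char_le) auto
  qed measurable
  also have "(LBINT u. complex_of_real (exp (- (limit_variance * u ^ 2 / 2)))) = of_real (sqrt (2 * pi / limit_variance))"
    by (simp only: integral_complex_of_real limit_variance_gaussian(2))
  finally show ?thesis by (rule LIMSEQ_imp_Suc)
qed

definition local_weight :: "nat \<Rightarrow> nat set \<Rightarrow> nat \<Rightarrow> complex" where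
  "local_weight n W j = of_real (real n powr (3/4)) * fourier_coeff (saddle n) n W j"

definition local_limit :: real where
  "local_limit = sqrt (2 * pi / limit_variance) / (2 * pi)"

lemma local_weight_tendsto:
  assumes "\<And>n. finite (W n)" "\<And>n. card (W n) \<le> h" "\<And>n. W n \<subseteq> {1..n}"
    "\<And>n k. k \<in> W n \<Longrightarrow> real k \<le> C * sqrt (real n)"
    and "\<And>n. real (j n) \<le> Y * sqrt (real n)"
  shows "(\<lambda>n. local_weight n (W n) (j n)) \<longlonglongrightarrow> of_real local_limit"
proof -
  have "(\<lambda>n. (LBINT u. truncated_char n (W n) (j n) u) / of_real (2 * pi)) \<longlonglongrightarrow>
      of_real (sqrt (2 * pi / limit_variance)) / of_real (2 * pi)"
    by (intro tendsto_divide truncated_char_integral_tendsto[OF assms] tendsto_const) auto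
  moreover have "\<forall>\<^sub>F n in sequentially. (LBINT u. truncated_char n (W n) (j n) u) / of_real (2 * pi) = local_weight n (W n) (j n)"
    by (rule eventually_mono[OF eventually_gt_at_top[of 0]]) (simp add: local_weight_def fourier_coeff_rescale)
  ultimately have "(\<lambda>n. local_weight n (W n) (j n)) \<longlonglongrightarrow> of_real (sqrt (2 * pi / limit_variance)) / of_real (2 * pi)"
    by (rule Lim_transform_eventually)
  then show ?thesis unfolding local_limit_def of_real_divide .
qed

lemma norm_local_weight_le:
  assumes "n > 0" "finite W" "card W \<le> h"
  shows "norm (local_weight n W j) \<le> char_bound h"
proof -
  have "norm (LBINT u. truncated_char n W j u) \<le> (LBINT u. char_bound h * inverse (1 + u ^ 2))"
  proof (rule Bochner_Integration.integral_norm_bound_integral[OF _ integrable_char_bound])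
    show "integrable lborel (truncated_char n W j)"
    proof (rule Bochner_Integration.integrable_bound[OF integrable_char_bound[of h]])
      show "AE u in lborel. norm (truncated_char n W j u) \<le> norm (char_bound h * inverse (1 + u ^ 2))"
        unfolding real_norm_def
        by (intro AE_I2 order_trans[OF norm_truncated_char_le[OF assms] abs_ge_self])
    qed measurable
  qed (rule norm_truncated_char_le[OF assms])
  also have "\<dots> = char_bound h * pi"
    using LBINT_inverse_1_plus_square by (simp add: interval_lebesgue_integral_def set_lebesgue_integral_def)
  finally have "norm (local_weight n W j) \<le> char_bound h * pi / (2 * pi)"
    unfolding local_weight_def fourier_coeff_rescale[OF assms(1)] norm_divide
    by (simp add: pos_divide_le_eq)
  also have "\<dots> = char_bound h / 2" by simp
  also have "\<dots> \<le> char_bound h" using tail_const_nonneg by (simp add: char_bound_def)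
  finally show ?thesis .
qed

lemma local_limit_eq: "local_limit = 1 / (2 * sqrt 2 * 3 powr (1/4))"
proof -
  have q: "(3 powr (1/4)) ^ 2 = sqrt (3 :: real)"
    by (simp add: powr_half_sqrt[symmetric] powr_powr flip: powr_realpow)
  have "local_limit ^ 2 = (1 / (2 * sqrt 2 * 3 powr (1/4))) ^ 2"
    unfolding local_limit_def limit_variance_def power_divide power_mult_distrib q
    by (simp add: power2_eq_square field_simps)
  then show ?thesis
    by (rule power2_eq_imp_eq) (auto simp: local_limit_def limit_variance_def)
qed

subsection \<open>Integrals over the half line\<close>

lemma has_bochner_integral_FTC_atLeast:
  fixes f F :: "real \<Rightarrow> real"
  assumes f[measurable]: "f \<in> borel_measurable borel"
    and F: "\<And>x. 0 \<le> x \<Longrightarrow> (F has_real_derivative f x) (at x)"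
    and nn: "\<And>x. 0 \<le> x \<Longrightarrow> 0 \<le> f x" and lim: "(F \<longlongrightarrow> T) at_top" and "F 0 \<le> T"
  shows "has_bochner_integral lborel (\<lambda>x. indicator {0..} x * f x) (T - F 0)"
proof (rule has_bochner_integral_nn_integral)
  have "(\<integral>\<^sup>+x. ennreal (indicator {0..} x * f x) \<partial>lborel) = (\<integral>\<^sup>+x\<in>{0..}. ennreal (f x) \<partial>lborel)"
    by (intro nn_integral_cong) (auto simp: indicator_def)
  also have "\<dots> = ennreal (T - F 0)"
    by (rule nn_integral_FTC_atLeast) (use assms in auto)
  finally show "(\<integral>\<^sup>+x. ennreal (indicator {0..} x * f x) \<partial>lborel) = ennreal (T - F 0)" .
  show "AE x in lborel. 0 \<le> indicator {0..} x * f x"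
    using nn by (intro AE_I2) (auto simp: indicator_def)
qed (use assms in auto)

lemma has_bochner_integral_exp_halfline:
  assumes "c > 0"
  shows "has_bochner_integral lborel (\<lambda>x::real. indicator {0..} x * exp (- (c * x))) (1 / c)"
proof -
  have "has_bochner_integral lborel (\<lambda>x::real. indicator {0..} x * exp (- (c * x))) (0 - (- exp (- (c * 0)) / c))"
  proof (rule has_bochner_integral_FTC_atLeast)
    fix x :: real
    show "((\<lambda>x. - exp (- (c * x)) / c) has_real_derivative exp (- (c * x))) (at x)"
      using assms by (auto intro!: derivative_eq_intros)
    show "((\<lambda>x. - exp (- (c * x)) / c) \<longlongrightarrow> 0) at_top"
      using assms by real_asymp
  qed (use assms in auto)
  then show ?thesis by simp
qed

lemma pattern_integral_nonneg: "0 \<le> pattern_integral a d"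
  unfolding pattern_integral_def by (intro integral_nonneg pattern_integrable) auto

lemma pattern_integral_0_pos: "0 < pattern_integral 0 d"
proof -
  have "integral {0..1} (\<lambda>v::real. 1 / 2 ^ d) \<le> pattern_integral 0 d"
    unfolding pattern_integral_def
    by (intro integral_le pattern_integrable) (auto intro!: divide_left_mono power_mono)
  then have "1 / 2 ^ d \<le> pattern_integral 0 d" by simp
  moreover have "0 < (1 / 2 ^ d :: real)" by simp
  ultimately show ?thesis by (rule less_le_trans[rotated])
qed

text \<open>The substitution v = exp (- c x).\<close>

lemma has_bochner_integral_pattern:
  assumes "c > 0"
  shows "has_bochner_integral lborel
    (\<lambda>x::real. indicator {0..} x * (exp (- (c * x)) ^ Suc a / (1 + exp (- (c * x))) ^ d)) (pattern_integral a d / c)"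
proof -
  define g where "g v = v ^ a / (1 + v) ^ d" for v :: real
  define P where "P v = integral {0..v} g" for v
  have g: "continuous_on {0..2} g"
    unfolding g_def by (intro continuous_intros) auto
  have dP: "(P has_real_derivative g v) (at v)" if "0 < v" "v < 2" for v
  proof -
    have "(P has_real_derivative g v) (at v within {0..2})"
      unfolding P_def by (rule integral_has_real_derivative[OF g]) (use that in auto)
    moreover have "v \<in> interior {0..2}" unfolding interior_atLeastAtMost_real using that by auto
    ultimately show ?thesis by (simp only: at_within_interior)
  qed
  have P0: "P 0 = 0" and P1: "P 1 = pattern_integral a d"
    by (simp_all add: P_def pattern_integral_def g_def[abs_def])
  have contP: "continuous_on {0..2} P"
    unfolding P_def by (rule indefinite_integral_continuous_1) (rule integrable_continuous_interval[OF g])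
  have "has_bochner_integral lborel
    (\<lambda>x::real. indicator {0..} x * (exp (- (c * x)) ^ Suc a / (1 + exp (- (c * x))) ^ d)) (0 - - (P (exp (- (c * 0))) / c))"
  proof (rule has_bochner_integral_FTC_atLeast)
    fix x :: real assume x: "0 \<le> x"
    have "exp (- (c * x)) \<le> 1" using x assms by simp
    then have "exp (- (c * x)) < 2" by linarith
    then have "((\<lambda>x. P (exp (- (c * x)))) has_real_derivative g (exp (- (c * x))) * (exp (- (c * x)) * (- c))) (at x)"
      by (intro DERIV_chain2[OF dP]) (auto intro!: derivative_eq_intros)
    from DERIV_minus[OF DERIV_cdivide[OF this, of c]]
    show "((\<lambda>x. - (P (exp (- (c * x))) / c)) has_real_derivative exp (- (c * x)) ^ Suc a / (1 + exp (- (c * x))) ^ d) (at x)"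
      by (rule DERIV_cong) (use assms in \<open>simp add: g_def\<close>)
  next
    have lim: "((\<lambda>x. exp (- (c * x))) \<longlongrightarrow> 0) at_top" using assms by real_asymp
    have ev: "\<forall>\<^sub>F x in at_top. exp (- (c * x)) \<in> {0..2}"
    proof (rule eventually_mono[OF eventually_ge_at_top[of 0]])
      fix x :: real assume "0 \<le> x"
      then have "exp (- (c * x)) \<le> 1" using assms by simp
      then have "exp (- (c * x)) \<le> 2" by linarith
      then show "exp (- (c * x)) \<in> {0..2}" by simp
    qed
    have "((\<lambda>x. P (exp (- (c * x)))) \<longlongrightarrow> P 0) at_top"
      by (rule continuous_on_tendsto_compose[OF contP lim _ ev]) simp
    from tendsto_minus[OF tendsto_divide[OF this tendsto_const, of c]]
    show "((\<lambda>x. - (P (exp (- (c * x))) / c)) \<longlongrightarrow> 0) at_top" using assms by (simp add: P0)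
  next
    show "- (P (exp (- (c * 0))) / c) \<le> 0"
      using assms pattern_integral_nonneg[of a d] by (simp add: P1)
    show "0 \<le> exp (- (c * x)) ^ Suc a / (1 + exp (- (c * x))) ^ d" for x :: real
      by (intro divide_nonneg_nonneg zero_le_power add_nonneg_nonneg) auto
  qed measurable
  then show ?thesis by (simp add: P1)
qed

lemma has_bochner_integral_step:
  fixes w :: "nat \<Rightarrow> real"
  assumes r: "r > 0" and w: "\<And>m. m \<notin> {1..n} \<Longrightarrow> w m = 0"
  shows "has_bochner_integral lborel (\<lambda>x. indicator {0<..} x * w (nat \<lceil>x * r\<rceil>)) ((\<Sum>m=1..n. w m) / r)"
proof -
  let ?I = "\<lambda>m. {(real m - 1) / r<..real m / r}"
  have "(\<lambda>x. indicator {0<..} x * w (nat \<lceil>x * r\<rceil>)) = (\<lambda>x. \<Sum>m=1..n. w m * indicator (?I m) x)"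
  proof
    fix x
    show "indicator {0<..} x * w (nat \<lceil>x * r\<rceil>) = (\<Sum>m=1..n. w m * indicator (?I m) x)"
    proof (cases "x > 0")
      case True
      define M where "M = nat \<lceil>x * r\<rceil>"
      have xr: "x * r > 0" using True r by simp
      have mem: "x \<in> ?I m \<longleftrightarrow> m = M" if "m \<ge> 1" for m
      proof -
        have "x \<in> ?I m \<longleftrightarrow> real m - 1 < x * r \<and> x * r \<le> real m"
          using r by (auto simp: pos_divide_less_eq pos_le_divide_eq)
        also have "\<dots> \<longleftrightarrow> \<lceil>x * r\<rceil> = int m" by (auto simp: ceiling_eq_iff)
        also have "\<dots> \<longleftrightarrow> m = M" using xr by (auto simp: M_def)
        finally show ?thesis .
      qed
      have "(\<Sum>m=1..n. w m * indicator (?I m) x) = (\<Sum>m=1..n. if m = M then w m else 0)"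
      proof (intro sum.cong refl)
        fix m assume "m \<in> {1..n}"
        then show "w m * indicator (?I m) x = (if m = M then w m else 0)"
          using mem[of m] by (simp only: indicator_def atLeastAtMost_iff) simp
      qed
      also have "\<dots> = w M" using w[of M] by auto
      finally show ?thesis using True by (simp add: M_def)
    next
      case False
      have "x \<notin> ?I m" if "m \<in> {1..n}" for m
      proof -
        have "0 \<le> (real m - 1) / r" using that r by simp
        then show ?thesis using False by auto
      qed
      then have "(\<Sum>m=1..n. w m * indicator (?I m) x) = 0" by (intro sum.neutral) auto
      then show ?thesis using False by simp
    qed
  qed
  moreover have "has_bochner_integral lborel (\<lambda>x. \<Sum>m=1..n. w m * indicator (?I m) x) (\<Sum>m=1..n. w m * measure lborel (?I m))"
  proof (rule has_bochner_integral_sum)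
    fix m assume "m \<in> {1..n}"
    have "(real m - 1) / r \<le> real m / r" using r by (intro divide_right_mono) auto
    then have "emeasure lborel (?I m) < \<infinity>" by simp
    then have "has_bochner_integral lborel (indicator (?I m) :: real \<Rightarrow> real) (measure lborel (?I m))"
      by (intro has_bochner_integral_real_indicator) auto
    then show "has_bochner_integral lborel (\<lambda>x. w m * indicator (?I m) x) (w m * measure lborel (?I m))"
      by (intro has_bochner_integral_mult_right)
  qed
  moreover have "measure lborel (?I m) = 1 / r" for m
  proof -
    have "(real m - 1) / r \<le> real m / r" using r by (intro divide_right_mono) auto
    then show ?thesis by (simp add: diff_divide_distrib)
  qed
  ultimately show ?thesis by (simp add: sum_divide_distrib)
qed

subsection \<open>Summation over the corners\<close>

definition pattern_weight :: "nat set \<Rightarrow> nat \<Rightarrow> nat \<Rightarrow> nat \<Rightarrow> real" where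
  "pattern_weight T d n m = (if d \<le> m \<and> m \<le> n then
     (\<Prod>k\<in>(-) m ` T. exp (- real k * saddle n)) / (\<Prod>k\<in>(-) m ` {..<d}. 1 + exp (- real k * saddle n)) *
     Re (local_weight n ((-) m ` {..<d}) (\<Sum>((-) m ` T))) else 0)"

lemma prescribed_count_eq_weight:
  assumes n: "n > 0" and m: "d \<le> m" "m \<le> n" and T: "T \<subseteq> {..<d}"
  shows "real (prescribed_count n ((-) m ` T) ((-) m ` {..<d})) =
    exp (real n * saddle n) * (\<Prod>k=1..n. 1 + exp (- real k * saddle n)) / real n powr (3/4) * pattern_weight T d n m"
proof -
  let ?U = "(-) m ` T" and ?W = "(-) m ` {..<d}"
  let ?C = "exp (real n * saddle n) * (\<Prod>k=1..n. 1 + exp (- real k * saddle n))"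
  let ?p = "(\<Prod>k\<in>?U. exp (- real k * saddle n)) / (\<Prod>k\<in>?W. 1 + exp (- real k * saddle n))"
  have UW: "?U \<subseteq> ?W" "?W \<subseteq> {1..n}" using m T by auto
  have "real (prescribed_count n ?U ?W) = Re (of_nat (prescribed_count n ?U ?W))" by simp
  also have "\<dots> = ?C * ?p * Re (fourier_coeff (saddle n) n ?W (\<Sum>?U))"
  proof -
    have "Re (of_real c * w) = c * Re w" for c w by simp
    then show ?thesis unfolding prescribed_count_fourier[OF UW, where z = "saddle n"] .
  qed
  also have "Re (fourier_coeff (saddle n) n ?W (\<Sum>?U)) = Re (local_weight n ?W (\<Sum>?U)) / real n powr (3/4)"
    using n by (simp add: local_weight_def)
  also have "?C * ?p * (Re (local_weight n ?W (\<Sum>?U)) / real n powr (3/4)) =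
      ?C / real n powr (3/4) * (?p * Re (local_weight n ?W (\<Sum>?U)))"
    by (simp only: times_divide_eq_right times_divide_eq_left mult_ac)
  also have "?p * Re (local_weight n ?W (\<Sum>?U)) = pattern_weight T d n m"
    unfolding pattern_weight_def by (rule if_P[symmetric]) (use m in simp)
  finally show ?thesis .
qed

lemma pattern_weight_bound:
  assumes T: "T \<in> hook_patterns h d" and d: "1 \<le> d" "d \<le> h" and n: "n > 0"
  shows "\<bar>pattern_weight T d n m\<bar> \<le> char_bound h * exp (- (real m * saddle n))"
proof (cases "d \<le> m \<and> m \<le> n")
  case True
  let ?U = "(-) m ` T" and ?W = "(-) m ` {..<d}"
  have z: "saddle n > 0" by (rule saddle_pos[OF n])
  have TT: "T \<subseteq> {..<d}" "0 \<in> T" using T by (auto simp: hook_patterns_def)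
  have fin: "finite ?U" using TT finite_subset by blast
  have mU: "m \<in> ?U" using TT(2) by (intro image_eqI[of _ _ 0]) auto
  have "(\<Prod>k\<in>?U. exp (- real k * saddle n)) = exp (- real m * saddle n) * (\<Prod>k\<in>?U - {m}. exp (- real k * saddle n))"
    by (rule prod.remove[OF fin mU])
  also have "\<dots> \<le> exp (- real m * saddle n) * 1"
    using z by (intro mult_left_mono prod_le_1) auto
  finally have 1: "(\<Prod>k\<in>?U. exp (- real k * saddle n)) \<le> exp (- (real m * saddle n))" by simp
  have 2: "1 \<le> (\<Prod>k\<in>?W. 1 + exp (- real k * saddle n))" by (intro prod_ge_1) auto
  have "(\<Prod>k\<in>?U. exp (- real k * saddle n)) / (\<Prod>k\<in>?W. 1 + exp (- real k * saddle n)) \<le> exp (- (real m * saddle n)) / 1"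
    using 1 2 by (intro frac_le prod_nonneg) auto
  then have p: "(\<Prod>k\<in>?U. exp (- real k * saddle n)) / (\<Prod>k\<in>?W. 1 + exp (- real k * saddle n)) \<le> exp (- (real m * saddle n))"
    by simp
  have p0: "0 \<le> (\<Prod>k\<in>?U. exp (- real k * saddle n)) / (\<Prod>k\<in>?W. 1 + exp (- real k * saddle n))"
    using 2 by (intro divide_nonneg_nonneg prod_nonneg) auto
  have "card ?W \<le> h" using card_image_le[of "{..<d}" "(-) m"] d by simp
  then have "norm (local_weight n ?W (\<Sum>?U)) \<le> char_bound h"
    by (intro norm_local_weight_le n) auto
  then have L: "\<bar>Re (local_weight n ?W (\<Sum>?U))\<bar> \<le> char_bound h"
    using abs_Re_le_cmod order_trans by blast
  have "\<bar>pattern_weight T d n m\<bar> = (\<Prod>k\<in>?U. exp (- real k * saddle n)) / (\<Prod>k\<in>?W. 1 + exp (- real k * saddle n)) *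
      \<bar>Re (local_weight n ?W (\<Sum>?U))\<bar>"
    unfolding pattern_weight_def if_P[OF True] abs_mult abs_of_nonneg[OF p0] ..
  also have "\<dots> \<le> exp (- (real m * saddle n)) * char_bound h"
    by (intro mult_mono p L) auto
  finally show ?thesis by (simp add: mult.commute)
next
  case False
  then have "pattern_weight T d n m = 0" unfolding pattern_weight_def by (rule if_not_P)
  then show ?thesis using tail_const_nonneg by (simp add: char_bound_def)
qed

lemma pattern_weight_tendsto:
  fixes x :: real
  assumes T: "T \<in> hook_patterns h d" and d: "1 \<le> d" "d \<le> h" and x: "x > 0"
  shows "(\<lambda>n. pattern_weight T d n (nat \<lceil>x * sqrt (real n)\<rceil>)) \<longlonglongrightarrow>
    exp (- (saddle_const * x)) ^ Suc (h - d) / (1 + exp (- (saddle_const * x))) ^ d * local_limit"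
proof -
  define m where "m n = nat \<lceil>x * sqrt (real n)\<rceil>" for n
  define v where "v = exp (- (saddle_const * x))"
  define W where "W n = (if d \<le> m n \<and> m n \<le> n then (-) (m n) ` {..<d} else {})" for n
  define j where "j n = (if d \<le> m n \<and> m n \<le> n then \<Sum>((-) (m n) ` T) else 0)" for n
  have TT: "T \<subseteq> {..<d}" "0 \<in> T" "card T = Suc (h - d)" using T by (auto simp: hook_patterns_def)
  then have finT: "finite T" using finite_subset by blast
  have m_bounds: "x * sqrt (real n) \<le> real (m n)" "real (m n) < x * sqrt (real n) + 1" for n
  proof -
    have "0 \<le> x * sqrt (real n)" using x by simp
    then show "x * sqrt (real n) \<le> real (m n)" "real (m n) < x * sqrt (real n) + 1"
      unfolding m_def by linarith+
  qed
  have m_le: "real (m n) \<le> (x + 1) * sqrt (real n)" if "n > 0" for n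
  proof -
    have "1 \<le> sqrt (real n)" using that by simp
    then show ?thesis using m_bounds(2)[of n] unfolding distrib_right mult_1 by linarith
  qed
  have ev: "\<forall>\<^sub>F n in sequentially. d \<le> m n \<and> m n \<le> n"
  proof -
    have "filterlim (\<lambda>n. x * sqrt (real n)) at_top sequentially" using x by real_asymp
    then have "\<forall>\<^sub>F n in sequentially. real d \<le> x * sqrt (real n)"
      by (rule filterlim_at_top[THEN iffD1, rule_format])
    moreover have "\<forall>\<^sub>F n in sequentially. x * sqrt (real n) + 1 \<le> real n" using x by real_asymp
    ultimately show ?thesis
    proof eventually_elim
      case (elim n)
      then show ?case using m_bounds[of n] by linarith
    qed
  qed
  have "(\<lambda>n. local_weight n (W n) (j n)) \<longlonglongrightarrow> of_real local_limit"
  proof (rule local_weight_tendsto[where h = h and C = "x + 1" and Y = "real d * (x + 1)"])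
    fix n
    show "finite (W n)" by (simp add: W_def)
    show "card (W n) \<le> h"
      using card_image_le[of "{..<d}" "(-) (m n)"] d by (auto simp: W_def)
    show "W n \<subseteq> {1..n}" by (auto simp: W_def)
    have npos: "n > 0" if "d \<le> m n \<and> m n \<le> n" using that d by linarith
    show "real k \<le> (x + 1) * sqrt (real n)" if "k \<in> W n" for k
    proof -
      have "d \<le> m n \<and> m n \<le> n" "k \<le> m n" using that by (auto simp: W_def split: if_splits)
      then show ?thesis using m_le[OF npos] by linarith
    qed
    show "real (j n) \<le> real d * (x + 1) * sqrt (real n)"
    proof (cases "d \<le> m n \<and> m n \<le> n")
      case True
      have "\<Sum>((-) (m n) ` T) \<le> card ((-) (m n) ` T) * m n"
      proof -
        have "(\<Sum>k\<in>(-) (m n) ` T. k) \<le> of_nat (card ((-) (m n) ` T)) * m n"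
          by (rule sum_bounded_above) auto
        then show ?thesis by simp
      qed
      also have "\<dots> \<le> d * m n"
      proof (rule mult_right_mono)
        have "card ((-) (m n) ` T) \<le> card T" by (rule card_image_le[OF finT])
        also have "\<dots> \<le> d" using card_mono[OF _ TT(1)] by simp
        finally show "card ((-) (m n) ` T) \<le> d" .
      qed simp
      finally have "j n \<le> d * m n" using True by (simp add: j_def)
      then have "real (j n) \<le> real d * real (m n)" by (metis of_nat_le_iff of_nat_mult)
      also have "\<dots> \<le> real d * ((x + 1) * sqrt (real n))"
        by (intro mult_left_mono m_le npos[OF True]) auto
      finally show ?thesis by (simp add: mult.assoc)
    next
      case False
      then have "j n = 0" by (simp only: j_def if_False)
      then show ?thesis using x by simp
    qed
  qed
  from tendsto_Re[OF this] have L: "(\<lambda>n. Re (local_weight n (W n) (j n))) \<longlonglongrightarrow> local_limit" by simp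
  have zlim: "(\<lambda>n. (real (m n) - real t) * saddle n) \<longlonglongrightarrow> saddle_const * x" for t
  proof -
    have c: "saddle_const > 0" by (rule saddle_const_pos)
    have "(\<lambda>n. (x * sqrt (real n) - real t) * (saddle_const / sqrt (real n))) \<longlonglongrightarrow> saddle_const * x"
      using c x by real_asymp
    then have lo: "(\<lambda>n. (x * sqrt (real n) - real t) * saddle n) \<longlonglongrightarrow> saddle_const * x"
      unfolding saddle_def .
    have "(\<lambda>n. (x * sqrt (real n) + 1 - real t) * (saddle_const / sqrt (real n))) \<longlonglongrightarrow> saddle_const * x"
      using c x by real_asymp
    then have hi: "(\<lambda>n. (x * sqrt (real n) + 1 - real t) * saddle n) \<longlonglongrightarrow> saddle_const * x"
      unfolding saddle_def .
    have z0: "saddle n \<ge> 0" for n using c by (simp add: saddle_def)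
    show ?thesis
      by (rule tendsto_sandwich[OF _ _ lo hi])
         (use m_bounds z0 in \<open>auto intro!: always_eventually mult_right_mono simp: less_imp_le\<close>)
  qed
  have elim_lim: "(\<lambda>n. exp (- ((real (m n) - real t) * saddle n))) \<longlonglongrightarrow> v" for t
    unfolding v_def by (intro tendsto_intros zlim)
  have U: "(\<lambda>n. \<Prod>t\<in>T. exp (- ((real (m n) - real t) * saddle n))) \<longlonglongrightarrow> (\<Prod>t\<in>T. v)"
    by (intro tendsto_prod elim_lim)
  have V: "(\<lambda>n. \<Prod>t<d. 1 + exp (- ((real (m n) - real t) * saddle n))) \<longlonglongrightarrow> (\<Prod>t<d. 1 + v)"
    by (intro tendsto_intros tendsto_prod elim_lim)
  have "1 + v > 0" by (simp add: v_def add_pos_pos)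
  then have "(\<lambda>n. (\<Prod>t\<in>T. exp (- ((real (m n) - real t) * saddle n))) / (\<Prod>t<d. 1 + exp (- ((real (m n) - real t) * saddle n))) *
      Re (local_weight n (W n) (j n))) \<longlonglongrightarrow> (\<Prod>t\<in>T. v) / (\<Prod>t<d. 1 + v) * local_limit"
    by (intro tendsto_mult tendsto_divide U V L) simp
  then have "(\<lambda>n. (\<Prod>t\<in>T. exp (- ((real (m n) - real t) * saddle n))) / (\<Prod>t<d. 1 + exp (- ((real (m n) - real t) * saddle n))) *
      Re (local_weight n (W n) (j n))) \<longlonglongrightarrow> v ^ Suc (h - d) / (1 + v) ^ d * local_limit"
    by (simp only: prod_constant TT(3) card_lessThan)
  moreover have "\<forall>\<^sub>F n in sequentially. (\<Prod>t\<in>T. exp (- ((real (m n) - real t) * saddle n))) /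
      (\<Prod>t<d. 1 + exp (- ((real (m n) - real t) * saddle n))) * Re (local_weight n (W n) (j n)) = pattern_weight T d n (m n)"
    using ev
  proof eventually_elim
    case (elim n)
    have sub: "real (m n - t) = real (m n) - real t" if "t < d" for t using elim that by simp
    have injd: "inj_on ((-) (m n)) {..<d}" using elim by (auto simp: inj_on_def)
    have "(\<Prod>k\<in>(-) (m n) ` T. exp (- real k * saddle n)) = (\<Prod>t\<in>T. exp (- ((real (m n) - real t) * saddle n)))"
      using sub TT(1) by (subst prod.reindex[OF inj_on_subset[OF injd TT(1)]]) (auto intro!: prod.cong)
    moreover have "(\<Prod>k\<in>(-) (m n) ` {..<d}. 1 + exp (- real k * saddle n)) = (\<Prod>t<d. 1 + exp (- ((real (m n) - real t) * saddle n)))"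
      using sub by (subst prod.reindex[OF injd]) (auto intro!: prod.cong)
    ultimately show ?case
      using elim by (simp only: pattern_weight_def W_def j_def if_True simp_thms)
  qed
  ultimately show ?thesis
    unfolding v_def m_def by (rule Lim_transform_eventually)
qed

lemma pattern_weight_sum_tendsto:
  assumes T: "T \<in> hook_patterns h d" and d: "1 \<le> d" "d \<le> h"
  shows "(\<lambda>n. (\<Sum>m=d..n. pattern_weight T d n m) / sqrt (real n)) \<longlonglongrightarrow>
    local_limit * (pattern_integral (h - d) d / saddle_const)"
proof -
  let ?c = saddle_const
  let ?s = "\<lambda>n x. indicator {0<..} x * pattern_weight T d n (nat \<lceil>x * sqrt (real n)\<rceil>)"
  let ?f = "\<lambda>x::real. indicator {0..} x * (exp (- (?c * x)) ^ Suc (h - d) / (1 + exp (- (?c * x))) ^ d)"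
  let ?b = "\<lambda>x::real. indicator {0..} x * exp (- (?c * x))"
  have step: "has_bochner_integral lborel (?s n) ((\<Sum>m=1..n. pattern_weight T d n m) / sqrt (real n))" if "n > 0" for n
    by (rule has_bochner_integral_step) (use that d in \<open>auto simp: pattern_weight_def\<close>)
  have f: "has_bochner_integral lborel ?f (pattern_integral (h - d) d / ?c)"
    by (rule has_bochner_integral_pattern[OF saddle_const_pos])
  have b: "has_bochner_integral lborel ?b (1 / ?c)"
    by (rule has_bochner_integral_exp_halfline[OF saddle_const_pos])
  have "(\<lambda>n. LBINT x. ?s (Suc n) x) \<longlonglongrightarrow> (LBINT x. ?f x * local_limit)"
  proof (rule integral_dominated_convergence)
    show "(\<lambda>x. ?f x * local_limit) \<in> borel_measurable lborel" by measurable
    show "?s (Suc n) \<in> borel_measurable lborel" for n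
      using step[of "Suc n"] by (auto dest: borel_measurable_has_bochner_integral)
    show "integrable lborel (\<lambda>x. char_bound h * ?b x)"
      using b by (intro integrable_mult_right) (auto simp: has_bochner_integral_iff)
    have "AE x in lborel. x \<noteq> (0::real)" by (rule AE_lborel_singleton)
    then show "AE x in lborel. (\<lambda>n. ?s (Suc n) x) \<longlonglongrightarrow> ?f x * local_limit"
    proof (rule AE_mp, intro AE_I2 impI)
      fix x :: real assume "x \<noteq> 0"
      show "(\<lambda>n. ?s (Suc n) x) \<longlonglongrightarrow> ?f x * local_limit"
      proof (cases "x > 0")
        case True
        then show ?thesis
          using LIMSEQ_Suc[OF pattern_weight_tendsto[OF T d True]] by simp
      next
        case False
        with \<open>x \<noteq> 0\<close> show ?thesis by simp
      qed
    qed
    show "AE x in lborel. norm (?s (Suc n) x) \<le> char_bound h * ?b x" for n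
    proof (rule AE_I2)
      fix x :: real
      show "norm (?s (Suc n) x) \<le> char_bound h * ?b x"
      proof (cases "x > 0")
        case True
        let ?m = "nat \<lceil>x * sqrt (real (Suc n))\<rceil>"
        have "\<bar>pattern_weight T d (Suc n) ?m\<bar> \<le> char_bound h * exp (- (real ?m * saddle (Suc n)))"
          by (rule pattern_weight_bound[OF T d]) simp
        also have "\<dots> \<le> char_bound h * exp (- (?c * x))"
        proof (intro mult_left_mono)
          have "0 \<le> x * sqrt (real (Suc n))" using True by simp
          then have "x * sqrt (real (Suc n)) \<le> real ?m" by linarith
          then have "x * sqrt (real (Suc n)) * saddle (Suc n) \<le> real ?m * saddle (Suc n)"
            using saddle_pos[of "Suc n"] by (intro mult_right_mono) auto
          moreover have "x * sqrt (real (Suc n)) * saddle (Suc n) = ?c * x"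
            by (simp add: saddle_def)
          ultimately show "exp (- (real ?m * saddle (Suc n))) \<le> exp (- (?c * x))"
            unfolding exp_le_cancel_iff by linarith
        qed (use tail_const_nonneg in \<open>simp add: char_bound_def\<close>)
        finally show ?thesis using True by simp
      next
        case False
        have "0 \<le> char_bound h * ?b x" using tail_const_nonneg by (simp add: char_bound_def)
        then show ?thesis using False by simp
      qed
    qed
  qed
  also have "(LBINT x. ?f x * local_limit) = local_limit * (pattern_integral (h - d) d / ?c)"
  proof -
    have "has_bochner_integral lborel (\<lambda>x. ?f x * local_limit) (pattern_integral (h - d) d / ?c * local_limit)"
      by (intro has_bochner_integral_mult_left f)
    from has_bochner_integral_integral_eq[OF this] show ?thesis
      unfolding mult.commute[of local_limit] .
  qed
  finally have "(\<lambda>n. LBINT x. ?s n x) \<longlonglongrightarrow> local_limit * (pattern_integral (h - d) d / ?c)"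
    by (rule LIMSEQ_imp_Suc)
  moreover have "\<forall>\<^sub>F n in sequentially. (LBINT x. ?s n x) = (\<Sum>m=d..n. pattern_weight T d n m) / sqrt (real n)"
  proof (rule eventually_mono[OF eventually_gt_at_top[of 0]])
    fix n :: nat assume n: "n > 0"
    have "(LBINT x. ?s n x) = (\<Sum>m=1..n. pattern_weight T d n m) / sqrt (real n)"
      by (rule has_bochner_integral_integral_eq[OF step[OF n]])
    also have "(\<Sum>m=1..n. pattern_weight T d n m) = (\<Sum>m=d..n. pattern_weight T d n m)"
      by (rule sum.mono_neutral_right) (use d in \<open>auto simp: pattern_weight_def\<close>)
    finally show "(LBINT x. ?s n x) = (\<Sum>m=d..n. pattern_weight T d n m) / sqrt (real n)" .
  qed
  ultimately show ?thesis by (rule Lim_transform_eventually)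
qed

lemma card_hook_patterns:
  assumes "1 \<le> d" "d \<le> h"
  shows "card (hook_patterns h d) = (d - 1) choose (h - d)"
proof -
  have "bij_betw (insert 0) {B. B \<subseteq> {1..<d} \<and> card B = h - d} (hook_patterns h d)"
  proof (rule bij_betwI[where g = "\<lambda>T. T - {0}"])
    show "insert 0 \<in> {B. B \<subseteq> {1..<d} \<and> card B = h - d} \<rightarrow> hook_patterns h d"
    proof
      fix B assume B: "B \<in> {B. B \<subseteq> {1..<d} \<and> card B = h - d}"
      then have "finite B" "0 \<notin> B" using finite_subset by auto
      then show "insert 0 B \<in> hook_patterns h d"
        using B assms by (auto simp: hook_patterns_def)
    qed
    show "(\<lambda>T. T - {0}) \<in> hook_patterns h d \<rightarrow> {B. B \<subseteq> {1..<d} \<and> card B = h - d}"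
      by (auto simp: hook_patterns_def Suc_le_eq)
  qed (auto simp: hook_patterns_def)
  from bij_betw_same_card[OF this] show ?thesis by (simp add: n_subsets)
qed

lemma hook_const_pos:
  assumes "h \<ge> 1"
  shows "hook_const h > 0"
proof -
  have "0 < real ((h - 1) choose (h - h)) * pattern_integral (h - h) h"
    using pattern_integral_0_pos[of h] by simp
  also have "\<dots> \<le> hook_const h"
    unfolding hook_const_def
    by (rule member_le_sum[where f = "\<lambda>d. real ((d - 1) choose (h - d)) * pattern_integral (h - d) d"])
       (use assms pattern_integral_nonneg in auto)
  finally show ?thesis .
qed

lemma hook_count_ratio_tendsto:
  "(\<lambda>n. real (hook_count h n) / (3 powr (1/4) / (2 * pi * real n powr (1/4)) * exp (pi * sqrt (real n / 3))))
    \<longlonglongrightarrow> hook_const h"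
proof -
  define A where "A n = exp (real n * saddle n) * (\<Prod>k=1..n. 1 + exp (- real k * saddle n)) / exp (pi * sqrt (real n / 3))" for n
  define S where "S n = (\<Sum>d=1..h. \<Sum>T\<in>hook_patterns h d. (\<Sum>m=d..n. pattern_weight T d n m) / sqrt (real n))" for n
  have "S \<longlonglongrightarrow> (\<Sum>d=1..h. \<Sum>T\<in>hook_patterns h d. local_limit * (pattern_integral (h - d) d / saddle_const))"
    unfolding S_def by (intro tendsto_sum pattern_weight_sum_tendsto) auto
  moreover have "(\<Sum>d=1..h. \<Sum>T\<in>hook_patterns h d. local_limit * (pattern_integral (h - d) d / saddle_const)) =
      local_limit / saddle_const * hook_const h"
    by (simp add: card_hook_patterns hook_const_def sum_distrib_left mult_ac)
  ultimately have S: "S \<longlonglongrightarrow> local_limit / saddle_const * hook_const h" by simp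
  have "(\<lambda>n. 2 * pi / 3 powr (1/4) * (A n * S n)) \<longlonglongrightarrow> 2 * pi / 3 powr (1/4) * (1 / sqrt 2 * (local_limit / saddle_const * hook_const h))"
    unfolding A_def by (intro tendsto_mult tendsto_const S partition_product_asymp)
  moreover have "2 * pi / 3 powr (1/4) * (1 / sqrt 2 * (local_limit / saddle_const * hook_const h)) = hook_const h"
  proof -
    have "3 powr (1/4) * 3 powr (1/4) = sqrt (3 :: real)"
      by (simp add: powr_half_sqrt[symmetric] flip: powr_add)
    then have "2 * pi / 3 powr (1/4) * (1 / sqrt 2 * (local_limit / saddle_const)) = 1"
      by (simp add: local_limit_eq saddle_const_def mult_ac)
    then show ?thesis by (simp only: mult.assoc[symmetric] mult_1)
  qed
  moreover have "\<forall>\<^sub>F n in sequentially. 2 * pi / 3 powr (1/4) * (A n * S n) =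
     real (hook_count h n) / (3 powr (1/4) / (2 * pi * real n powr (1/4)) * exp (pi * sqrt (real n / 3)))"
  proof (rule eventually_mono[OF eventually_gt_at_top[of 0]])
    fix n :: nat assume n: "n > 0"
    let ?C = "exp (real n * saddle n) * (\<Prod>k=1..n. 1 + exp (- real k * saddle n))"
    let ?e = "exp (pi * sqrt (real n / 3))"
    have "real (hook_count h n) = (\<Sum>d=1..h. \<Sum>T\<in>hook_patterns h d. \<Sum>m=d..n.
        real (prescribed_count n ((-) m ` T) ((-) m ` {..<d})))"
      unfolding hook_count_eq by simp
    also have "\<dots> = (\<Sum>d=1..h. \<Sum>T\<in>hook_patterns h d. \<Sum>m=d..n. ?C / real n powr (3/4) * pattern_weight T d n m)"
      by (intro sum.cong refl prescribed_count_eq_weight[OF n]) (auto simp: hook_patterns_def)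
    also have "\<dots> = ?C / real n powr (3/4) * (sqrt (real n) * S n)"
      using n unfolding S_def by (simp add: sum_distrib_left sum_divide_distrib)
    finally have hc: "real (hook_count h n) = ?C / real n powr (3/4) * (sqrt (real n) * S n)" .
    have pw: "real n powr (3/4) = sqrt (real n) * real n powr (1/4)"
      using n by (simp add: powr_half_sqrt[symmetric] flip: powr_add)
    have C: "?C = A n * ?e" by (simp add: A_def)
    have pos: "sqrt (real n) > 0" "real n powr (1/4) > 0" "?e > 0" "(3::real) powr (1/4) > 0" "pi > 0" using n by auto
    have gen: "2 * p / t * (a * s) = a * e / (r * q) * (r * s) / (t / (2 * p * q) * e)"
      if "r > 0" "q > 0" "e > 0" "t > 0" "p > 0" for p t a s e r q :: real
      using that by (simp add: field_simps)
    show "2 * pi / 3 powr (1/4) * (A n * S n) =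
       real (hook_count h n) / (3 powr (1/4) / (2 * pi * real n powr (1/4)) * ?e)"
      unfolding hc pw C by (rule gen[OF pos])
  qed
  ultimately show ?thesis by (simp only: tendsto_cong)
qed

theorem theorem1p5:
  fixes h :: nat
  assumes "h \<ge> 1"
  shows "\<exists>\<beta>\<in>Rats_ln2.
      (\<lambda>n. real (hook_count h n)) \<sim>[at_top]
        (\<lambda>n. \<beta> * (3 powr (1/4) / (2 * pi * real n powr (1/4))) * exp (pi * sqrt (real n / 3)))
      \<and> (\<beta> \<in> \<rat> \<longleftrightarrow> even h)"
proof (intro bexI conjI)
  have pos: "hook_const h > 0" by (rule hook_const_pos[OF assms])
  have "(\<lambda>n. real (hook_count h n) / (3 powr (1/4) / (2 * pi * real n powr (1/4)) * exp (pi * sqrt (real n / 3))) / hook_const h)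
     \<longlonglongrightarrow> hook_const h / hook_const h"
    using pos by (intro tendsto_divide hook_count_ratio_tendsto tendsto_const) auto
  then have "(\<lambda>n. real (hook_count h n) / (hook_const h * (3 powr (1/4) / (2 * pi * real n powr (1/4))) * exp (pi * sqrt (real n / 3))))
     \<longlonglongrightarrow> 1"
    using pos by (simp only: divide_divide_eq_left mult_ac divide_self less_imp_neq[symmetric] not_False_eq_True)
  then show "(\<lambda>n. real (hook_count h n)) \<sim>[at_top]
        (\<lambda>n. hook_const h * (3 powr (1/4) / (2 * pi * real n powr (1/4))) * exp (pi * sqrt (real n / 3)))"
    by (rule asymp_equivI')
  show "hook_const h \<in> \<rat> \<longleftrightarrow> even h" by (rule hook_const_rational_iff)
  show "hook_const h \<in> Rats_ln2" by (rule hook_const_in_Rats_ln2)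
qed

end
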